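(* Let $N\in\mathbb N\setminus\{1\}$ and let the pair $(c,d)\in\mathbb N^2$ be such that $c\ge d$. Let $g_{-1}(X)\in(\mathbb Z/N\mathbb Z)[X]$ be a polynomial of degree $c$ and let $g_0(X)\in(\mathbb Z/N\mathbb Z)[X]$ be a monic polynomial of degree $d$. Let $\iota\in\{1,\ldots,d\}$ be the unique integer such that there exists an $\iota$-tuple $(g_1,\ldots,g_\iota)\in(\mathbb Z/N\mathbb Z)[X]^\iota$ with the property that the leading coefficients of $g_1,\ldots,g_{\iota-1}$ are units of $\mathbb Z/N\mathbb Z$, either $g_\iota=0$ or the leading coefficient of $g_\iota$ is not a unit of $\mathbb Z/N\mathbb Z$, and for each $i\in\{1,\ldots,\iota\}$, $g_i$ is the remainder of the division of $g_{i-2}(X)$ by $g_{i-1}(X)$ (i.e., there exists a unique $h_i\in(\mathbb Z/N\mathbb Z)[X]$ such that $g_{i-2}(X)=g_{i-1}(X)h_i(X)+g_i(X)$ and $\deg(g_i)<\deg(g_{i-1})$). For $e\in\mathbb N$ with $e\ge d$ let $$B_{e,d,\iota}:=d\left(e+\iota-\frac{d(\iota+1)}{2\iota}\right)-\frac{\iota(\iota-1)}2\in[d(e+1-d),de]\cap\mathbb Q.$$ Then the following properties hold. (1) If $g_\iota=0$, then $\bigl(g_{-1}(X),g_0(X)\bigr)=\bigl(g_{\iota-1}(X)\bigr)$ as ideals of $(\mathbb Z/N\mathbb Z)[X]$ and the cost of finding $g_{\iota-1}$ is bounded by $$\left(B_{c+\iota-1,d,\iota}-\frac{\iota(\iota-1)}2\right)M_{\mathrm{mod}}(N)+B_{c,d,\iota}O(\log_2N)+O\bigl(2(\iota-1)M(\lfloor\log_2N\rfloor+1)\log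 N\bigr).$$ (2) If $g_\iota\ne0$, then the cost of finding a proper divisor of $N$ is bounded by $$\left(B_{c+\iota-1,d,\iota}-\frac{\iota(\iota-1)}2\right)M_{\mathrm{mod}}(N)+B_{c,d,\iota}O(\log_2N)+O\bigl((2\iota-1)M(\lfloor\log_2N\rfloor+1)\log N\bigr).$$
   Context: $\mathbb N$ is the set of positive integers. A proper divisor of $N$ is a divisor different from $1$ and $N$. Cost means number of word operations. $M:\mathbb N\to(0,\infty)$ is a multiplication time function for $\mathbb Z$: two integers of bit length at most $n$ can be multiplied using at most $M(n)$ word operations. $M_{\mathrm{mod}}:\mathbb N\to(0,\infty)$ is a modular multiplication time function: for each $N\in\mathbb N$, one multiplication in $\mathbb Z/N\mathbb Z$ can be performed using $M_{\mathrm{mod}}(N)$ word operations. One has $M_{\mathrm{mod}}(N)=O(M(\lfloor\log_2N\rfloor+1))$; the gcd of $b\in\{2,\ldots,N-1\}$ with $N$, and the inverse of $b$ modulo $N$ when $\gcd(b,N)=1$, can be computed at the cost $O(M(\lfloor\log_2N\rfloor+1)\log N)$. The zero polynomial is regarded as having degree smaller than that of every nonzero polynomial.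
   Formalization: The existence of ι in {1,…,d} is assumed, not asserted: it can fail (for g_{-1}=X+1, g_0=X one has g_1=1, and the process would only stop at ι=2>d=1). The theorem covers all data for which such an ι exists and proves its uniqueness. *)

theory Defs
  imports
    Complex_Main
    "HOL-Library.Word"
    "HOL-Library.Landau_Symbols"
    "HOL-Algebra.UnivPoly"
    "HOL-Number_Theory.Residues"
begin

section \<open>Word operations\<close>

text \<open>
  Costs are counted on a structured random access machine with words of a fixed but arbitrary
  length \<open>LENGTH('w)\<close>. The machine has word registers, index registers (natural numbers, used as
  addresses and loop counters) and named memory areas, whose cells hold one word each and are
  addressed by two index registers. Index registers can only be cleared, copied, incremented,
  decremented, compared, and exchanged with words; the lack of index addition prevents packing long
  integers into an index register. A program is a fixed piece of text that does not depend on its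
  input; in particular it names only finitely many registers and memory areas.
\<close>

record (overloaded) ('w :: len) state =
  wreg :: "nat \<Rightarrow> 'w word"
  ireg :: "nat \<Rightarrow> nat"
  mem :: "nat \<Rightarrow> nat \<Rightarrow> nat \<Rightarrow> 'w word"

datatype word_op =
  WAdd | WSub | WMul | WMulHigh | WDiv | WMod | WAnd | WOr | WXor | WShiftL | WShiftR

fun eval_op :: "word_op \<Rightarrow> 'w::len word \<Rightarrow> 'w word \<Rightarrow> 'w word" where
  "eval_op WAdd x y = x + y"
| "eval_op WSub x y = x - y"
| "eval_op WMul x y = x * y"
| "eval_op WMulHigh x y = of_nat (unat x * unat y div 2 ^ LENGTH('w))"
| "eval_op WDiv x y = x div y"
| "eval_op WMod x y = x mod y"
| "eval_op WAnd x y = and x y"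
| "eval_op WOr x y = or x y"
| "eval_op WXor x y = xor x y"
| "eval_op WShiftL x y = push_bit (unat y) x"
| "eval_op WShiftR x y = drop_bit (unat y) x"

datatype instr =
    Const nat nat
  | Copy nat nat
  | Op word_op nat nat nat
  | Load nat nat nat nat
  | Store nat nat nat nat
  | IndexZero nat
  | IndexCopy nat nat
  | IndexInc nat
  | IndexDec nat
  | IndexOfWord nat nat
  | WordOfIndex nat nat

text \<open>
  The first argument of \<open>Load\<close> is the target register and that of \<open>Store\<close> the memory area.
\<close>

fun step :: "instr \<Rightarrow> 'w::len state \<Rightarrow> 'w state" where
  "step (Const r k) s = s\<lparr>wreg := (wreg s)(r := of_nat k)\<rparr>"
| "step (Copy r r1) s = s\<lparr>wreg := (wreg s)(r := wreg s r1)\<rparr>"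
| "step (Op f r r1 r2) s = s\<lparr>wreg := (wreg s)(r := eval_op f (wreg s r1) (wreg s r2))\<rparr>"
| "step (Load r a i j) s = s\<lparr>wreg := (wreg s)(r := mem s a (ireg s i) (ireg s j))\<rparr>"
| "step (Store a i j r) s =
     s\<lparr>mem := (mem s)(a := (mem s a)(ireg s i := (mem s a (ireg s i))(ireg s j := wreg s r)))\<rparr>"
| "step (IndexZero i) s = s\<lparr>ireg := (ireg s)(i := 0)\<rparr>"
| "step (IndexCopy i j) s = s\<lparr>ireg := (ireg s)(i := ireg s j)\<rparr>"
| "step (IndexInc i) s = s\<lparr>ireg := (ireg s)(i := ireg s i + 1)\<rparr>"
| "step (IndexDec i) s = s\<lparr>ireg := (ireg s)(i := ireg s i - 1)\<rparr>"
| "step (IndexOfWord i r) s = s\<lparr>ireg := (ireg s)(i := unat (wreg s r))\<rparr>"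
| "step (WordOfIndex r i) s = s\<lparr>wreg := (wreg s)(r := of_nat (ireg s i))\<rparr>"

datatype test = WordEq nat nat | WordLess nat nat | IndexEq nat nat | IndexLess nat nat | Neg test

fun holds :: "test \<Rightarrow> 'w::len state \<Rightarrow> bool" where
  "holds (WordEq r1 r2) s \<longleftrightarrow> wreg s r1 = wreg s r2"
| "holds (WordLess r1 r2) s \<longleftrightarrow> wreg s r1 < wreg s r2"
| "holds (IndexEq i j) s \<longleftrightarrow> ireg s i = ireg s j"
| "holds (IndexLess i j) s \<longleftrightarrow> ireg s i < ireg s j"
| "holds (Neg b) s \<longleftrightarrow> \<not> holds b s"

datatype prog =
    Skip
  | Instr instr
  | Seq prog prog
  | If test prog prog
  | While test prog

text \<open>
  \<open>exec p s t s'\<close>: started in \<open>s\<close>, the program \<open>p\<close> halts in \<open>s'\<close> after exactly \<open>t\<close> word operations;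
  every instruction and every test counts as one.
\<close>

inductive exec :: "prog \<Rightarrow> 'w::len state \<Rightarrow> nat \<Rightarrow> 'w state \<Rightarrow> bool" where
  Skip: "exec Skip s 0 s"
| Instr: "exec (Instr i) s 1 (step i s)"
| Seq: "exec p s t s' \<Longrightarrow> exec q s' t' s'' \<Longrightarrow> exec (Seq p q) s (t + t') s''"
| IfTrue: "holds b s \<Longrightarrow> exec p s t s' \<Longrightarrow> exec (If b p q) s (1 + t) s'"
| IfFalse: "\<not> holds b s \<Longrightarrow> exec q s t s' \<Longrightarrow> exec (If b p q) s (1 + t) s'"
| WhileFalse: "\<not> holds b s \<Longrightarrow> exec (While b p) s 1 s"
| WhileTrue: "holds b s \<Longrightarrow> exec p s t s' \<Longrightarrow> exec (While b p) s' t' s'' \<Longrightarrow>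
    exec (While b p) s (1 + t + t') s''"

section \<open>Cost of solving a problem\<close>

definition bit_length :: "nat \<Rightarrow> nat" where
  "bit_length n = nat \<lfloor>log 2 (real n)\<rfloor> + 1"

definition words_for :: "'w::len itself \<Rightarrow> nat \<Rightarrow> nat" where
  "words_for _ n = nat \<lceil>real n / real LENGTH('w)\<rceil>"

definition limbs_value :: "(nat \<Rightarrow> 'w::len word) \<Rightarrow> nat \<Rightarrow> nat" where
  "limbs_value f l = (\<Sum>j<l. unat (f j) * 2 ^ (LENGTH('w) * j))"

text \<open>
  The interface between programs and data: \<open>stores s l xss\<close> says that \<open>s\<close> presents the tuple \<open>xss\<close>
  of vectors of natural numbers, every entry written with \<open>l\<close> words, least significant word first.
  The vector with number \<open>k\<close> lies in memory area \<open>k\<close>, one row for each entry, and its length is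
  in index register \<open>k + 1\<close>; index register 0 contains \<open>l\<close>.
\<close>

definition stores :: "'w::len state \<Rightarrow> nat \<Rightarrow> nat list list \<Rightarrow> bool" where
  "stores s l xss \<longleftrightarrow> ireg s 0 = l \<and>
     (\<forall>k < length xss. ireg s (k + 1) = length (xss ! k) \<and>
        (\<forall>i < length (xss ! k). limbs_value (mem s k i) l = xss ! k ! i))"

text \<open>
  The input has entries of \<open>l\<close> words, the output entries of \<open>l'\<close> words, and any output in \<open>Out\<close> is
  correct. Everything in the initial state that does not belong to the input is arbitrary, so
  programs cannot rely on cleared memory.
\<close>

definition solves_within ::
  "'w::len itself \<Rightarrow> prog \<Rightarrow> nat \<Rightarrow> nat list list \<Rightarrow> nat \<Rightarrow> nat list list set \<Rightarrow> real \<Rightarrow> bool" where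
  "solves_within _ p l inp l' Out T \<longleftrightarrow>
     (\<forall>s :: 'w state. stores s l inp \<longrightarrow>
        (\<exists>t s' out. exec p s t s' \<and> out \<in> Out \<and> stores s' l' out \<and> real t \<le> T))"

text \<open>
  In the following four notions a single program serves all instances; in particular the modulus is
  part of the input, and no precomputation depending on it is free of charge. Integers enter through
  their absolute values.
\<close>

definition multiplication_time :: "'w::len itself \<Rightarrow> (nat \<Rightarrow> real) \<Rightarrow> bool" where
  "multiplication_time W M \<longleftrightarrow> (\<forall>n\<ge>1. M n > 0) \<and>
     (\<exists>p. \<forall>n\<ge>1. \<forall>x y. bit_length x \<le> n \<and> bit_length y \<le> n \<longrightarrow>
        solves_within W p (words_for W n) [[x], [y]] (2 * words_for W n) {[[x * y]]} (M n))"

abbreviation residue_words :: "'w::len itself \<Rightarrow> nat \<Rightarrow> nat" where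
  "residue_words W N \<equiv> words_for W (bit_length N)"

definition modular_multiplication_time :: "'w::len itself \<Rightarrow> (nat \<Rightarrow> real) \<Rightarrow> bool" where
  "modular_multiplication_time W Mmod \<longleftrightarrow> (\<forall>N\<ge>1. Mmod N > 0) \<and>
     (\<exists>p. \<forall>N\<ge>1. \<forall>a<N. \<forall>b<N.
        solves_within W p (residue_words W N) [[N], [a], [b]]
          (residue_words W N) {[[a * b mod N]]} (Mmod N))"

definition gcd_cost_bigo :: "'w::len itself \<Rightarrow> (nat \<Rightarrow> real) \<Rightarrow> bool" where
  "gcd_cost_bigo W f \<longleftrightarrow>
     (\<exists>p C. \<forall>N. \<forall>b\<in>{2..<N}.
        solves_within W p (residue_words W N) [[N], [b]]
          (residue_words W N) {[[gcd b N]]} (C * f N))"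

definition inverse_cost_bigo :: "'w::len itself \<Rightarrow> (nat \<Rightarrow> real) \<Rightarrow> bool" where
  "inverse_cost_bigo W f \<longleftrightarrow>
     (\<exists>p C. \<forall>N. \<forall>b\<in>{2..<N}. coprime b N \<longrightarrow>
        solves_within W p (residue_words W N) [[N], [b]]
          (residue_words W N) {[[y]] | y. y < N \<and> [b * y = 1] (mod N)} (C * f N))"

section \<open>Remainder sequences over \<open>\<int>/N\<int>\<close>\<close>

abbreviation Zmod :: "nat \<Rightarrow> int ring" where
  "Zmod N \<equiv> residue_ring (int N)"

abbreviation Zmod_poly :: "nat \<Rightarrow> (int, nat \<Rightarrow> int) up_ring" where
  "Zmod_poly N \<equiv> UP (Zmod N)"

definition leading_coeff :: "nat \<Rightarrow> (nat \<Rightarrow> int) \<Rightarrow> int" where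
  "leading_coeff N f = coeff (Zmod_poly N) f (deg (Zmod N) f)"

text \<open>\<^const>\<open>deg\<close> assigns degree 0 to the zero polynomial, which has to rank below all others here.\<close>

definition deg_less :: "nat \<Rightarrow> (nat \<Rightarrow> int) \<Rightarrow> (nat \<Rightarrow> int) \<Rightarrow> bool" where
  "deg_less N f g \<longleftrightarrow> g \<noteq> \<zero>\<^bsub>Zmod_poly N\<^esub> \<and>
     (f = \<zero>\<^bsub>Zmod_poly N\<^esub> \<or> deg (Zmod N) f < deg (Zmod N) g)"

definition is_remainder ::
  "nat \<Rightarrow> (nat \<Rightarrow> int) \<Rightarrow> (nat \<Rightarrow> int) \<Rightarrow> (nat \<Rightarrow> int) \<Rightarrow> bool" where
  "is_remainder N f g r \<longleftrightarrow>
     (\<exists>!h. h \<in> carrier (Zmod_poly N) \<and>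
        f = g \<otimes>\<^bsub>Zmod_poly N\<^esub> h \<oplus>\<^bsub>Zmod_poly N\<^esub> r \<and> deg_less N r g)"

definition remainder_sequence ::
  "nat \<Rightarrow> nat \<Rightarrow> nat \<Rightarrow> nat \<Rightarrow> (int \<Rightarrow> nat \<Rightarrow> int) \<Rightarrow> bool" where
  "remainder_sequence N c d \<iota> g \<longleftrightarrow>
     N \<ge> 2 \<and> d \<ge> 1 \<and> c \<ge> d \<and>
     (\<forall>i\<in>{-1..int \<iota>}. g i \<in> carrier (Zmod_poly N)) \<and>
     deg (Zmod N) (g (-1)) = c \<and>
     deg (Zmod N) (g 0) = d \<and> leading_coeff N (g 0) = \<one>\<^bsub>Zmod N\<^esub> \<and>
     \<iota> \<in> {1..d} \<and>
     (\<forall>i\<in>{1..int \<iota> - 1}. leading_coeff N (g i) \<in> Units (Zmod N)) \<and>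
     (g (int \<iota>) = \<zero>\<^bsub>Zmod_poly N\<^esub> \<or> leading_coeff N (g (int \<iota>)) \<notin> Units (Zmod N)) \<and>
     (\<forall>i\<in>{1..int \<iota>}. is_remainder N (g (i - 2)) (g (i - 1)) (g i))"

definition coeff_vector :: "nat \<Rightarrow> (nat \<Rightarrow> int) \<Rightarrow> nat list" where
  "coeff_vector N f = map (\<lambda>j. nat (coeff (Zmod_poly N) f j)) [0..<deg (Zmod N) f + 1]"

definition proper_divisor :: "nat \<Rightarrow> nat \<Rightarrow> bool" where
  "proper_divisor m N \<longleftrightarrow> m dvd N \<and> m \<noteq> 1 \<and> m \<noteq> N"

definition B :: "nat \<Rightarrow> nat \<Rightarrow> nat \<Rightarrow> real" where
  "B e d \<iota> =
     real d * (real e + real \<iota> - real d * (real \<iota> + 1) / (2 * real \<iota>))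
       - real \<iota> * (real \<iota> - 1) / 2"

end

theory Submission
  imports Defs
begin

text \<open>
  Run Euclid's algorithm, but before dividing by \<open>g\<^sub>j\<close> with \<open>j \<ge> 1\<close> compute the gcd of its leading
  coefficient with \<open>N\<close>, stop if it is not 1, and otherwise make \<open>g\<^sub>j\<close> monic with one inversion and
  \<open>deg g\<^sub>j\<close> multiplications; the remainder is not affected. With \<open>n\<^sub>j = deg g\<^sub>j\<close>, division by the monic
  associate takes \<open>(n\<^bsub>j-1\<^esub> - n\<^sub>j + 1) n\<^sub>j\<close> multiplications. Over all sequences \<open>d = n\<^sub>0 > n\<^sub>1 > \<dots>\<close>
  of length \<open>\<iota>\<close> the sum of these numbers is at most \<open>B c d \<iota>\<close>, and normalizing adds
  \<open>n\<^sub>1 + \<dots> + n\<^bsub>\<iota>-1\<^esub> \<le> d (\<iota> - 1) - \<iota> (\<iota> - 1) / 2\<close>. Everything else (subtractions, copying, calling the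
  given programs) costs \<open>O(log N)\<close> per multiplication or per input coefficient, and both the number of
  multiplications and \<open>c\<close> are \<open>O(B c d \<iota>)\<close>.
\<close>

section \<open>Multiword arithmetic\<close>

text \<open>Modular multiplications must be counted with leading constant 1, so costs are kept sharp
  only in the coefficient of \<open>Mm\<close>; all other work is rounded up to multiples of
  \<open>l\<close>, the number of words per residue, which is at most \<open>2 * log 2 N\<close>.
  The obstacle is that the programs for multiplication, gcd and inversion are known only through
  their input and output and may destroy whatever they touch. Each is a finite text, however, so
  some \<open>K\<close> bounds all index registers and memory areas that they write, and the data of
  the algorithm survive from \<open>K\<close> on. Word registers get no such protection; the outcome
  of a multiword comparison is therefore moved to an index register. Dividing by the monic associate
  \<open>u b\<close> is harmless because \<open>a = (u b) h + r\<close> is also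
  \<open>a = b (u h) + r\<close>, and remainders by \<open>b\<close> are unique, although the ring
  has zero divisors, since the leading coefficient of \<open>b\<close> is a unit. One program serves
  both outcomes: each of the first \<open>\<iota> - 1\<close> rounds makes at most one gcd and one
  inversion call, the last round at most one gcd call.\<close>

fun instr_writes :: "instr \<Rightarrow> nat set" where
  "instr_writes (Store a i j r) = {a}"
| "instr_writes (IndexZero i) = {i}"
| "instr_writes (IndexCopy i j) = {i}"
| "instr_writes (IndexInc i) = {i}"
| "instr_writes (IndexDec i) = {i}"
| "instr_writes (IndexOfWord i r) = {i}"
| "instr_writes _ = {}"

text \<open>Index registers and memory areas share one set of numbers because a single bound
  \<open>K\<close> will serve for both. Word registers are left out, as nothing is kept in them
  across a call.\<close>

fun prog_writes :: "prog \<Rightarrow> nat set" where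
  "prog_writes Skip = {}"
| "prog_writes (Instr i) = instr_writes i"
| "prog_writes (Seq p q) = prog_writes p \<union> prog_writes q"
| "prog_writes (If b p q) = prog_writes p \<union> prog_writes q"
| "prog_writes (While b p) = prog_writes p"

text \<open>This provides the bound \<open>K\<close> for programs of which only the existence is
  assumed.\<close>

lemma finite_prog_writes: "finite (prog_writes p)"
proof (induction p)
  case (Instr i)
  then show ?case by (cases i) auto
qed auto

lemma step_frame: "x \<notin> instr_writes i \<Longrightarrow> ireg (step i s) x = ireg s x \<and> mem (step i s) x = mem s x"
  by (cases i) auto

lemma exec_frame:
  "exec p s t s' \<Longrightarrow> x \<notin> prog_writes p \<Longrightarrow> ireg s' x = ireg s x \<and> mem s' x = mem s x"
  by (induction rule: exec.induct) (auto simp: step_frame)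

section \<open>Natural numbers as rows of words\<close>

lemma limbs_value_cong: "(\<And>j. j < l \<Longrightarrow> f j = g j) \<Longrightarrow> limbs_value f l = limbs_value g l"
  by (simp add: limbs_value_def)

lemma limbs_value_Suc:
  fixes f :: "nat \<Rightarrow> 'w::len word"
  shows "limbs_value f (Suc l) = limbs_value f l + unat (f l) * 2 ^ (LENGTH('w) * l)"
  by (simp add: limbs_value_def)

lemma limbs_value_0 [simp]: "limbs_value f 0 = 0"
  by (simp add: limbs_value_def)

lemma limbs_value_less:
  fixes f :: "nat \<Rightarrow> 'w::len word"
  shows "limbs_value f l < 2 ^ (LENGTH('w) * l)"
proof (induction l)
  case (Suc l)
  have "unat (f l) + 1 \<le> 2 ^ LENGTH('w)"
    by (metis Suc_eq_plus1 Suc_leI unsigned_less)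
  then have "(unat (f l) + 1) * 2 ^ (LENGTH('w) * l) \<le> 2 ^ LENGTH('w) * 2 ^ (LENGTH('w) * l)"
    by (rule mult_right_mono) simp
  with Suc show ?case by (simp add: limbs_value_Suc algebra_simps power_add)
qed simp

text \<open>Induction on the number of rounds still to go. Each round pays \<open>c\<close> and one
  test; the last \<open>+ 1\<close> is the failing test.\<close>

lemma exec_while:
  assumes "\<And>k s. k < n \<Longrightarrow> Inv k s \<Longrightarrow> holds b s \<and> (\<exists>t s'. exec p s t s' \<and> t \<le> c \<and> Inv (Suc k) s')"
    and "\<And>s. Inv n s \<Longrightarrow> \<not> holds b s"
    and "Inv 0 s"
  shows "\<exists>t s'. exec (While b p) s t s' \<and> t \<le> n * (c + 1) + 1 \<and> Inv n s'"
proof -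
  have "\<exists>t s'. exec (While b p) s t s' \<and> t \<le> m * (c + 1) + 1 \<and> Inv n s'"
    if "m \<le> n" "Inv (n - m) s" for m s
    using that
  proof (induction m arbitrary: s)
    case 0
    then show ?case using assms(2) exec.WhileFalse by fastforce
  next
    case (Suc m)
    then obtain t s1 where 1: "holds b s" "exec p s t s1" "t \<le> c" "Inv (Suc (n - Suc m)) s1"
      using assms(1)[of "n - Suc m" s] by auto
    then obtain t' s' where "exec (While b p) s1 t' s'" "t' \<le> m * (c + 1) + 1" "Inv n s'"
      using Suc.IH[of s1] Suc.prems by (auto simp: Suc_diff_Suc)
    moreover from 1 this have "exec (While b p) s (1 + t + t') s'"
      by (intro exec.WhileTrue)
    ultimately show ?case
      using 1 by (intro exI[of _ "1 + t + t'"] exI[of _ s']) auto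
  qed
  from this[of n s] assms(3) show ?thesis by simp
qed

abbreviation seq_prog (infixr ";;" 60) where "p ;; q \<equiv> Seq p q"

text \<open>
  The subroutines below use index register 4 and the word registers 0 to 3 as scratch; the caller keeps
  its own data elsewhere.
\<close>

definition copy_value :: "nat \<Rightarrow> nat \<Rightarrow> nat \<Rightarrow> nat \<Rightarrow> nat \<Rightarrow> prog" where
  "copy_value L A x C y =
     Instr (IndexZero 4) ;;
     While (IndexLess 4 L) (Instr (Load 0 A x 4) ;; Instr (Store C y 4 0) ;; Instr (IndexInc 4))"

lemma exec_copy_value:
  fixes s :: "'w::len state"
  assumes "L \<noteq> 4" "x \<noteq> 4" "y \<noteq> 4"
  shows "\<exists>t s'. exec (copy_value L A x C y) s t s' \<and> t \<le> 4 * ireg s L + 2 \<and>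
    ireg s' = (ireg s)(4 := ireg s L) \<and>
    mem s' = (mem s)(C := (mem s C)(ireg s y :=
      (\<lambda>j. if j < ireg s L then mem s A (ireg s x) j else mem s C (ireg s y) j)))"
proof -
  define Inv :: "nat \<Rightarrow> 'w state \<Rightarrow> bool" where "Inv k s' \<longleftrightarrow>
    ireg s' = (ireg s)(4 := k) \<and>
    mem s' = (mem s)(C := (mem s C)(ireg s y :=
      (\<lambda>j. if j < k then mem s A (ireg s x) j else mem s C (ireg s y) j)))" for k s'
  let ?p = "Instr (Load 0 A x 4) ;; Instr (Store C y 4 0) ;; Instr (IndexInc 4)"
  have "\<exists>t s'. exec (While (IndexLess 4 L) ?p) (step (IndexZero 4) s) t s' \<and>
      t \<le> ireg s L * (3 + 1) + 1 \<and> Inv (ireg s L) s'"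
  proof (rule exec_while)
    fix k s1 assume k: "k < ireg s L" and 1: "Inv k s1"
    have "exec ?p s1 (1 + (1 + 1))
        (step (IndexInc 4) (step (Store C y 4 0) (step (Load 0 A x 4) s1)))"
      by (rule exec.Seq exec.Instr)+
    moreover have "Inv (Suc k) (step (IndexInc 4) (step (Store C y 4 0) (step (Load 0 A x 4) s1)))"
      using 1 assms by (auto simp: Inv_def fun_eq_iff less_Suc_eq)
    moreover have "holds (IndexLess 4 L) s1"
      using 1 k assms by (simp add: Inv_def)
    ultimately show "holds (IndexLess 4 L) s1 \<and> (\<exists>t s'. exec ?p s1 t s' \<and> t \<le> 3 \<and> Inv (Suc k) s')"
      by force
  next
    show "\<not> holds (IndexLess 4 L) s1" if "Inv (ireg s L) s1" for s1
      using that assms by (simp add: Inv_def)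
    show "Inv 0 (step (IndexZero 4) s)"
      by (simp add: Inv_def)
  qed
  then obtain t s' where ex: "exec (While (IndexLess 4 L) ?p) (step (IndexZero 4) s) t s'"
    "t \<le> ireg s L * 4 + 1" "Inv (ireg s L) s'" by auto
  have "exec (copy_value L A x C y) s (1 + t) s'"
    unfolding copy_value_def by (rule exec.Seq[OF exec.Instr ex(1)])
  then show ?thesis using ex(2,3)
    by (intro exI[of _ "1 + t"] exI[of _ s']) (auto simp: Inv_def)
qed

text \<open>Schoolbook subtraction with the borrow in word register 3: it is set if the upper word
  is smaller, kept if both words are equal, and cleared otherwise. The final borrow goes to index
  register \<open>f\<close>, so that this program also serves as the comparison of multiword
  numbers.\<close>

definition sub_value :: "nat \<Rightarrow> nat \<Rightarrow> nat \<Rightarrow> nat \<Rightarrow> nat \<Rightarrow> nat \<Rightarrow> nat \<Rightarrow> nat \<Rightarrow> prog" where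
  "sub_value L D z A x C y f =
     Instr (Const 3 0) ;; Instr (IndexZero 4) ;;
     While (IndexLess 4 L)
       (Instr (Load 0 A x 4) ;; Instr (Load 1 C y 4) ;;
        Instr (Op WSub 2 0 1) ;; Instr (Op WSub 2 2 3) ;; Instr (Store D z 4 2) ;;
        If (WordLess 0 1) (Instr (Const 3 1)) (If (WordEq 0 1) Skip (Instr (Const 3 0))) ;;
        Instr (IndexInc 4)) ;;
     Instr (IndexOfWord f 3)"

text \<open>The integer \<open>x - y - b\<close> lies between \<open>- 2 ^ LENGTH('w)\<close> and
  \<open>2 ^ LENGTH('w)\<close>, so its residue is the number itself or exceeds it by one modulus;
  the condition on the right says that it is negative.\<close>

lemma word_sub_borrow:
  fixes x y b :: "'w::len word"
  assumes "unat b \<le> 1"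
  shows "unat (x - y - b) + unat y + unat b =
    unat x + (if x < y \<or> x = y \<and> b \<noteq> 0 then 2 ^ LENGTH('w) else 0)"
proof -
  have b: "b = 0 \<or> b = 1" using assms
    by (metis One_nat_def le_Suc_eq le_zero_eq unat_0 unat_1 word_unat_eq_iff)
  have bx: "unat x < 2 ^ LENGTH('w)" "unat y < 2 ^ LENGTH('w)" by auto
  have bb: "unat b = (if b = 0 then 0 else 1)" using b by auto
  have "int (unat (x - y - b)) = (int (unat x) - int (unat y) - int (unat b)) mod 2 ^ LENGTH('w)"
    by (simp add: uint_word_ariths mod_simps)
  also have "\<dots> = int (unat x) - int (unat y) - int (unat b) +
      (if x < y \<or> x = y \<and> b \<noteq> 0 then 2 ^ LENGTH('w) else 0)"
  proof (cases "x < y \<or> x = y \<and> b \<noteq> 0")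
    case True
    then have "int (unat x) - int (unat y) - int (unat b) < 0"
      using b by (auto simp: word_less_def)
    moreover have "int (unat x) - int (unat y) - int (unat b) + 2 ^ LENGTH('w) \<ge> 0"
    proof -
      have "int (unat y) + 1 \<le> 2 ^ LENGTH('w)" using bx(2)
        by (metis Suc_eq_plus1 Suc_leI of_nat_1 of_nat_add of_nat_le_iff of_nat_numeral of_nat_power)
      moreover have "0 \<le> int (unat x)" by (rule of_nat_0_le_iff)
      moreover have "int (unat b) \<le> 1" using assms by linarith
      ultimately show ?thesis by linarith
    qed
    ultimately show ?thesis using True
      by (smt (verit) mod_add_self2 mod_pos_pos_trivial)
  next
    case False
    then have "unat y \<le> unat x" "b \<noteq> 0 \<Longrightarrow> unat x \<noteq> unat y"
      by (auto simp: word_less_nat_alt word_unat_eq_iff)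
    then have "unat y + unat b \<le> unat x" using bb by (cases "b = 0") auto
    then have "int (unat x) - int (unat y) - int (unat b) \<ge> 0" by linarith
    moreover have "int (unat x) < 2 ^ LENGTH('w)" using bx(1)
      by (metis of_nat_less_iff of_nat_numeral of_nat_power)
    ultimately have "int (unat x) - int (unat y) - int (unat b) < 2 ^ LENGTH('w)" by linarith
    with \<open>0 \<le> int (unat x) - int (unat y) - int (unat b)\<close> show ?thesis
      unfolding if_not_P[OF False] by (simp only: mod_pos_pos_trivial add_0_right)
  qed
  finally have "int (unat (x - y - b) + unat y + unat b) =
    int (unat x + (if x < y \<or> x = y \<and> b \<noteq> 0 then 2 ^ LENGTH('w) else 0))"
    by auto
  then show ?thesis by (simp only: of_nat_eq_iff)
qed

lemma exec_sub_value:
  fixes s :: "'w::len state" and A C x y L :: nat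
  assumes "L \<noteq> 4" "x \<noteq> 4" "y \<noteq> 4" "z \<noteq> 4"
  defines "X \<equiv> limbs_value (mem s A (ireg s x)) (ireg s L)"
    and "Y \<equiv> limbs_value (mem s C (ireg s y)) (ireg s L)"
  shows "\<exists>t s' v. exec (sub_value L D z A x C y f) s t s' \<and> t \<le> 10 * ireg s L + 4 \<and>
    ireg s' = (ireg s)(4 := ireg s L, f := if X < Y then 1 else 0) \<and>
    mem s' = (mem s)(D := (mem s D)(ireg s z := v)) \<and>
    limbs_value v (ireg s L) = (if X < Y then 2 ^ (LENGTH('w) * ireg s L) + X - Y else X - Y)"
proof -
  define xs where "xs = mem s A (ireg s x)"
  define ys where "ys = mem s C (ireg s y)"
  \<comment> \<open>The last conjunct is the subtraction of the low \<open>k\<close> words with the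
    borrow moved to the other side. Words from \<open>k\<close> on are recorded as untouched because
    the target row may be one of the operands, as happens in \<open>mod_sub\<close>.\<close>
  define Inv :: "nat \<Rightarrow> 'w state \<Rightarrow> bool" where "Inv k s' \<longleftrightarrow>
    ireg s' = (ireg s)(4 := k) \<and> unat (wreg s' 3) \<le> 1 \<and>
    (\<exists>v. mem s' = (mem s)(D := (mem s D)(ireg s z := v)) \<and>
      (\<forall>j\<ge>k. v j = mem s D (ireg s z) j) \<and>
      limbs_value v k + limbs_value ys k =
        limbs_value xs k + unat (wreg s' 3) * 2 ^ (LENGTH('w) * k))" for k s'
  let ?p = "Instr (Load 0 A x 4) ;; Instr (Load 1 C y 4) ;;
        Instr (Op WSub 2 0 1) ;; Instr (Op WSub 2 2 3) ;; Instr (Store D z 4 2) ;;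
        If (WordLess 0 1) (Instr (Const 3 1)) (If (WordEq 0 1) Skip (Instr (Const 3 0))) ;;
        Instr (IndexInc 4)"
  let ?s0 = "step (IndexZero 4) (step (Const 3 0) s)"
  have "\<exists>t s'. exec (While (IndexLess 4 L) ?p) ?s0 t s' \<and>
      t \<le> ireg s L * (9 + 1) + 1 \<and> Inv (ireg s L) s'"
  proof (rule exec_while)
    fix k s1 assume k: "k < ireg s L" and 1: "Inv k s1"
    then obtain v where v: "ireg s1 = (ireg s)(4 := k)" "unat (wreg s1 3) \<le> 1"
      "mem s1 = (mem s)(D := (mem s D)(ireg s z := v))"
      "\<And>j. j \<ge> k \<Longrightarrow> v j = mem s D (ireg s z) j"
      "limbs_value v k + limbs_value ys k = limbs_value xs k + unat (wreg s1 3) * 2 ^ (LENGTH('w) * k)"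
      unfolding Inv_def by auto
    let ?b = "wreg s1 3"
    let ?s2 = "step (Store D z 4 2) (step (Op WSub 2 2 3) (step (Op WSub 2 0 1)
      (step (Load 1 C y 4) (step (Load 0 A x 4) s1))))"
    have xk: "mem s1 A (ireg s x) k = xs k" using v(3,4) by (auto simp: xs_def)
    have yk: "mem s1 C (ireg s y) k = ys k" using v(3,4) by (auto simp: ys_def)
    have w: "wreg ?s2 0 = xs k" "wreg ?s2 1 = ys k" "wreg ?s2 3 = ?b"
      and i2: "ireg ?s2 = (ireg s)(4 := k)"
      and m2: "mem ?s2 = (mem s)(D := (mem s D)(ireg s z := v(k := xs k - ys k - ?b)))"
      using assms(1-4) xk yk by (auto simp: v(1) v(3) fun_eq_iff)
    define b' where "b' = (if xs k < ys k then 1 else if xs k = ys k then ?b else 0)"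
    define s3 where "s3 = ?s2\<lparr>wreg := (wreg ?s2)(3 := b')\<rparr>"
    have e3: "\<exists>t\<le>3. exec (If (WordLess 0 1) (Instr (Const 3 1)) (If (WordEq 0 1) Skip (Instr (Const 3 0)))) ?s2 t s3"
    proof -
      consider "xs k < ys k" | "xs k = ys k" | "\<not> xs k < ys k" "xs k \<noteq> ys k" by blast
      then show ?thesis
      proof cases
        case 1
        have "exec (If (WordLess 0 1) (Instr (Const 3 1)) (If (WordEq 0 1) Skip (Instr (Const 3 0)))) ?s2 (1 + 1) (step (Const 3 1) ?s2)"
          by (intro exec.IfTrue exec.Instr) (use w 1 in \<open>simp del: step.simps\<close>)
        moreover have "step (Const 3 1) ?s2 = s3" using 1
          by (simp add: s3_def b'_def)
        ultimately have "exec (If (WordLess 0 1) (Instr (Const 3 1)) (If (WordEq 0 1) Skip (Instr (Const 3 0)))) ?s2 (1 + 1) s3" by (simp only:)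
        then show ?thesis by (intro exI[of _ "1 + 1"] conjI) (simp, assumption)
      next
        case 2
        have "exec (If (WordLess 0 1) (Instr (Const 3 1)) (If (WordEq 0 1) Skip (Instr (Const 3 0)))) ?s2 (1 + (1 + 0)) ?s2"
          by (intro exec.IfTrue exec.IfFalse exec.Skip) (use w 2 in \<open>simp_all del: step.simps\<close>)
        moreover have "(wreg ?s2)(3 := b') = wreg ?s2"
          using 2 w(3) by (simp del: step.simps add: b'_def fun_upd_idem)
        then have "?s2 = s3" unfolding s3_def
          by (simp only:) (cases ?s2; simp del: step.simps)
        ultimately have "exec (If (WordLess 0 1) (Instr (Const 3 1)) (If (WordEq 0 1) Skip (Instr (Const 3 0)))) ?s2 (1 + (1 + 0)) s3" by (simp only:)
        then show ?thesis by (intro exI[of _ "1 + (1 + 0)"] conjI) (simp, assumption)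
      next
        case 3
        have "exec (If (WordLess 0 1) (Instr (Const 3 1)) (If (WordEq 0 1) Skip (Instr (Const 3 0)))) ?s2 (1 + (1 + 1)) (step (Const 3 0) ?s2)"
          by (intro exec.IfFalse exec.Instr) (use w 3 in \<open>simp_all del: step.simps\<close>)
        moreover have "step (Const 3 0) ?s2 = s3" using 3
          by (simp add: s3_def b'_def)
        ultimately have "exec (If (WordLess 0 1) (Instr (Const 3 1)) (If (WordEq 0 1) Skip (Instr (Const 3 0)))) ?s2 (1 + (1 + 1)) s3" by (simp only:)
        then show ?thesis by (intro exI[of _ "1 + (1 + 1)"] conjI) (simp, assumption)
      qed
    qed
    then obtain t where t: "t \<le> 3"
      "exec (If (WordLess 0 1) (Instr (Const 3 1)) (If (WordEq 0 1) Skip (Instr (Const 3 0)))) ?s2 t s3"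
      by blast
    have "exec ?p s1 (1 + (1 + (1 + (1 + (1 + (t + 1)))))) (step (IndexInc 4) s3)"
      by (rule exec.Seq exec.Instr t(2))+
    moreover have "Inv (Suc k) (step (IndexInc 4) s3)"
    proof -
      let ?v = "v(k := xs k - ys k - ?b)"
      have "limbs_value ?v k = limbs_value v k" by (rule limbs_value_cong) auto
      moreover have "unat (xs k - ys k - ?b) + unat (ys k) + unat ?b = unat (xs k) + unat b' * 2 ^ LENGTH('w)"
        using word_sub_borrow[OF v(2), of "xs k" "ys k"] v(2)
        by (auto simp: b'_def le_Suc_eq unat_eq_0 split: if_splits)
      then have "(unat (xs k - ys k - ?b) + unat (ys k) + unat ?b) * 2 ^ (LENGTH('w) * k)
        = (unat (xs k) + unat b' * 2 ^ LENGTH('w)) * 2 ^ (LENGTH('w) * k)" by simp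
      ultimately have "limbs_value ?v (Suc k) + limbs_value ys (Suc k) =
        limbs_value xs (Suc k) + unat b' * 2 ^ (LENGTH('w) * Suc k)"
        using v(5) by (simp add: limbs_value_Suc algebra_simps power_add)
      moreover have "unat b' \<le> 1" using v(2) by (auto simp: b'_def)
      moreover have "ireg (step (IndexInc 4) s3) = (ireg s)(4 := Suc k)"
        using i2 by (simp add: s3_def)
      moreover have "mem (step (IndexInc 4) s3) = (mem s)(D := (mem s D)(ireg s z := ?v))"
        using m2 by (simp add: s3_def)
      moreover have "wreg (step (IndexInc 4) s3) 3 = b'" by (simp add: s3_def)
      moreover have "\<forall>j\<ge>Suc k. ?v j = mem s D (ireg s z) j" using v(4) by auto
      ultimately show ?thesis unfolding Inv_def by metis
    qed
    moreover have "holds (IndexLess 4 L) s1"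
      using v k assms(1) by simp
    ultimately show "holds (IndexLess 4 L) s1 \<and> (\<exists>t s'. exec ?p s1 t s' \<and> t \<le> 9 \<and> Inv (Suc k) s')"
      using t(1) by (intro conjI exI) auto
  next
    show "\<not> holds (IndexLess 4 L) s1" if "Inv (ireg s L) s1" for s1
      using that assms(1) by (simp add: Inv_def)
    show "Inv 0 ?s0"
      by (auto simp: Inv_def intro!: exI[of _ "mem s D (ireg s z)"])
  qed
  then obtain t s' where ex: "exec (While (IndexLess 4 L) ?p) ?s0 t s'"
    "t \<le> ireg s L * 10 + 1" "Inv (ireg s L) s'" by auto
  then obtain v where v: "ireg s' = (ireg s)(4 := ireg s L)" "unat (wreg s' 3) \<le> 1"
    "mem s' = (mem s)(D := (mem s D)(ireg s z := v))"
    "limbs_value v (ireg s L) + Y = X + unat (wreg s' 3) * 2 ^ (LENGTH('w) * ireg s L)"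
    unfolding Inv_def X_def Y_def xs_def ys_def by auto
  \<comment> \<open>The value of \<open>v\<close> is below \<open>2 ^ (LENGTH('w) * l)\<close> for
    \<open>l = ireg s L\<close>, and so are \<open>X\<close> and \<open>Y\<close>; hence
    \<open>v + Y = X + borrow * 2 ^ (LENGTH('w) * l)\<close> leaves only one choice for the
    borrow.\<close>
  have bor: "unat (wreg s' 3) = (if X < Y then 1 else 0)"
    and val: "limbs_value v (ireg s L) = (if X < Y then 2 ^ (LENGTH('w) * ireg s L) + X - Y else X - Y)"
    using v(2,4) limbs_value_less[of v "ireg s L"] limbs_value_less[of "mem s A (ireg s x)" "ireg s L"]
      limbs_value_less[of "mem s C (ireg s y)" "ireg s L"]
    by (auto simp: le_Suc_eq simp flip: X_def Y_def split: if_splits)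
  have "exec (sub_value L D z A x C y f) s (1 + (1 + (t + 1))) (step (IndexOfWord f 3) s')"
    unfolding sub_value_def by (rule exec.Seq exec.Instr ex(1))+
  moreover have "ireg (step (IndexOfWord f 3) s') = (ireg s)(4 := ireg s L, f := if X < Y then 1 else 0)"
    using v(1) bor by simp
  moreover have "mem (step (IndexOfWord f 3) s') = (mem s)(D := (mem s D)(ireg s z := v))"
    using v(3) by simp
  ultimately show ?thesis using ex(2) val by (intro exI conjI) (assumption | simp)+
qed

section \<open>Reasoning about programs\<close>

text \<open>
  A state is viewed through the index registers and memory areas with numbers in a set \<open>X\<close>, where a
  memory row is read as a single number of \<open>l\<close> words. In \<open>run W l X p T I V Q\<close> the number \<open>T\<close> is a
  time credit, and the postcondition receives what is left of it.
\<close>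

definition agree ::
  "nat \<Rightarrow> nat set \<Rightarrow> 'w::len state \<Rightarrow> (nat \<Rightarrow> nat) \<Rightarrow> (nat \<Rightarrow> nat \<Rightarrow> nat) \<Rightarrow> bool" where
  "agree l X s I V \<longleftrightarrow> (\<forall>x\<in>X. ireg s x = I x \<and> (\<forall>i. limbs_value (mem s x i) l = V x i))"

definition run ::
  "'w::len itself \<Rightarrow> nat \<Rightarrow> nat set \<Rightarrow> prog \<Rightarrow> real \<Rightarrow> (nat \<Rightarrow> nat) \<Rightarrow> (nat \<Rightarrow> nat \<Rightarrow> nat) \<Rightarrow>
    (real \<Rightarrow> (nat \<Rightarrow> nat) \<Rightarrow> (nat \<Rightarrow> nat \<Rightarrow> nat) \<Rightarrow> bool) \<Rightarrow> bool" where
  "run _ l X p T I V Q \<longleftrightarrow> (\<forall>s :: 'w state. agree l X s I V \<longrightarrow>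
     (\<exists>t s' t' I' V'. exec p s t s' \<and> real t \<le> t' \<and> agree l X s' I' V' \<and> Q (T - t') I' V'))"

lemma runI:
  fixes W :: "'w::len itself"
  assumes "\<And>s :: 'w state. agree l X s I V \<Longrightarrow>
     \<exists>t s' t' I' V'. exec p s t s' \<and> real t \<le> t' \<and> agree l X s' I' V' \<and> Q (T - t') I' V'"
  shows "run W l X p T I V Q"
  using assms by (simp add: run_def)

lemma runE:
  fixes W :: "'w::len itself" and s :: "'w state"
  assumes "run W l X p T I V Q" "agree l X s I V"
  obtains t s' t' I' V' where "exec p s t s'" "real t \<le> t'" "agree l X s' I' V'" "Q (T - t') I' V'"
  using assms unfolding run_def by blast

lemma run_mono:
  assumes "run W l X p T I V Q" "\<And>T' I' V'. Q T' I' V' \<Longrightarrow> Q' T' I' V'"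
  shows "run W l X p T I V Q'"
  using assms unfolding run_def by meson

section \<open>Rules for control structures and for changing the view\<close>

lemma run_Skip:
  fixes W :: "'w::len itself"
  assumes "Q T I V"
  shows "run W l X Skip T I V Q"
proof (rule runI)
  fix s :: "'w state" assume "agree l X s I V"
  then have "exec Skip s 0 s \<and> real 0 \<le> 0 \<and> agree l X s I V \<and> Q (T - 0) I V"
    using assms by (simp add: exec.Skip)
  then show "\<exists>t s' t' I' V'. exec Skip s t s' \<and> real t \<le> t' \<and> agree l X s' I' V' \<and> Q (T - t') I' V'"
    by blast
qed

lemma run_Seq:
  fixes W :: "'w::len itself"
  assumes "run W l X p T I V (\<lambda>T' I' V'. run W l X q T' I' V' Q)"
  shows "run W l X (p ;; q) T I V Q"
proof (rule runI)
  fix s :: "'w state" assume s: "agree l X s I V"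
  obtain t s' t' I' V' where 1: "exec p s t s'" "real t \<le> t'" "agree l X s' I' V'"
    "run W l X q (T - t') I' V' Q" by (rule runE[OF assms s])
  obtain u s'' u' I'' V'' where 2: "exec q s' u s''" "real u \<le> u'" "agree l X s'' I'' V''"
    "Q (T - t' - u') I'' V''" by (rule runE[OF 1(4,3)])
  have "exec (p ;; q) s (t + u) s''" using 1 2 exec.Seq by blast
  moreover have "real (t + u) \<le> t' + u'" using 1 2 by simp
  moreover have "Q (T - (t' + u')) I'' V''" using 2 by (simp add: algebra_simps)
  ultimately show "\<exists>t s' t' I' V'. exec (p ;; q) s t s' \<and> real t \<le> t' \<and> agree l X s' I' V' \<and> Q (T - t') I' V'"
    using 2 by blast
qed

text \<open>A view shows no word registers, so only tests on index registers can be decided from it.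
  The value \<open>False\<close> of \<open>index_holds\<close> on word tests is a dummy, guarded by
  \<open>index_test\<close>.\<close>

fun index_test :: "nat set \<Rightarrow> test \<Rightarrow> bool" where
  "index_test X (IndexEq i j) \<longleftrightarrow> i \<in> X \<and> j \<in> X"
| "index_test X (IndexLess i j) \<longleftrightarrow> i \<in> X \<and> j \<in> X"
| "index_test X (Neg b) \<longleftrightarrow> index_test X b"
| "index_test X _ \<longleftrightarrow> False"

fun index_holds :: "test \<Rightarrow> (nat \<Rightarrow> nat) \<Rightarrow> bool" where
  "index_holds (IndexEq i j) I \<longleftrightarrow> I i = I j"
| "index_holds (IndexLess i j) I \<longleftrightarrow> I i < I j"
| "index_holds (Neg b) I \<longleftrightarrow> \<not> index_holds b I"
| "index_holds _ I \<longleftrightarrow> False"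

lemma holds_index_holds: "index_test X b \<Longrightarrow> agree l X s I V \<Longrightarrow> holds b s \<longleftrightarrow> index_holds b I"
  by (induction b) (auto simp: agree_def)

lemma run_If:
  fixes W :: "'w::len itself"
  assumes "index_test X b"
    and "index_holds b I \<Longrightarrow> run W l X p (T - 1) I V Q"
    and "\<not> index_holds b I \<Longrightarrow> run W l X q (T - 1) I V Q"
  shows "run W l X (If b p q) T I V Q"
proof (rule runI)
  fix s :: "'w state" assume s: "agree l X s I V"
  obtain t s' t' I' V' where *: "exec (If b p q) s (1 + t) s'" "real t \<le> t'"
    "agree l X s' I' V'" "Q (T - 1 - t') I' V'"
  proof (cases "holds b s")
    case True
    with holds_index_holds[OF assms(1) s] have "index_holds b I" by simp
    from runE[OF assms(2)[OF this] s] show ?thesis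
      using that exec.IfTrue[OF True] by metis
  next
    case False
    with holds_index_holds[OF assms(1) s] have "\<not> index_holds b I" by simp
    from runE[OF assms(3)[OF this] s] show ?thesis
      using that exec.IfFalse[OF False] by metis
  qed
  have "T - 1 - t' = T - (1 + t')" by simp
  with * show "\<exists>t s' t' I' V'. exec (If b p q) s t s' \<and> real t \<le> t' \<and> agree l X s' I' V' \<and> Q (T - t') I' V'"
    by (intro exI[of _ "1 + t"] exI[of _ s'] exI[of _ "1 + t'"] exI[of _ I'] exI[of _ V']) simp
qed

text \<open>The body is required to work for every credit \<open>T\<close>, so the proof may run it
  with credit 0 and read off the cost. The bound \<open>c\<close> varies with the round, as the
  rounds of Euclid's algorithm differ in cost.\<close>

lemma run_while:
  fixes W :: "'w::len itself" and c :: "nat \<Rightarrow> real"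
  assumes step: "\<And>k T I V. k < n \<Longrightarrow> Inv k I V \<Longrightarrow> index_holds b I \<and>
      run W l X p T I V (\<lambda>T' I' V'. T - c k \<le> T' \<and> Inv (Suc k) I' V')"
    and exit: "\<And>I V. Inv n I V \<Longrightarrow> \<not> index_holds b I"
    and b: "index_test X b"
    and init: "Inv 0 I V"
    and post: "\<And>I' V'. Inv n I' V' \<Longrightarrow> Q (T - ((\<Sum>k<n. c k + 1) + 1)) I' V'"
  shows "run W l X (While b p) T I V Q"
proof (rule runI)
  fix s :: "'w state" assume s: "agree l X s I V"
  have *: "\<exists>t s' I' V'. exec (While b p) s t s' \<and> real t \<le> (\<Sum>k=n-m..<n. c k + 1) + 1 \<and>
      agree l X s' I' V' \<and> Inv n I' V'"
    if "m \<le> n" "Inv (n - m) I V" "agree l X s I V" for m and s :: "'w state" and I V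
    using that
  proof (induction m arbitrary: s I V)
    case 0
    then have "\<not> holds b s" using exit[of I V] holds_index_holds[OF b, of l s I V] by auto
    then have "exec (While b p) s 1 s" by (rule exec.WhileFalse)
    then show ?case using 0 by (intro exI[of _ 1] exI[of _ s] exI[of _ I] exI[of _ V]) auto
  next
    case (Suc m)
    define k where "k = n - Suc m"
    have k: "k < n" "Suc k = n - m" "Inv k I V" using Suc.prems by (auto simp: k_def)
    then have hb: "holds b s" and r: "run W l X p 0 I V (\<lambda>T' I' V'. 0 - c k \<le> T' \<and> Inv (Suc k) I' V')"
      using step[of k I V 0] holds_index_holds[OF b Suc.prems(3)] by auto
    obtain t s1 t' I1 V1 where 1: "exec p s t s1" "real t \<le> t'" "agree l X s1 I1 V1"
      "0 - c k \<le> 0 - t'" "Inv (n - m) I1 V1"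
      using runE[OF r Suc.prems(3)] k(2) by metis
    obtain u s' I' V' where 2: "exec (While b p) s1 u s'" "real u \<le> (\<Sum>k=n-m..<n. c k + 1) + 1"
      "agree l X s' I' V'" "Inv n I' V'"
      using Suc.IH[of I1 V1 s1] Suc.prems 1 by auto
    have "exec (While b p) s (1 + t + u) s'" using hb 1(1) 2(1) by (rule exec.WhileTrue)
    moreover have "(\<Sum>j=k..<n. c j + 1) = c k + 1 + (\<Sum>j=Suc k..<n. c j + 1)"
      using k(1) by (simp add: sum.atLeast_Suc_lessThan)
    then have "real (1 + t + u) \<le> (\<Sum>k=n-Suc m..<n. c k + 1) + 1"
      using 1 2 k(2) by (simp flip: k_def)
    ultimately show ?case using 2 by blast
  qed
  obtain t s' I' V' where "exec (While b p) s t s'" "real t \<le> (\<Sum>k=n-n..<n. c k + 1) + 1"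
      "agree l X s' I' V'" "Inv n I' V'"
    using *[of n I V s] init s by auto
  then show "\<exists>t s' t' I' V'. exec (While b p) s t s' \<and> real t \<le> t' \<and> agree l X s' I' V' \<and> Q (T - t') I' V'"
    using post[of I' V'] unfolding diff_self_eq_0 atLeast0LessThan by blast
qed

lemma run_while_const:
  assumes "\<And>k T I V. k < n \<Longrightarrow> Inv k I V \<Longrightarrow> index_holds b I \<and>
      run W l X p T I V (\<lambda>T' I' V'. T - c \<le> T' \<and> Inv (Suc k) I' V')"
    and "\<And>I V. Inv n I V \<Longrightarrow> \<not> index_holds b I"
    and "index_test X b"
    and "Inv 0 I V"
    and "\<And>I' V'. Inv n I' V' \<Longrightarrow> Q (T - (real n * (c + 1) + 1)) I' V'"
  shows "run W l X (While b p) T I V Q"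
  by (rule run_while[where Inv = Inv and n = n and c = "\<lambda>_. c"]) (use assms in auto)

text \<open>In \<open>run\<close> the time \<open>t'\<close> is any upper bound of the true time and
  may be raised to exactly \<open>c\<close>. Hence \<open>Q\<close> need not be monotone in the
  credit, and a subroutine can be given a closed cost formula.\<close>

lemma run_conseq:
  fixes W :: "'w::len itself"
  assumes "run W l X p T I V (\<lambda>T' I' V'. T - c \<le> T' \<and> R I' V')"
    and "\<And>I' V'. R I' V' \<Longrightarrow> Q (T - c) I' V'"
  shows "run W l X p T I V Q"
proof (rule runI)
  fix s :: "'w state" assume s: "agree l X s I V"
  obtain t s' t' I' V' where "exec p s t s'" "real t \<le> t'" "agree l X s' I' V'"
    "T - c \<le> T - t' \<and> R I' V'" by (rule runE[OF assms(1) s])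
  then show "\<exists>t s' t' I' V'. exec p s t s' \<and> real t \<le> t' \<and> agree l X s' I' V' \<and> Q (T - t') I' V'"
    using assms(2)[of I' V']
    by (intro exI[of _ t] exI[of _ s'] exI[of _ c] exI[of _ I'] exI[of _ V']) auto
qed

text \<open>Opens a larger view inside a subroutine: what lies in \<open>Y\<close> but not in
  \<open>X\<close> has arbitrary values on entry and is forgotten on exit. This hides the parameter
  registers below \<open>K\<close> from the algorithm.\<close>

lemma run_restrict:
  fixes W :: "'w::len itself"
  assumes "X \<subseteq> Y"
    and "\<And>I1 V1. (\<forall>x\<in>X. I1 x = I x \<and> V1 x = V x) \<Longrightarrow>
      run W l Y p T I1 V1 (\<lambda>T' I' V'. \<exists>I'' V''. (\<forall>x\<in>X. I' x = I'' x \<and> V' x = V'' x) \<and> Q T' I'' V'')"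
  shows "run W l X p T I V Q"
proof (rule runI)
  fix s :: "'w state" assume s: "agree l X s I V"
  let ?I = "ireg s" and ?V = "\<lambda>a i. limbs_value (mem s a i) l"
  have a: "agree l Y s ?I ?V" by (simp add: agree_def)
  have r: "run W l Y p T ?I ?V (\<lambda>T' I' V'. \<exists>I'' V''. (\<forall>x\<in>X. I' x = I'' x \<and> V' x = V'' x) \<and> Q T' I'' V'')"
    using s by (intro assms(2)) (auto simp: agree_def)
  obtain t s' t' I' V' I'' V'' where *: "exec p s t s'" "real t \<le> t'" "agree l Y s' I' V'"
    "\<forall>x\<in>X. I' x = I'' x \<and> V' x = V'' x" "Q (T - t') I'' V''"
    using runE[OF r a] by metis
  have "agree l X s' I'' V''" using * assms(1) by (auto simp: agree_def)
  then show "\<exists>t s' t' I' V'. exec p s t s' \<and> real t \<le> t' \<and> agree l X s' I' V' \<and> Q (T - t') I' V'"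
    using * by blast
qed

text \<open>The opposite direction: a program verified in a small view may be used in a larger one,
  at the price that nothing is known afterwards about the registers and areas outside the small
  view.\<close>

lemma run_extend:
  fixes W :: "'w::len itself"
  assumes "X \<subseteq> Y" "run W l X p T I V Q'"
    and "\<And>T' I' V' I'' V''. Q' T' I'' V'' \<Longrightarrow> (\<forall>x\<in>X. I' x = I'' x \<and> V' x = V'' x) \<Longrightarrow> Q T' I' V'"
  shows "run W l Y p T I V Q"
proof (rule runI)
  fix s :: "'w state" assume "agree l Y s I V"
  then have s: "agree l X s I V" using assms(1) by (auto simp: agree_def)
  obtain t s' t' I'' V'' where *: "exec p s t s'" "real t \<le> t'" "agree l X s' I'' V''"
    "Q' (T - t') I'' V''"
    by (rule runE[OF assms(2) s])
  let ?I = "ireg s'" and ?V = "\<lambda>a i. limbs_value (mem s' a i) l"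
  have "agree l Y s' ?I ?V" by (simp add: agree_def)
  moreover have "Q (T - t') ?I ?V"
    by (rule assms(3)[OF *(4)]) (use *(3) in \<open>auto simp: agree_def\<close>)
  ultimately show "\<exists>t s' t' I' V'. exec p s t s' \<and> real t \<le> t' \<and> agree l Y s' I' V' \<and> Q (T - t') I' V'"
    using * by blast
qed

lemma run_Instr:
  fixes W :: "'w::len itself"
  assumes "\<And>s :: 'w state. agree l X s I V \<Longrightarrow> agree l X (step i s) I' V'" "Q (T - 1) I' V'"
  shows "run W l X (Instr i) T I V Q"
proof (rule runI)
  fix s :: "'w state" assume "agree l X s I V"
  then show "\<exists>t s' t' I' V'. exec (Instr i) s t s' \<and> real t \<le> t' \<and> agree l X s' I' V' \<and> Q (T - t') I' V'"
    by (intro exI[of _ 1] exI[of _ "step i s"] exI[of _ I'] exI[of _ V'] conjI exec.Instr) (use assms in auto)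
qed

lemma run_IndexZero: "Q (T - 1) (I(i := 0)) V \<Longrightarrow> run W l X (Instr (IndexZero i)) T I V Q"
  by (rule run_Instr) (auto simp: agree_def)

lemma run_IndexCopy:
  "Q (T - 1) (I(i := I j)) V \<Longrightarrow> j \<in> X \<Longrightarrow> run W l X (Instr (IndexCopy i j)) T I V Q"
  by (rule run_Instr) (auto simp: agree_def)

lemma run_IndexInc:
  "Q (T - 1) (I(i := I i + 1)) V \<Longrightarrow> i \<in> X \<Longrightarrow> run W l X (Instr (IndexInc i)) T I V Q"
  by (rule run_Instr[where I' = "I(i := I i + 1)"]) (auto simp: agree_def)

lemma run_IndexDec:
  "Q (T - 1) (I(i := I i - 1)) V \<Longrightarrow> i \<in> X \<Longrightarrow> run W l X (Instr (IndexDec i)) T I V Q"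
  by (rule run_Instr[where I' = "I(i := I i - 1)"]) (auto simp: agree_def)

text \<open>Index register 4 is the loop counter and is overwritten, so the view must not contain 4.
  The bound \<open>4 * l + 2\<close> is rounded to \<open>6 * l\<close> by
  \<open>l \<ge> 1\<close>.\<close>

lemma run_copy_value:
  fixes W :: "'w::len itself"
  assumes Q: "Q (T - 6 * real l) I (V(C := (V C)(I y := V A (I x))))"
    and vis: "L \<in> X" "x \<in> X" "y \<in> X" "A \<in> X" "4 \<notin> X" and l: "I L = l" "l \<ge> 1"
  shows "run W l X (copy_value L A x C y) T I V Q"
proof (rule runI)
  fix s :: "'w state" assume s: "agree l X s I V"
  have ir: "ireg s L = l" "ireg s x = I x" "ireg s y = I y" using s vis l by (auto simp: agree_def)
  have "L \<noteq> 4" "x \<noteq> 4" "y \<noteq> 4" using vis by auto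
  from exec_copy_value[OF this, of A C s] obtain t s' where
    *: "exec (copy_value L A x C y) s t s'" "t \<le> 4 * l + 2" "ireg s' = (ireg s)(4 := l)"
    "mem s' = (mem s)(C := (mem s C)(I y := (\<lambda>j. if j < l then mem s A (I x) j else mem s C (I y) j)))"
    unfolding ir by blast
  have v: "limbs_value (\<lambda>j. if j < l then mem s A (I x) j else mem s C (I y) j) l = V A (I x)"
  proof -
    have "limbs_value (\<lambda>j. if j < l then mem s A (I x) j else mem s C (I y) j) l = limbs_value (mem s A (I x)) l"
      by (rule limbs_value_cong) simp
    then show ?thesis using s vis by (simp add: agree_def)
  qed
  have "agree l X s' I (V(C := (V C)(I y := V A (I x))))"
    unfolding agree_def *(3,4) using s vis v by (auto simp: agree_def)
  moreover have "real t \<le> 6 * real l" using *(2) l by linarith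
  ultimately show "\<exists>t s' t' I' V'. exec (copy_value L A x C y) s t s' \<and> real t \<le> t' \<and> agree l X s' I' V' \<and> Q (T - t') I' V'"
    by (intro exI conjI) (rule *(1) Q | assumption)+
qed

lemma run_sub_value:
  fixes W :: "'w::len itself"
  assumes Q: "Q (T - 14 * real l) (I(f := if V A (I x) < V C (I y) then 1 else 0))
      (V(D := (V D)(I z := if V A (I x) < V C (I y)
        then 2 ^ (LENGTH('w) * l) + V A (I x) - V C (I y) else V A (I x) - V C (I y))))"
    and vis: "L \<in> X" "x \<in> X" "y \<in> X" "z \<in> X" "A \<in> X" "C \<in> X" "4 \<notin> X" and l: "I L = l" "l \<ge> 1"
  shows "run W l X (sub_value L D z A x C y f) T I V Q"
proof (rule runI)
  fix s :: "'w state" assume s: "agree l X s I V"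
  have ir: "ireg s L = l" "ireg s x = I x" "ireg s y = I y" "ireg s z = I z"
    and v: "limbs_value (mem s A (I x)) l = V A (I x)" "limbs_value (mem s C (I y)) l = V C (I y)"
    using s vis l by (auto simp: agree_def)
  have "L \<noteq> 4" "x \<noteq> 4" "y \<noteq> 4" "z \<noteq> 4" using vis by auto
  from exec_sub_value[OF this, of D A C f s] obtain t s' w where
    *: "exec (sub_value L D z A x C y f) s t s'" "t \<le> 10 * l + 4"
    "ireg s' = (ireg s)(4 := l, f := if V A (I x) < V C (I y) then 1 else 0)"
    "mem s' = (mem s)(D := (mem s D)(I z := w))"
    "limbs_value w l = (if V A (I x) < V C (I y)
        then 2 ^ (LENGTH('w) * l) + V A (I x) - V C (I y) else V A (I x) - V C (I y))"
    unfolding ir v by blast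
  have "agree l X s' (I(f := if V A (I x) < V C (I y) then 1 else 0))
      (V(D := (V D)(I z := limbs_value w l)))"
    unfolding agree_def *(3,4) using s vis by (auto simp: agree_def)
  moreover have "real t \<le> 14 * real l" using *(2) l by linarith
  ultimately show "\<exists>t s' t' I' V'. exec (sub_value L D z A x C y f) s t s' \<and> real t \<le> t' \<and> agree l X s' I' V' \<and> Q (T - t') I' V'"
    by (intro exI conjI) (rule *(1) Q[folded *(5)] | assumption)+
qed

definition holds_data :: "(nat \<Rightarrow> nat) \<Rightarrow> (nat \<Rightarrow> nat \<Rightarrow> nat) \<Rightarrow> nat \<Rightarrow> nat list list \<Rightarrow> bool" where
  "holds_data I V l xss \<longleftrightarrow> I 0 = l \<and>
     (\<forall>k < length xss. I (k + 1) = length (xss ! k) \<and> (\<forall>i < length (xss ! k). V k i = xss ! k ! i))"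

lemma stores_iff_holds_data:
  "stores s l xss \<longleftrightarrow> holds_data (ireg s) (\<lambda>a i. limbs_value (mem s a i) l) l xss"
  by (simp add: stores_def holds_data_def)

text \<open>Below \<open>K\<close> nothing but the output is guaranteed after a call, not even the
  input; from \<open>K\<close> on the frame property keeps everything.\<close>

lemma run_solver:
  fixes W :: "'w::len itself"
  assumes sw: "solves_within W p l inp l Out T0"
    and frame: "prog_writes p \<subseteq> {..<K}"
    and vis: "{..length inp} \<subseteq> X" "{K..} \<subseteq> X"
    and data: "holds_data I V l inp"
    and Q: "\<And>I' V' out. out \<in> Out \<Longrightarrow> holds_data I' V' l out \<Longrightarrow>
      (\<forall>x\<ge>K. I' x = I x \<and> V' x = V x) \<Longrightarrow> Q (T - T0) I' V'"
  shows "run W l X p T I V Q"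
proof (rule runI)
  fix s :: "'w state" assume s: "agree l X s I V"
  have "stores s l inp"
    using s data vis(1) unfolding stores_def holds_data_def agree_def by (auto simp: subset_iff)
  then obtain t s' out where *: "exec p s t s'" "out \<in> Out" "stores s' l out" "real t \<le> T0"
    using sw by (auto simp: solves_within_def)
  let ?I = "ireg s'" and ?V = "\<lambda>a i. limbs_value (mem s' a i) l"
  have "\<forall>x\<ge>K. ?I x = I x \<and> ?V x = V x"
  proof (intro allI impI)
    fix x assume "K \<le> x"
    then have "x \<notin> prog_writes p" "x \<in> X" using frame vis by auto
    then show "?I x = I x \<and> ?V x = V x"
      using exec_frame[OF *(1), of x] s by (auto simp: agree_def)
  qed
  then have "Q (T - T0) ?I ?V" using * by (intro Q) (auto simp: stores_iff_holds_data)
  moreover have "agree l X s' ?I ?V" by (simp add: agree_def)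
  ultimately show "\<exists>t s' t' I' V'. exec p s t s' \<and> real t \<le> t' \<and> agree l X s' I' V' \<and> Q (T - t') I' V'"
    using * by blast
qed

lemma solves_within_runI:
  fixes W :: "'w::len itself"
  assumes "\<And>I V. holds_data I V l inp \<Longrightarrow>
      run W l UNIV p T I V (\<lambda>T' I' V'. 0 \<le> T' \<and> (\<exists>out\<in>Out. holds_data I' V' l out))"
  shows "solves_within W p l inp l Out T"
  unfolding solves_within_def
proof (intro allI impI)
  fix s :: "'w state" assume "stores s l inp"
  then have r: "run W l UNIV p T (ireg s) (\<lambda>a i. limbs_value (mem s a i) l)
      (\<lambda>T' I' V'. 0 \<le> T' \<and> (\<exists>out\<in>Out. holds_data I' V' l out))"
    by (intro assms) (simp add: stores_iff_holds_data)
  have a: "agree l UNIV s (ireg s) (\<lambda>a i. limbs_value (mem s a i) l)" by (simp add: agree_def)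
  obtain t s' t' I' V' out where *: "exec p s t s'" "real t \<le> t'" "agree l UNIV s' I' V'"
    "0 \<le> T - t'" "out \<in> Out" "holds_data I' V' l out"
    using runE[OF r a] by metis
  then have "stores s' l out"
    by (simp add: stores_def holds_data_def agree_def)
  with * show "\<exists>t s' out. exec p s t s' \<and> out \<in> Out \<and> stores s' l out \<and> real t \<le> T"
    by (intro exI[of _ t] exI[of _ s'] exI[of _ out]) auto
qed

section \<open>Building blocks of the Euclidean algorithm\<close>

text \<open>
  From now on the numbers from \<open>K\<close> on are reserved for the Euclidean algorithm, while the called
  programs write below \<open>K\<close> only. Index registers: \<open>K\<close> holds the number of words per value, \<open>K + 1\<close>
  zero, \<open>K + 2\<close> the number of coefficients of the dividend, \<open>K + 3\<close> the degree of the divisor,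
  \<open>K + 4\<close> to \<open>K + 8\<close> counters and borrows, \<open>K + 9\<close> the number of coefficients of the remainder,
  \<open>K + 10\<close> the reason for halting (\<open>1\<close>: zero remainder, \<open>2\<close>: divisor of \<open>N\<close> found).
  Memory areas: \<open>K\<close>, \<open>K + 1\<close>, \<open>K + 2\<close> hold the modulus, one and zero in row 0, \<open>K + 3\<close> the dividend
  and remainder, \<open>K + 4\<close> the divisor, \<open>K + 5\<close> the monic associate of the divisor (without its leading
  coefficient), \<open>K + 6\<close> and \<open>K + 7\<close> intermediate values, \<open>K + 8\<close> a gcd or an inverse.
\<close>

definition call_unary :: "nat \<Rightarrow> prog \<Rightarrow> nat \<Rightarrow> nat \<Rightarrow> nat \<Rightarrow> prog" where
  "call_unary K p A x D =
     copy_value K K (K + 1) 0 (K + 1) ;; copy_value K A x 1 (K + 1) ;;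
     Instr (IndexCopy 0 K) ;; Instr (IndexZero 1) ;; Instr (IndexInc 1) ;;
     Instr (IndexZero 2) ;; Instr (IndexInc 2) ;; p ;; copy_value K 0 (K + 1) D (K + 1)"

definition call_binary :: "nat \<Rightarrow> prog \<Rightarrow> nat \<Rightarrow> nat \<Rightarrow> nat \<Rightarrow> nat \<Rightarrow> nat \<Rightarrow> prog" where
  "call_binary K p A x C y D =
     copy_value K K (K + 1) 0 (K + 1) ;; copy_value K A x 1 (K + 1) ;; copy_value K C y 2 (K + 1) ;;
     Instr (IndexCopy 0 K) ;; Instr (IndexZero 1) ;; Instr (IndexInc 1) ;;
     Instr (IndexZero 2) ;; Instr (IndexInc 2) ;; Instr (IndexZero 3) ;; Instr (IndexInc 3) ;;
     p ;; copy_value K 0 (K + 1) D (K + 1)"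

text \<open>If \<open>x - y\<close> borrows, the residue is \<open>N - (y - x)\<close>, which takes
  two more subtractions and no addition. Thus \<open>sub_value\<close> is the only multiword
  arithmetic that has to be programmed.\<close>

definition mod_sub :: "nat \<Rightarrow> nat \<Rightarrow> nat \<Rightarrow> prog" where
  "mod_sub K D z =
     sub_value K (K + 7) (K + 1) D z (K + 6) (K + 1) (K + 7) ;;
     If (IndexLess (K + 1) (K + 7))
       (sub_value K (K + 7) (K + 1) (K + 6) (K + 1) D z (K + 7) ;;
        sub_value K (K + 7) (K + 1) K (K + 1) (K + 7) (K + 1) (K + 7)) Skip ;;
     copy_value K (K + 7) (K + 1) D z"

definition copy_rows :: "nat \<Rightarrow> nat \<Rightarrow> nat \<Rightarrow> nat \<Rightarrow> prog" where
  "copy_rows K A C r =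
     Instr (IndexZero (K + 5)) ;;
     While (IndexLess (K + 5) r)
       (copy_value K A (K + 5) C (K + 5) ;; Instr (IndexInc (K + 5)))"

definition eliminate :: "nat \<Rightarrow> prog \<Rightarrow> prog" where
  "eliminate K pm =
     Instr (IndexCopy (K + 5) (K + 4)) ;; Instr (IndexCopy (K + 6) (K + 3)) ;;
     While (IndexLess (K + 1) (K + 6))
       (Instr (IndexDec (K + 5)) ;; Instr (IndexDec (K + 6)) ;;
        call_binary K pm (K + 3) (K + 4) (K + 5) (K + 6) (K + 6) ;; mod_sub K (K + 3) (K + 5))"

definition divide :: "nat \<Rightarrow> prog \<Rightarrow> prog" where
  "divide K pm =
     Instr (IndexCopy (K + 4) (K + 2)) ;;
     While (IndexLess (K + 3) (K + 4)) (Instr (IndexDec (K + 4)) ;; eliminate K pm)"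

text \<open>The subtraction \<open>0 - x\<close> borrows exactly if \<open>x\<close> is nonzero,
  which gives the zero test. Register \<open>K + 9\<close> receives one more than the last nonzero
  position, so 0 stands for the zero polynomial.\<close>

definition measure_length :: "nat \<Rightarrow> prog" where
  "measure_length K =
     Instr (IndexZero (K + 9)) ;; Instr (IndexZero (K + 5)) ;;
     While (IndexLess (K + 5) (K + 3))
       (sub_value K (K + 7) (K + 1) (K + 2) (K + 1) (K + 3) (K + 5) (K + 7) ;;
        If (IndexLess (K + 1) (K + 7))
          (Instr (IndexCopy (K + 9) (K + 5)) ;; Instr (IndexInc (K + 9))) Skip ;;
        Instr (IndexInc (K + 5)))"

definition scale :: "nat \<Rightarrow> prog \<Rightarrow> prog" where
  "scale K pm =
     Instr (IndexCopy (K + 6) (K + 4)) ;;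
     While (IndexLess (K + 1) (K + 6))
       (Instr (IndexDec (K + 6)) ;;
        call_binary K pm (K + 8) (K + 1) (K + 3) (K + 6) (K + 6) ;;
        copy_value K (K + 6) (K + 1) (K + 5) (K + 6))"

definition diff_mod :: "nat \<Rightarrow> nat \<Rightarrow> nat \<Rightarrow> nat" where
  "diff_mod N x y = (if y \<le> x then x - y else N - (y - x))"

lemma diff_mod_less: "x < N \<Longrightarrow> y < N \<Longrightarrow> diff_mod N x y < N"
  by (auto simp: diff_mod_def)

lemma int_diff_mod:
  assumes "x < N" "y < N"
  shows "int (diff_mod N x y) = (int x - int y) mod int N"
proof (cases "y \<le> x")
  case True
  with assms show ?thesis by (simp add: diff_mod_def of_nat_diff)
next
  case False
  then have "(int x - int y) mod int N = (int x - int y + int N) mod int N" by simp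
  also have "\<dots> = int x - int y + int N" using False assms by (intro mod_pos_pos_trivial) auto
  finally show ?thesis using False assms by (simp add: diff_mod_def of_nat_diff)
qed

text \<open>
  The divisor is monic of degree \<open>n\<close> and \<open>r\<close> holds its other coefficients; the entry \<open>k\<close> that is
  cancelled keeps its old value, since it is never read again.
\<close>

definition cancel_top :: "nat \<Rightarrow> nat \<Rightarrow> (nat \<Rightarrow> nat) \<Rightarrow> nat \<Rightarrow> (nat \<Rightarrow> nat) \<Rightarrow> nat \<Rightarrow> nat" where
  "cancel_top N n r k f i =
     (if k - n \<le> i \<and> i < k then diff_mod N (f i) (f k * r (i - (k - n)) mod N) else f i)"

fun long_division :: "nat \<Rightarrow> nat \<Rightarrow> (nat \<Rightarrow> nat) \<Rightarrow> nat \<Rightarrow> nat \<Rightarrow> (nat \<Rightarrow> nat) \<Rightarrow> nat \<Rightarrow> nat" where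
  "long_division N n r m 0 f = f"
| "long_division N n r m (Suc t) f = cancel_top N n r (m - t) (long_division N n r m t f)"

lemma long_division_less:
  assumes "\<And>i. i \<le> m \<Longrightarrow> f i < N" "i \<le> m" "N > 0"
  shows "long_division N n r m t f i < N"
  using assms(2)
proof (induction t arbitrary: i)
  case (Suc t)
  then show ?case using assms(3) by (auto simp: cancel_top_def intro!: diff_mod_less)
qed (use assms in auto)

abbreviation same_except :: "'a set \<Rightarrow> ('a \<Rightarrow> 'b) \<Rightarrow> ('a \<Rightarrow> 'b) \<Rightarrow> bool" where
  "same_except S f g \<equiv> \<forall>x. x \<notin> S \<longrightarrow> f x = g x"

section \<open>Calls of given programs and residue arithmetic\<close>

locale modular_machine =
  fixes W :: "'w::len itself" and l N K :: nat
  assumes l: "1 \<le> l" and N: "2 \<le> N" and K: "10 \<le> K"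
begin

definition ready :: "(nat \<Rightarrow> nat) \<Rightarrow> (nat \<Rightarrow> nat \<Rightarrow> nat) \<Rightarrow> bool" where
  "ready I V \<longleftrightarrow> I K = l \<and> I (K + 1) = 0 \<and> V K 0 = N \<and> V (K + 1) 0 = 1 \<and> V (K + 2) 0 = 0"

lemma l_real: "1 \<le> real l" using l by simp

lemmas straight = run_Seq run_IndexZero run_IndexCopy run_IndexInc run_IndexDec run_copy_value run_sub_value

text \<open>Three copies cost \<open>18 * l\<close>, and the five index instructions are charged
  \<open>l\<close> each. The set \<open>R\<close> leaves room for programs specified by a property
  of their result, as the inversion is.\<close>

lemma run_call_unary:
  assumes Q: "\<And>r. r \<in> R \<Longrightarrow> Q (T - (T0 + 23 * real l)) I (V(D := (V D)(0 := r)))"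
    and sw: "solves_within W p l [[N], [V A (I x)]] l {[[r]] | r. r \<in> R} T0"
    and p: "prog_writes p \<subseteq> {..<K}"
    and ready: "ready I V" and ge: "K \<le> A" "K \<le> x" "K \<le> D"
  shows "run W l {K..} (call_unary K p A x D) T I V Q"
proof (rule run_conseq[where c = "T0 + 23 * real l"
      and R = "\<lambda>I' V'. \<exists>r\<in>R. I' = I \<and> V' = V(D := (V D)(0 := r))"])
  show "run W l {K..} (call_unary K p A x D) T I V (\<lambda>T' I' V'.
      T - (T0 + 23 * real l) \<le> T' \<and> (\<exists>r\<in>R. I' = I \<and> V' = V(D := (V D)(0 := r))))"
  proof (rule run_restrict[where Y = "- {4}"])
    show "{K..} \<subseteq> - {4}" using K by auto
    fix I1 :: "nat \<Rightarrow> nat" and V1 :: "nat \<Rightarrow> nat \<Rightarrow> nat" assume 1: "\<forall>x\<in>{K..}. I1 x = I x \<and> V1 x = V x"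
    have rd: "I1 K = l" "I1 (Suc K) = 0" "V1 K 0 = N" "V1 A (I1 x) = V A (I x)"
      using 1 ready ge by (auto simp: ready_def)
    show "run W l (- {4}) (call_unary K p A x D) T I1 V1 (\<lambda>T' I' V'.
        \<exists>I'' V''. (\<forall>x\<in>{K..}. I' x = I'' x \<and> V' x = V'' x) \<and> T - (T0 + 23 * real l) \<le> T' \<and>
          (\<exists>r\<in>R. I'' = I \<and> V'' = V(D := (V D)(0 := r))))"
      unfolding call_unary_def
      apply (rule straight)+
          apply (rule run_solver[OF sw p])
             apply auto[1]
      subgoal using K by auto
      subgoal using rd K ge l by (auto simp: holds_data_def less_Suc_eq)
           apply (rule straight)+
      subgoal premises prems for I' V' out
      proof -
        obtain r where r: "out = [[r]]" "r \<in> R" using prems(1) by auto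
        have "V' 0 0 = r" using prems(2) r by (simp add: holds_data_def)
        moreover have "I' x = I x" "V' x = V x" if "K \<le> x" for x
          using prems(3) 1 that K by auto
        ultimately show ?thesis using r(2) rd ge K l_real ready
          by (intro exI[of _ I] exI[of _ "V(D := (V D)(0 := r))"]) (auto simp: ready_def)
      qed
      using rd K l ge by auto
  qed
next
  show "Q (T - (T0 + 23 * real l)) I' V'" if "\<exists>r\<in>R. I' = I \<and> V' = V(D := (V D)(0 := r))" for I' V'
    using that Q by auto
qed

lemma run_call_binary:
  assumes Q: "Q (T - (T0 + 31 * real l)) I (V(D := (V D)(0 := r)))"
    and sw: "solves_within W p l [[N], [V A (I x)], [V C (I y)]] l {[[r]]} T0"
    and p: "prog_writes p \<subseteq> {..<K}"
    and ready: "ready I V" and ge: "K \<le> A" "K \<le> x" "K \<le> C" "K \<le> y" "K \<le> D"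
  shows "run W l {K..} (call_binary K p A x C y D) T I V Q"
proof (rule run_conseq[where c = "T0 + 31 * real l"
      and R = "\<lambda>I' V'. I' = I \<and> V' = V(D := (V D)(0 := r))"])
  show "run W l {K..} (call_binary K p A x C y D) T I V (\<lambda>T' I' V'.
      T - (T0 + 31 * real l) \<le> T' \<and> I' = I \<and> V' = V(D := (V D)(0 := r)))"
  proof (rule run_restrict[where Y = "- {4}"])
    show "{K..} \<subseteq> - {4}" using K by auto
    fix I1 :: "nat \<Rightarrow> nat" and V1 :: "nat \<Rightarrow> nat \<Rightarrow> nat" assume 1: "\<forall>x\<in>{K..}. I1 x = I x \<and> V1 x = V x"
    have rd: "I1 K = l" "I1 (Suc K) = 0" "V1 K 0 = N" "V1 A (I1 x) = V A (I x)" "V1 C (I1 y) = V C (I y)"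
      using 1 ready ge by (auto simp: ready_def)
    show "run W l (- {4}) (call_binary K p A x C y D) T I1 V1 (\<lambda>T' I' V'.
        \<exists>I'' V''. (\<forall>x\<in>{K..}. I' x = I'' x \<and> V' x = V'' x) \<and> T - (T0 + 31 * real l) \<le> T' \<and>
          I'' = I \<and> V'' = V(D := (V D)(0 := r)))"
      unfolding call_binary_def
      apply (rule straight)+
          apply (rule run_solver[OF sw p])
             apply auto[1]
      subgoal using K by auto
      subgoal using rd K ge l by (auto simp: holds_data_def less_Suc_eq)
           apply (rule straight)+
      subgoal premises prems for I' V' out
      proof -
        have "V' 0 0 = r" using prems(1,2) by (simp add: holds_data_def)
        moreover have "I' x = I x" "V' x = V x" if "K \<le> x" for x
          using prems(3) 1 that K by auto
        ultimately show ?thesis using rd ge K l_real ready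
          by (intro exI[of _ I] exI[of _ "V(D := (V D)(0 := r))"]) (auto simp: ready_def)
      qed
      using rd K l ge by auto
  qed
qed (use Q in auto)

text \<open>The scratch contents \<open>f\<close> and \<open>v\<close> are left unspecified. The
  bound \<open>60 * l\<close> has slack over three subtractions, one copy and one test, which take
  at most \<open>49 * l\<close>.\<close>

lemma run_mod_sub:
  assumes Q: "\<And>f v. Q (T - 60 * real l) (I(K + 7 := f))
      (V(K + 7 := v, D := (V D)(I z := diff_mod N (V D (I z)) (V (K + 6) 0))))"
    and ready: "ready I V" and less: "V D (I z) < N" "V (K + 6) 0 < N"
    and ge: "K \<le> D" "K \<le> z" and ne: "D \<noteq> K + 7" "D \<noteq> K" "z \<noteq> K + 7"
  shows "run W l {K..} (mod_sub K D z) T I V Q"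
proof (rule run_conseq[where c = "60 * real l" and R = "\<lambda>I' V'. \<exists>f v. I' = I(K + 7 := f) \<and>
      V' = V(K + 7 := v, D := (V D)(I z := diff_mod N (V D (I z)) (V (K + 6) 0)))"])
  let ?R = "\<lambda>I' V'. \<exists>f v. I' = I(K + 7 := f) \<and>
      V' = V(K + 7 := v, D := (V D)(I z := diff_mod N (V D (I z)) (V (K + 6) 0)))"
  have upd: "V(K + 7 := v, D := w) = V(D := w, K + 7 := v)" for v w
    using ne by (simp add: fun_upd_twist)
  show "run W l {K..} (mod_sub K D z) T I V (\<lambda>T' I' V'. T - 60 * real l \<le> T' \<and> ?R I' V')"
  proof (cases "V (K + 6) 0 \<le> V D (I z)")
    case True
    show ?thesis
      unfolding mod_sub_def
      apply (rule straight)+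
               apply (rule run_If)
      subgoal by simp
      subgoal using True ready ne by (simp add: ready_def)
               apply (rule run_Skip straight)+
      subgoal using True ready ne ge l_real
        by (auto simp: ready_def diff_mod_def intro!: exI)
      using ready ne ge K l by (auto simp: ready_def)
  next
    case False
    show ?thesis
      unfolding mod_sub_def
      apply (rule straight)+
               apply (rule run_If)
      subgoal by simp
               apply (rule straight)+
      subgoal using False ready ne ge l_real less
        by (auto simp: ready_def diff_mod_def)
      using False ready ne ge K l by (auto simp: ready_def)
  qed
qed (use Q in auto)

end

context modular_machine
begin

lemma ready_update [simp]:
  "x \<noteq> K \<Longrightarrow> x \<noteq> K + 1 \<Longrightarrow> ready (I(x := a)) V \<longleftrightarrow> ready I V"
  "A \<noteq> K \<Longrightarrow> A \<noteq> K + 1 \<Longrightarrow> A \<noteq> K + 2 \<Longrightarrow> ready I (V(A := w)) \<longleftrightarrow> ready I V"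
  by (simp_all add: ready_def)

lemma run_copy_rows:
  assumes Q: "\<And>j. Q (T - (real (I r) * (8 * real l) + 2)) (I(K + 5 := j))
      (V(C := (\<lambda>i. if i < I r then V A i else V C i)))"
    and vis: "{K..} \<subseteq> X" "A \<in> X" "r \<in> X" "4 \<notin> X"
    and IK: "I K = l" and ne: "A \<noteq> C" "r \<noteq> K + 5"
  shows "run W l X (copy_rows K A C r) T I V Q"
  unfolding copy_rows_def
  apply (rule run_Seq)
  apply (rule run_IndexZero)
  \<comment> \<open>Copying, increment and test take at most \<open>6 * l + 2\<close>, hence
    \<open>8 * l\<close>, per row; the \<open>- 1\<close> compensates for the test that
    \<open>run_while_const\<close> adds. The loops below follow the same pattern.\<close>
  apply (rule run_while_const[where n = "I r" and c = "8 * real l - 1" and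
        Inv = "\<lambda>k I' V'. I' = I(K + 5 := k) \<and>
          V' = V(C := (\<lambda>i. if i < k then V A i else V C i))"])
  subgoal for k T' I' V'
    apply (rule conjI)
    subgoal using ne by simp
    apply (rule straight)+
    subgoal using l_real ne IK by (auto simp: fun_eq_iff)
    using vis IK l by auto
  subgoal using ne by simp
  subgoal using vis by auto
  subgoal by (auto simp: fun_eq_iff)
  subgoal for I' V'
    using Q[of "I r"] by (simp add: algebra_simps)
  done

lemma run_measure_length:
  assumes Q: "\<And>I' V'. same_except {K + 5, K + 7, K + 9} I' I \<Longrightarrow> same_except {K + 7} V' V \<Longrightarrow>
      I' (K + 9) \<le> I (K + 3) \<Longrightarrow> (\<And>i. I' (K + 9) \<le> i \<Longrightarrow> i < I (K + 3) \<Longrightarrow> V (K + 3) i = 0) \<Longrightarrow>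
      (I' (K + 9) > 0 \<Longrightarrow> V (K + 3) (I' (K + 9) - 1) \<noteq> 0) \<Longrightarrow>
      Q (T - (real (I (K + 3)) * (19 * real l) + 3)) I' V'"
    and ready: "ready I V"
  shows "run W l {K..} (measure_length K) T I V Q"
  unfolding measure_length_def
  apply (rule run_Seq)
  apply (rule run_IndexZero)
  apply (rule run_Seq)
  apply (rule run_IndexZero)
  apply (rule run_while_const[where n = "I (K + 3)" and c = "19 * real l - 1" and
        Inv = "\<lambda>k I' V'. same_except {K + 5, K + 7, K + 9} I' I \<and> same_except {K + 7} V' V \<and>
          I' (K + 5) = k \<and> I' (K + 9) \<le> k \<and> (\<forall>i. I' (K + 9) \<le> i \<longrightarrow> i < k \<longrightarrow> V (K + 3) i = 0) \<and>
          (I' (K + 9) > 0 \<longrightarrow> V (K + 3) (I' (K + 9) - 1) \<noteq> 0)"])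
  subgoal for k T' I' V'
    apply (rule conjI)
    subgoal by simp
    apply (rule straight)+
                     apply (rule run_If)
    subgoal by simp
                      apply (rule straight)+
    subgoal using l_real ready by (auto simp: ready_def split: if_splits)
    subgoal by simp
    subgoal by simp
    subgoal by simp
     apply (rule run_Skip straight)+
    subgoal using l_real ready by (auto simp: ready_def less_Suc_eq split: if_splits)
    using ready K l by (auto simp: ready_def)
  subgoal by simp
  subgoal by simp
  subgoal by simp
  subgoal for I' V'
    using Q[of I' V'] by (simp add: algebra_simps)
  done

end

section \<open>Long division and scaling with counted multiplications\<close>

locale modular_multiplier = modular_machine W l N K
  for W :: "'w::len itself" and l N K :: nat +
  fixes pm :: prog and Mm :: real
  assumes pm_writes: "prog_writes pm \<subseteq> {..<K}"
    and pm: "\<And>a b. a < N \<Longrightarrow> b < N \<Longrightarrow> solves_within W pm l [[N], [a], [b]] l {[[a * b mod N]]} Mm"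
begin

lemma run_mult:
  assumes "Q (T - (Mm + 31 * real l)) I (V(D := (V D)(0 := V A (I x) * V C (I y) mod N)))"
    and "V A (I x) < N" "V C (I y) < N"
    and "ready I V" "K \<le> A" "K \<le> x" "K \<le> C" "K \<le> y" "K \<le> D"
  shows "run W l {K..} (call_binary K pm A x C y D) T I V Q"
  by (rule run_call_binary[OF _ pm pm_writes]) (use assms in auto)

lemma run_eliminate:
  assumes Q: "\<And>I' V'. same_except {K + 5, K + 6, K + 7} I' I \<Longrightarrow>
      same_except {K + 3, K + 6, K + 7} V' V \<Longrightarrow>
      V' (K + 3) = cancel_top N (I (K + 3)) (V (K + 5)) (I (K + 4)) (V (K + 3)) \<Longrightarrow>
      Q (T - (real (I (K + 3)) * (Mm + 94 * real l) + 3)) I' V'"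
    and ready: "ready I V" and le: "I (K + 3) \<le> I (K + 4)"
    and less: "\<And>i. i \<le> I (K + 4) \<Longrightarrow> V (K + 3) i < N" "\<And>i. i < I (K + 3) \<Longrightarrow> V (K + 5) i < N"
  shows "run W l {K..} (eliminate K pm) T I V Q"
  unfolding eliminate_def
  apply (rule run_Seq)
  apply (rule run_IndexCopy)
   apply (rule run_Seq)
   apply (rule run_IndexCopy)
    \<comment> \<open>Here 94 is 31 for the call, 60 for the modular subtraction, 2 for the
      decrements and 1 for the test. The updated positions stay below \<open>I (K + 4)\<close>, so
      every pass reads the same multiplier at that position.\<close>
    apply (rule run_while_const[where n = "I (K + 3)" and c = "Mm + 94 * real l - 1" and
        Inv = "\<lambda>t I' V'. same_except {K + 5, K + 6, K + 7} I' I \<and> same_except {K + 3, K + 6, K + 7} V' V \<and>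
          I' (K + 5) = I (K + 4) - t \<and> I' (K + 6) = I (K + 3) - t \<and>
          V' (K + 3) = (\<lambda>i. if I (K + 4) - t \<le> i \<and> i < I (K + 4)
            then diff_mod N (V (K + 3) i) (V (K + 3) (I (K + 4)) * V (K + 5) (i - (I (K + 4) - I (K + 3))) mod N)
            else V (K + 3) i)"])
  subgoal premises prems for t T' I' V'
  proof -
    have t: "t < I (K + 3)" using prems by simp
    have I': "I' (K + 5) = I (K + 4) - t" "I' (K + 6) = I (K + 3) - t" "I' (K + 4) = I (K + 4)"
      and V': "V' (K + 3) = (\<lambda>i. if I (K + 4) - t \<le> i \<and> i < I (K + 4)
            then diff_mod N (V (K + 3) i) (V (K + 3) (I (K + 4)) * V (K + 5) (i - (I (K + 4) - I (K + 3))) mod N)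
            else V (K + 3) i)" "V' (K + 5) = V (K + 5)"
      using prems by auto
    have rd: "ready I' V'" using prems ready by (auto simp: ready_def)
    have q: "V' (K + 3) (I (K + 4)) = V (K + 3) (I (K + 4))" "V (K + 3) (I (K + 4)) < N"
      "V' (K + 3) (I (K + 4) - t - 1) = V (K + 3) (I (K + 4) - t - 1)" "V (K + 3) (I (K + 4) - t - 1) < N"
      "V (K + 5) (I (K + 3) - t - 1) < N"
      using V' t le less by auto
    show ?thesis
      apply (rule conjI)
      subgoal using t I' rd by (simp add: ready_def)
      apply (rule straight)+
            apply (rule run_mult)
                   apply (rule run_mod_sub)
      subgoal for f v
        apply (intro conjI)
        subgoal using l_real by (simp add: algebra_simps)
        subgoal using prems by simp
        subgoal using prems by simp
        subgoal using I' by simp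
        subgoal using I' by simp
        subgoal
        proof -
          have idx: "I (K + 4) - t - 1 - (I (K + 4) - I (K + 3)) = I (K + 3) - t - 1" using t le by simp
          have "I (K + 4) - Suc t \<le> i \<and> i < I (K + 4) \<longleftrightarrow>
              i = I (K + 4) - t - 1 \<or> I (K + 4) - t \<le> i \<and> i < I (K + 4)" for i
            using t le by auto
          then show ?thesis using q idx t le by (auto simp: fun_eq_iff I' V')
        qed
        done
      using rd q I' V'(2) N by simp_all
  qed
  subgoal using ready by (auto simp: ready_def)
  subgoal by simp
  subgoal by (auto simp: fun_eq_iff)
  subgoal for I' V'
    using Q[of I' V'] by (simp add: cancel_top_def fun_eq_iff algebra_simps)
   apply simp
  apply simp
  done

lemma run_divide:
  assumes Q: "\<And>I' V'. same_except {K + 4, K + 5, K + 6, K + 7} I' I \<Longrightarrow>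
      same_except {K + 3, K + 6, K + 7} V' V \<Longrightarrow>
      V' (K + 3) = long_division N n (V (K + 5)) m (Suc m - n) (V (K + 3)) \<Longrightarrow>
      Q (T - (real (Suc m - n) * (real n * (Mm + 94 * real l) + 5) + 2)) I' V'"
    and ready: "ready I V" and deg: "I (K + 2) = Suc m" "I (K + 3) = n" "n \<le> m"
    and less: "\<And>i. i \<le> m \<Longrightarrow> V (K + 3) i < N" "\<And>i. i < n \<Longrightarrow> V (K + 5) i < N"
  shows "run W l {K..} (divide K pm) T I V Q"
  unfolding divide_def
  apply (rule run_Seq)
  apply (rule run_IndexCopy)
   apply (rule run_while_const[where n = "Suc m - n" and c = "real n * (Mm + 94 * real l) + 4" and
        Inv = "\<lambda>t I' V'. same_except {K + 4, K + 5, K + 6, K + 7} I' I \<and>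
          same_except {K + 3, K + 6, K + 7} V' V \<and> I' (K + 4) = Suc m - t \<and>
          V' (K + 3) = long_division N n (V (K + 5)) m t (V (K + 3))"])
  subgoal premises prems for t T' I' V'
  proof -
    have t: "t < Suc m - n" using prems by simp
    have I': "I' (K + 4) = Suc m - t" "I' (K + 3) = n"
      and V': "V' (K + 3) = long_division N n (V (K + 5)) m t (V (K + 3))" "V' (K + 5) = V (K + 5)"
      using prems deg by auto
    have rd: "ready I' V'" using prems ready by (auto simp: ready_def)
    have e: "Suc m - t - 1 = m - t" using t by simp
    have b: "V' (K + 3) i < N" if "i \<le> m" for i
      unfolding V' using long_division_less[of m "V (K + 3)" N i] less(1) that N by simp
    show ?thesis
      apply (rule conjI)
      subgoal using t I' by auto
      apply (rule straight)+
       apply (rule run_eliminate)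
      subgoal for I'' V''
        using prems I' V' e by (auto)
      subgoal using rd by (simp add: ready_def)
      using I' V' e t less b by auto
  qed
  subgoal using deg by auto
  subgoal by simp
  subgoal using deg by auto
  subgoal for I' V'
    using Q[of I' V'] by (simp add: algebra_simps)
  apply simp
  done

lemma run_scale:
  assumes Q: "\<And>I' V'. same_except {K + 6} I' I \<Longrightarrow>
      same_except {K + 5, K + 6} V' V \<Longrightarrow>
      (\<And>i. i < I (K + 4) \<Longrightarrow> V' (K + 5) i = V (K + 8) 0 * V (K + 3) i mod N) \<Longrightarrow>
      Q (T - (real (I (K + 4)) * (Mm + 39 * real l) + 2)) I' V'"
    and ready: "ready I V"
    and less: "\<And>i. i < I (K + 4) \<Longrightarrow> V (K + 3) i < N" "V (K + 8) 0 < N"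
  shows "run W l {K..} (scale K pm) T I V Q"
  unfolding scale_def
  apply (rule run_Seq)
  apply (rule run_IndexCopy)
   apply (rule run_while_const[where n = "I (K + 4)" and c = "Mm + 39 * real l - 1" and
        Inv = "\<lambda>t I' V'. same_except {K + 6} I' I \<and> same_except {K + 5, K + 6} V' V \<and>
          I' (K + 6) = I (K + 4) - t \<and>
          (\<forall>i. I (K + 4) - t \<le> i \<longrightarrow> i < I (K + 4) \<longrightarrow> V' (K + 5) i = V (K + 8) 0 * V (K + 3) i mod N)"])
  subgoal premises prems for t T' I' V'
  proof -
    have t: "t < I (K + 4)" using prems by simp
    have I': "I' (K + 6) = I (K + 4) - t" "I' (K + 4) = I (K + 4)"
      and V': "V' (K + 3) = V (K + 3)" "V' (K + 8) = V (K + 8)"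
      using prems by auto
    have rd: "ready I' V'" using prems ready by (auto simp: ready_def)
    have b: "V (K + 3) (I (K + 4) - t - 1) < N" using less t by auto
    show ?thesis
      apply (rule conjI)
      subgoal using t I' rd by (simp add: ready_def)
      apply (rule straight)+
          apply (rule run_mult)
                  apply (rule straight)+
      subgoal
        using l_real prems I' V' t rd by (auto simp: ready_def)
      using rd b less I' V' K l by (auto simp: ready_def)
  qed
  subgoal using ready by (auto simp: ready_def)
  subgoal by simp
  subgoal by simp
  subgoal for I' V'
    using Q[of I' V'] by (simp add: algebra_simps)
  apply simp
  done

end

text \<open>The remainder is parked in area \<open>K + 6\<close> because area \<open>K + 3\<close>
  must first receive the old divisor. The increment turns the degree of that divisor into its number
  of coefficients, as register \<open>K + 2\<close> requires. Both polynomials are kept without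
  normalization.\<close>

definition rotate_areas :: "nat \<Rightarrow> prog" where
  "rotate_areas K =
     copy_rows K (K + 3) (K + 6) (K + 9) ;; Instr (IndexInc (K + 3)) ;;
     copy_rows K (K + 4) (K + 3) (K + 3) ;; copy_rows K (K + 6) (K + 4) (K + 9) ;;
     Instr (IndexCopy (K + 2) (K + 3)) ;; Instr (IndexCopy (K + 3) (K + 4))"

text \<open>The subtraction \<open>1 - x\<close> borrows exactly if \<open>x\<close> exceeds 1. The
  given programs are specified only for arguments from 2 on, so they are called only in that case;
  for leading coefficient 1 the value 1 stored beforehand in area \<open>K + 8\<close> is both the
  gcd and the inverse.\<close>

definition euclid_round :: "nat \<Rightarrow> prog \<Rightarrow> prog \<Rightarrow> prog \<Rightarrow> prog" where
  "euclid_round K pm pg pv =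
     divide K pm ;; measure_length K ;;
     If (IndexEq (K + 9) (K + 1)) (Instr (IndexInc (K + 10)))
       (Instr (IndexCopy (K + 4) (K + 9)) ;; Instr (IndexDec (K + 4)) ;;
        sub_value K (K + 7) (K + 1) (K + 1) (K + 1) (K + 3) (K + 4) (K + 7) ;;
        copy_value K (K + 1) (K + 1) (K + 8) (K + 1) ;;
        If (IndexLess (K + 1) (K + 7)) (call_unary K pg (K + 3) (K + 4) (K + 8)) Skip ;;
        sub_value K (K + 7) (K + 1) (K + 1) (K + 1) (K + 8) (K + 1) (K + 8) ;;
        If (IndexLess (K + 1) (K + 8)) (Instr (IndexInc (K + 10)) ;; Instr (IndexInc (K + 10)))
          (If (IndexLess (K + 1) (K + 7)) (call_unary K pv (K + 3) (K + 4) (K + 8)) Skip ;;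
           scale K pm ;; rotate_areas K))"

context modular_machine
begin

lemma run_rotate_areas:
  assumes Q: "\<And>I' V'. same_except {K + 2, K + 3, K + 5} I' I \<Longrightarrow> same_except {K + 3, K + 4, K + 6} V' V \<Longrightarrow>
      I' (K + 2) = Suc (I (K + 3)) \<Longrightarrow> I' (K + 3) = I (K + 4) \<Longrightarrow>
      (\<And>i. i \<le> I (K + 3) \<Longrightarrow> V' (K + 3) i = V (K + 4) i) \<Longrightarrow>
      (\<And>i. i < I (K + 9) \<Longrightarrow> V' (K + 4) i = V (K + 3) i) \<Longrightarrow>
      Q (T - (24 * real (I (K + 3)) * real l + 17 * real l)) I' V'"
    and ready: "ready I V" and le: "I (K + 9) \<le> I (K + 3)"
  shows "run W l {K..} (rotate_areas K) T I V Q"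
proof (rule run_conseq[where c = "24 * real (I (K + 3)) * real l + 17 * real l" and R = "\<lambda>I' V'.
      same_except {K + 2, K + 3, K + 5} I' I \<and> same_except {K + 3, K + 4, K + 6} V' V \<and>
      I' (K + 2) = Suc (I (K + 3)) \<and> I' (K + 3) = I (K + 4) \<and>
      (\<forall>i. i \<le> I (K + 3) \<longrightarrow> V' (K + 3) i = V (K + 4) i) \<and>
      (\<forall>i. i < I (K + 9) \<longrightarrow> V' (K + 4) i = V (K + 3) i)"])
  have IK: "I K = l" using ready by (simp add: ready_def)
  have le': "real (I (K + 9)) * real l \<le> real (I (K + 3)) * real l"
    using le by (intro mult_right_mono) auto
  have cost: "(real (I (K + 9)) * (8 * real l) + 2) + 1 + (real (Suc (I (K + 3))) * (8 * real l) + 2) +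
      (real (I (K + 9)) * (8 * real l) + 2) + 1 + 1 \<le> 24 * real (I (K + 3)) * real l + 17 * real l"
  proof -
    have "real (I (K + 9)) * (8 * real l) = 8 * (real (I (K + 9)) * real l)"
      "real (Suc (I (K + 3))) * (8 * real l) = 8 * (real (I (K + 3)) * real l) + 8 * real l"
      by (simp_all add: algebra_simps)
    with le' l_real show ?thesis by linarith
  qed
  show "run W l {K..} (rotate_areas K) T I V (\<lambda>T' I' V'. T - (24 * real (I (K + 3)) * real l + 17 * real l) \<le> T' \<and>
      same_except {K + 2, K + 3, K + 5} I' I \<and> same_except {K + 3, K + 4, K + 6} V' V \<and>
      I' (K + 2) = Suc (I (K + 3)) \<and> I' (K + 3) = I (K + 4) \<and>
      (\<forall>i. i \<le> I (K + 3) \<longrightarrow> V' (K + 3) i = V (K + 4) i) \<and>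
      (\<forall>i. i < I (K + 9) \<longrightarrow> V' (K + 4) i = V (K + 3) i))"
    unfolding rotate_areas_def
    apply (rule run_Seq)
    apply (rule run_copy_rows)
    apply (rule run_Seq)
    apply (rule run_IndexInc)
    apply (rule run_Seq)
    apply (rule run_copy_rows)
    apply (rule run_Seq)
    apply (rule run_copy_rows)
    apply (rule run_Seq)
    apply (rule run_IndexCopy)
    apply (rule run_IndexCopy)
    subgoal using cost by simp
    using IK K by simp_all
qed (use Q in blast)

end

section \<open>Correctness and cost of a single round\<close>

locale euclid_machine = modular_multiplier W l N K pm Mm
  for W :: "'w::len itself" and l N K :: nat and pm :: prog and Mm :: real +
  fixes pg pv :: prog and G :: real
  assumes pg_writes: "prog_writes pg \<subseteq> {..<K}" and pv_writes: "prog_writes pv \<subseteq> {..<K}"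
    and G: "0 \<le> G"
    and pg: "\<And>b. b \<in> {2..<N} \<Longrightarrow> solves_within W pg l [[N], [b]] l {[[gcd b N]]} G"
    and pv: "\<And>b. b \<in> {2..<N} \<Longrightarrow> coprime b N \<Longrightarrow>
      solves_within W pv l [[N], [b]] l {[[y]] | y. y < N \<and> [b * y = 1] (mod N)} G"
begin

text \<open>This is the beginning shared by the three outcomes of a round. The conditions on
  \<open>len\<close> determine it, so a measured value that is smaller or larger contradicts
  them.\<close>

lemma run_divide_measure:
  fixes m n :: nat and I :: "nat \<Rightarrow> nat" and V :: "nat \<Rightarrow> nat \<Rightarrow> nat"
  defines "r \<equiv> long_division N n (V (K + 5)) m (Suc m - n) (V (K + 3))"
  assumes Q: "\<And>I' V'. same_except {K + 4, K + 5, K + 6, K + 7, K + 9} I' I \<Longrightarrow>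
      same_except {K + 3, K + 6, K + 7} V' V \<Longrightarrow> V' (K + 3) = r \<Longrightarrow> I' (K + 9) = len \<Longrightarrow>
      run W l {K..} p (T - (real (Suc m - n) * (real n * (Mm + 94 * real l) + 5) + 19 * real n * real l + 5)) I' V' Q"
    and ready: "ready I V" and deg: "I (K + 2) = Suc m" "I (K + 3) = n" "n \<le> m"
    and less: "\<And>i. i \<le> m \<Longrightarrow> V (K + 3) i < N" "\<And>i. i < n \<Longrightarrow> V (K + 5) i < N"
    and len: "len \<le> n" "\<And>i. len \<le> i \<Longrightarrow> i < n \<Longrightarrow> r i = 0" "len > 0 \<Longrightarrow> r (len - 1) \<noteq> 0"
  shows "run W l {K..} (divide K pm ;; measure_length K ;; p) T I V Q"
  apply (rule run_Seq)
  apply (rule run_divide[where n = n and m = m])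
  subgoal premises p1 for I1 V1
    apply (rule run_Seq)
    apply (rule run_measure_length)
    subgoal premises p2 for I2 V2
    proof -
      have V1: "V1 (K + 3) = r" using p1 by (simp add: r_def)
      have n: "I1 (K + 3) = n" using p1 deg by simp
      have "I2 (K + 9) = len"
      proof (rule linorder_cases[of "I2 (K + 9)" len])
        assume "I2 (K + 9) < len"
        then show ?thesis using p2(4)[of "len - 1"] len n V1 by auto
      next
        assume a: "len < I2 (K + 9)"
        then have "r (I2 (K + 9) - 1) = 0" using p2(3) n by (intro len(2)) auto
        then show ?thesis using p2(5) V1 a by auto
      qed auto
      moreover have "same_except {K + 4, K + 5, K + 6, K + 7, K + 9} I2 I" using p1(1) p2(1) by simp
      moreover have "same_except {K + 3, K + 6, K + 7} V2 V" using p1(2) p2(2) by simp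
      moreover have "V2 (K + 3) = r" using p2(2) V1 by simp
      ultimately show ?thesis using Q[of I2 V2] n by (simp add: algebra_simps)
    qed
    subgoal using p1 ready by (simp add: ready_def)
    done
  using ready deg less by auto

lemma run_round_zero:
  fixes m n :: nat and I :: "nat \<Rightarrow> nat" and V :: "nat \<Rightarrow> nat \<Rightarrow> nat"
  defines "r \<equiv> long_division N n (V (K + 5)) m (Suc m - n) (V (K + 3))"
  assumes ready: "ready I V" and deg: "I (K + 2) = Suc m" "I (K + 3) = n" "n \<le> m"
    and less: "\<And>i. i \<le> m \<Longrightarrow> V (K + 3) i < N" "\<And>i. i < n \<Longrightarrow> V (K + 5) i < N"
    and zero: "\<And>i. i < n \<Longrightarrow> r i = 0"
  shows "run W l {K..} (euclid_round K pm pg pv) T I V (\<lambda>T' I' V'.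
      T - (real ((Suc m - n) * n) * Mm + 205 * real ((Suc m - n) * Suc n) * real l) \<le> T' \<and>
      ready I' V' \<and> I' (K + 3) = n \<and> I' (K + 10) = Suc (I (K + 10)) \<and> V' (K + 4) = V (K + 4))"
proof -
  have cost: "real (Suc m - n) * (real n * (Mm + 94 * real l) + 5) + 19 * real n * real l + 5 + 2
    \<le> real ((Suc m - n) * n) * Mm + 205 * real ((Suc m - n) * Suc n) * real l"
  proof -
    define a where "a = real (Suc m - n)"
    have a: "1 \<le> a" using deg by (simp add: a_def)
    have "1 * 1 \<le> a * real l" using a l_real by (intro mult_mono) auto
    moreover have "real n * real l \<le> a * (real n * real l)" using mult_right_mono[OF a, of "real n * real l"] by (simp only: mult_1) simp
    moreover have "a \<le> a * real l" using a l_real by simp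
    moreover have "0 \<le> a * (real n * real l)" using a by simp
    ultimately show ?thesis unfolding of_nat_mult a_def[symmetric]
      by (simp add: algebra_simps)
  qed
  show ?thesis
    unfolding euclid_round_def
    apply (rule run_divide_measure[where n = n and m = m and len = 0])
           apply (rule run_If)
    subgoal by simp
    subgoal premises p for I' V'
      apply (rule run_IndexInc)
      using p cost ready deg by (simp_all add: ready_def)
    subgoal premises p for I' V'
      using p ready by (simp add: ready_def)
    using ready deg less zero by (auto simp: r_def)
qed

lemma run_round_gcd:
  fixes m n k :: nat and I :: "nat \<Rightarrow> nat" and V :: "nat \<Rightarrow> nat \<Rightarrow> nat"
  defines "r \<equiv> long_division N n (V (K + 5)) m (Suc m - n) (V (K + 3))"
  assumes ready: "ready I V" and deg: "I (K + 2) = Suc m" "I (K + 3) = n" "n \<le> m"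
    and less: "\<And>i. i \<le> m \<Longrightarrow> V (K + 3) i < N" "\<And>i. i < n \<Longrightarrow> V (K + 5) i < N"
    and k: "k < n" "r k \<noteq> 0" "\<And>i. k < i \<Longrightarrow> i < n \<Longrightarrow> r i = 0" "\<not> coprime (r k) N"
  shows "run W l {K..} (euclid_round K pm pg pv) T I V (\<lambda>T' I' V'.
      T - (real ((Suc m - n) * n) * Mm + 205 * real ((Suc m - n) * Suc n) * real l + G) \<le> T' \<and>
      ready I' V' \<and> I' (K + 10) = Suc (Suc (I (K + 10))) \<and> V' (K + 8) 0 = gcd (r k) N)"
proof -
  have cost: "real (Suc m - n) * (real n * (Mm + 94 * real l) + 5) + 19 * real n * real l + 5 + 66 * real l
    \<le> real ((Suc m - n) * n) * Mm + 205 * real ((Suc m - n) * Suc n) * real l"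
  proof -
    define a where "a = real (Suc m - n)"
    have a: "1 \<le> a" using deg by (simp add: a_def)
    have "1 * 1 \<le> a * real l" using a l_real by (intro mult_mono) auto
    moreover have "real n * real l \<le> a * (real n * real l)" using mult_right_mono[OF a, of "real n * real l"] by (simp only: mult_1) simp
    moreover have "a \<le> a * real l" using a l_real by simp
    moreover have "real l \<le> a * real l" using a l_real by simp
    moreover have "0 \<le> a * (real n * real l)" using a by simp
    ultimately show ?thesis unfolding of_nat_mult a_def[symmetric]
      by (simp add: algebra_simps)
  qed
  have rk: "r k < N"
    unfolding r_def using long_division_less[of m "V (K + 3)" N k] less(1) k(1) deg(3) N by simp
  \<comment> \<open>Values 0 and 1 are excluded, so the gcd program is applicable.\<close>
  have rk2: "2 \<le> r k" using k(2,4) by (cases "r k = 1") auto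
  have gcd1: "1 < gcd (r k) N"
    using k(4) N by (metis coprime_iff_gcd_eq_1 gcd_nat.neutr_eq_iff less_one linorder_neqE_nat not_numeral_le_zero)
  show ?thesis
    unfolding euclid_round_def
    apply (rule run_divide_measure[where n = n and m = m and len = "Suc k"])
           apply (rule run_If)
    subgoal by simp
    subgoal premises p for I' V'
      using p ready by (simp add: ready_def)
    subgoal premises p for I1 V1
    proof -
      have V1: "V1 (K + 3) = r" using p by (simp add: r_def)
      have I1: "I1 (K + 9) = Suc k" "I1 (K + 1) = 0" "I1 K = l" "I1 (K + 10) = I (K + 10)"
        and V1': "V1 (K + 1) 0 = 1" using p ready by (simp_all add: ready_def)
      have rd: "ready I1 V1" using p ready by (simp add: ready_def)
      show ?thesis
        apply (rule straight)+
             apply (rule run_If)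
               apply simp
              apply (rule run_call_unary[where R = "{gcd (r k) N}" and ?T0.0 = G])
                     apply (rule straight)+
                    apply (rule run_If)
                      apply simp
                     apply (rule straight)+
        subgoal using I1 rd V1 V1' rk2 gcd1 cost l_real by (simp add: r_def[symmetric])
        using I1 rd V1 V1' rk rk2 gcd1 pg[of "r k"] pg_writes K l by (simp_all add: r_def[symmetric])
    qed
    using ready deg less k by (auto simp: r_def Suc_le_eq)
qed

text \<open>The \<open>k\<close> additional multiplications normalize the remainder, and
  \<open>2 * G\<close> pays for its gcd and its inversion.\<close>

lemma run_round_step:
  fixes m n k :: nat and I :: "nat \<Rightarrow> nat" and V :: "nat \<Rightarrow> nat \<Rightarrow> nat"
  defines "r \<equiv> long_division N n (V (K + 5)) m (Suc m - n) (V (K + 3))"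
  assumes ready: "ready I V" and deg: "I (K + 2) = Suc m" "I (K + 3) = n" "n \<le> m"
    and less: "\<And>i. i \<le> m \<Longrightarrow> V (K + 3) i < N" "\<And>i. i < n \<Longrightarrow> V (K + 5) i < N"
    and k: "k < n" "\<And>i. k < i \<Longrightarrow> i < n \<Longrightarrow> r i = 0" "coprime (r k) N"
  shows "run W l {K..} (euclid_round K pm pg pv) T I V (\<lambda>T' I' V'.
      T - (real ((Suc m - n) * n + k) * Mm + 205 * real ((Suc m - n) * Suc n) * real l + 2 * G) \<le> T' \<and>
      ready I' V' \<and> I' (K + 2) = Suc n \<and> I' (K + 3) = k \<and> I' (K + 10) = I (K + 10) \<and>
      (\<forall>i\<le>n. V' (K + 3) i = V (K + 4) i) \<and> (\<forall>i\<le>k. V' (K + 4) i = r i) \<and>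
      (\<exists>u<N. [r k * u = 1] (mod N) \<and> (\<forall>i<k. V' (K + 5) i = u * r i mod N)))"
    (is "run _ _ _ _ _ _ _ ?post")
proof -
  \<comment> \<open>With \<open>a\<close> the number of quotient coefficients, the overhead is at
    most \<open>176 * a * n * l + 117 * a * l\<close>, using \<open>k < n\<close>,
    \<open>1 \<le> a\<close> and \<open>1 \<le> l\<close>; 205 exceeds both constants. The factor
    \<open>Suc n\<close> is needed since a divisor of degree 0 costs time as well.\<close>
  have cost: "real (Suc m - n) * (real n * (Mm + 94 * real l) + 5) + 19 * real n * real l + 5 + 88 * real l
      + (real k * (Mm + 39 * real l) + 2) + (24 * real n * real l + 17 * real l)
    \<le> real ((Suc m - n) * n + k) * Mm + 205 * real ((Suc m - n) * Suc n) * real l"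
  proof -
    define a where "a = real (Suc m - n)"
    have a: "1 \<le> a" using deg by (simp add: a_def)
    have "1 * 1 \<le> a * real l" using a l_real by (intro mult_mono) auto
    moreover have "real n * real l \<le> a * (real n * real l)" using mult_right_mono[OF a, of "real n * real l"] by (simp only: mult_1) simp
    moreover have "real k * real l \<le> real n * real l" using k by (intro mult_right_mono) auto
    moreover have "a \<le> a * real l" using a l_real by simp
    moreover have "real l \<le> a * real l" using a l_real by simp
    moreover have "0 \<le> a * (real n * real l)" using a by simp
    ultimately show ?thesis unfolding of_nat_mult of_nat_add a_def[symmetric]
      by (simp add: algebra_simps)
  qed
  have r: "r i < N" if "i \<le> m" for i
    unfolding r_def using long_division_less[of m "V (K + 3)" N i] less(1) that N by simp
  have rk0: "r k \<noteq> 0" using k(3) N by (intro notI) simp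
  \<comment> \<open>The common end of the branches with and without calls. They arrive with
    different credits; the bound on \<open>T1\<close> is the one of the more expensive
    branch.\<close>
  have finish: "run W l {K..} (scale K pm ;; rotate_areas K) T1 I1 V1 ?post"
    if "ready I1 V1" "V1 (K + 3) = r" "V1 (K + 4) = V (K + 4)" "I1 (K + 3) = n" "I1 (K + 4) = k"
      "I1 (K + 9) = Suc k" "I1 (K + 10) = I (K + 10)"
      "V1 (K + 8) 0 < N" "[r k * V1 (K + 8) 0 = 1] (mod N)"
      "T - (real (Suc m - n) * (real n * (Mm + 94 * real l) + 5) + 19 * real n * real l + 5 + 88 * real l + 2 * G) \<le> T1"
    for T1 I1 V1
    apply (rule run_Seq)
    apply (rule run_scale)
    subgoal premises p2 for I2 V2
      apply (rule run_rotate_areas)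
      subgoal premises p3 for I3 V3
      proof (intro conjI allI impI exI[of _ "V1 (K + 8) 0"])
        show "ready I3 V3" using p3 p2 that(1) by (simp add: ready_def)
        show "T - (real ((Suc m - n) * n + k) * Mm + 205 * real ((Suc m - n) * Suc n) * real l + 2 * G)
          \<le> T1 - (real (I1 (K + 4)) * (Mm + 39 * real l) + 2) - (24 * real (I2 (K + 3)) * real l + 17 * real l)"
        proof -
          have n: "I2 (K + 3) = n" using p2(1) that(4) by simp
          have "T - (D + E) \<le> T1 - B - C" if "A + B + C \<le> D" "T - (A + E) \<le> T1" for A B C D E
            using that by linarith
          from this[OF cost that(10)] show ?thesis unfolding n that(5) .
        qed
        show "V3 (K + 3) i = V (K + 4) i" if "i \<le> n" for i
          using p3(5)[of i] p2(1,2) \<open>I1 (K + 3) = n\<close> \<open>V1 (K + 4) = V (K + 4)\<close> that by simp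
        show "V3 (K + 4) i = r i" if "i \<le> k" for i
          using p3(6)[of i] p2(1,2) \<open>I1 (K + 9) = Suc k\<close> \<open>V1 (K + 3) = r\<close> that by simp
        show "V3 (K + 5) i = V1 (K + 8) 0 * r i mod N" if "i < k" for i
          using p3(2) p2(3)[of i] \<open>I1 (K + 4) = k\<close> \<open>V1 (K + 3) = r\<close> that by simp
      qed (use p3 p2 that in simp_all)
      subgoal using p2 that(1) by (simp add: ready_def)
      subgoal using p2 that k by simp
      done
    using that r k deg by auto
  show ?thesis
    unfolding euclid_round_def
    apply (rule run_divide_measure[where n = n and m = m and len = "Suc k"])
           apply (rule run_If)
    subgoal by simp
    subgoal premises p for I' V'
      using p ready by (simp add: ready_def)
    subgoal premises p for I1 V1
    proof -
      have V1: "V1 (K + 3) = r" using p by (simp add: r_def)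
      have I1: "I1 (K + 9) = Suc k" "I1 (K + 1) = 0" "I1 K = l" "I1 (K + 10) = I (K + 10)" "I1 (K + 3) = n"
        and V1': "V1 (K + 1) 0 = 1" "V1 (K + 4) = V (K + 4)" using p ready deg by (simp_all add: ready_def)
      have rd: "ready I1 V1" using p ready by (simp add: ready_def)
      show ?thesis
      proof (cases "r k = 1")
        case True
        show ?thesis
          apply (rule straight)+
               apply (rule run_If)
                 apply simp
          subgoal using I1 V1 V1' True by (simp add: r_def[symmetric])
                apply (rule run_Skip straight)+
                     apply (rule run_If)
                       apply simp
          subgoal using I1 V1 V1' True by (simp add: r_def[symmetric])
                apply (rule run_Skip straight)+
                     apply (rule run_If)
                       apply simp
          subgoal using I1 V1 V1' True by (simp add: r_def[symmetric])
                apply (rule run_Skip)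
                apply (rule finish)
          using I1 rd V1 V1' True cost l_real N K l G by (simp_all add: r_def[symmetric])
      next
        case False
        then have rk2: "r k \<in> {2..<N}" using rk0 r[of k] k deg by auto
        show ?thesis
          apply (rule straight)+
               apply (rule run_If)
                 apply simp
              apply (rule run_call_unary[where R = "{gcd (r k) N}" and ?T0.0 = G])
                     apply (rule straight)+
                     apply (rule run_If)
                       apply simp
          subgoal using I1 V1 V1' k(3) by (simp add: r_def[symmetric])
                apply (rule run_Skip straight)+
                     apply (rule run_If)
                       apply simp
                apply (rule run_call_unary[where R = "{y. y < N \<and> [r k * y = 1] (mod N)}" and ?T0.0 = G])
                apply (rule finish)
          using I1 rd V1 V1' k(3) rk2 pg[of "r k"] pv[of "r k"] pg_writes pv_writes l_real N K l G
          by (simp_all add: r_def[symmetric])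
      qed
    qed
    using ready deg less k rk0 by (auto simp: r_def Suc_le_eq)
qed

end

section \<open>Division of polynomials over \<open>\<int>/N\<int>\<close>\<close>

locale residue_poly =
  fixes N :: nat
  assumes N: "2 \<le> N"
begin

abbreviation R where "R \<equiv> Zmod N"
abbreviation P where "P \<equiv> Zmod_poly N"

lemma residues: "residues (int N)"
  using N by unfold_locales auto

lemma cring: "cring R"
  by (rule residues.cring[OF residues])

sublocale UP_cring R P
  by (intro UP_cring.intro cring) auto

lemma carrier_R: "carrier R = {0..<int N}"
  by (auto simp: residue_ring_def)

lemma R_ops: "\<zero>\<^bsub>R\<^esub> = 0" "\<one>\<^bsub>R\<^esub> = 1" "x \<oplus>\<^bsub>R\<^esub> y = (x + y) mod int N" "x \<otimes>\<^bsub>R\<^esub> y = x * y mod int N"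
  by (simp_all add: residue_ring_def)

lemma R_minus: "x \<in> carrier R \<Longrightarrow> y \<in> carrier R \<Longrightarrow> x \<ominus>\<^bsub>R\<^esub> y = (x - y) mod int N"
  by (simp add: a_minus_def residues.res_neg_eq[OF residues] R_ops mod_simps)

lemma Units_R: "Units R = {x. 0 < x \<and> x < int N \<and> coprime x (int N)}"
  by (rule residues.res_units_eq[OF residues])

definition rep :: "(nat \<Rightarrow> int) \<Rightarrow> nat \<Rightarrow> nat" where
  "rep f i = nat (coeff P f i)"

lemma int_rep: "f \<in> carrier P \<Longrightarrow> int (rep f i) = coeff P f i"
  using coeff_closed[of f i] by (simp add: rep_def carrier_R)

lemma rep_less: "f \<in> carrier P \<Longrightarrow> rep f i < N"
  using coeff_closed[of f i] N by (auto simp: rep_def carrier_R)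

lemma zero_above_degree: "f \<in> carrier P \<Longrightarrow> deg R f < i \<Longrightarrow> coeff P f i = 0"
  using deg_aboveD[of f i] by (simp add: R_ops)

lemma rep_minus:
  assumes "f \<in> carrier P" "g \<in> carrier P"
  shows "rep (f \<ominus>\<^bsub>P\<^esub> g) i = diff_mod N (rep f i) (rep g i)"
proof -
  have "int (rep (f \<ominus>\<^bsub>P\<^esub> g) i) = int (diff_mod N (rep f i) (rep g i))"
    using assms by (simp add: int_rep R_minus int_diff_mod rep_less)
  then show ?thesis by simp
qed

lemma rep_monom_mult:
  assumes "f \<in> carrier P" "q \<in> carrier R"
  shows "rep (monom P q e \<otimes>\<^bsub>P\<^esub> f) i = (if e \<le> i then nat q * rep f (i - e) mod N else 0)"
proof -
  have c: "coeff P (monom P q e \<otimes>\<^bsub>P\<^esub> f) i = (if e \<le> i then q * coeff P f (i - e) mod int N else 0)"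
  proof (cases "e \<le> i")
    case True
    then show ?thesis using coeff_monom_mult[OF assms(2,1), of e "i - e"] by (simp add: R_ops)
  next
    case False
    have "coeff P (monom P q e \<otimes>\<^bsub>P\<^esub> f) i = (\<Oplus>\<^bsub>R\<^esub> j \<in> {..i}. coeff P (monom P q e) j \<otimes>\<^bsub>R\<^esub> coeff P f (i - j))"
      using assms by (simp add: coeff_mult)
    also have "\<dots> = (\<Oplus>\<^bsub>R\<^esub> j \<in> {..i}. \<zero>\<^bsub>R\<^esub>)"
      using False assms by (intro R.finsum_cong') (auto simp: coeff_monom)
    also have "\<dots> = \<zero>\<^bsub>R\<^esub>" by (rule R.finsum_zero)
    finally show ?thesis using False by (simp add: R_ops(1))
  qed
  show ?thesis
  proof (cases "e \<le> i")
    case True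
    have "int (rep (monom P q e \<otimes>\<^bsub>P\<^esub> f) i) = int (nat q * rep f (i - e) mod N)"
      using c True assms by (simp add: int_rep carrier_R zmod_int)
    then show ?thesis using True by simp
  qed (simp add: rep_def c)
qed

lemma diff_mod_0 [simp]: "diff_mod N x 0 = x" "diff_mod N x x = 0"
  by (simp_all add: diff_mod_def)

text \<open>Each step subtracts \<open>q X^(k - n) b\<close> from the current \<open>\<rho>\<close>,
  where \<open>q\<close> is the coefficient of \<open>\<rho>\<close> at the top position
  \<open>k\<close>; since \<open>b\<close> is monic this cancels it. The array agrees with
  \<open>\<rho>\<close> only below \<open>Suc m - t\<close>, because cancelled entries are not
  overwritten.\<close>

lemma long_division_correct:
  assumes a: "a \<in> carrier P" "\<And>i. m < i \<Longrightarrow> rep a i = 0"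
    and b: "b \<in> carrier P" "rep b n = 1" "\<And>i. n < i \<Longrightarrow> rep b i = 0"
    and f: "\<And>i. i \<le> m \<Longrightarrow> f i = rep a i" and r: "\<And>i. i < n \<Longrightarrow> r i = rep b i"
    and t: "t \<le> Suc m - n"
  shows "\<exists>h\<in>carrier P. \<exists>\<rho>\<in>carrier P. a = b \<otimes>\<^bsub>P\<^esub> h \<oplus>\<^bsub>P\<^esub> \<rho> \<and>
    (\<forall>i\<ge>Suc m - t. rep \<rho> i = 0) \<and> (\<forall>i<Suc m - t. long_division N n r m t f i = rep \<rho> i)"
  using t
proof (induction t)
  case 0
  have "a = b \<otimes>\<^bsub>P\<^esub> \<zero>\<^bsub>P\<^esub> \<oplus>\<^bsub>P\<^esub> a" using a b by simp
  then show ?case using a f by (intro bexI[of _ "\<zero>\<^bsub>P\<^esub>"] bexI[of _ a]) auto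
next
  case (Suc t)
  define k where "k = m - t"
  have k: "n \<le> k" "Suc m - t = Suc k" "Suc m - Suc t = k" using Suc.prems by (auto simp: k_def)
  from Suc obtain h \<rho> where h: "h \<in> carrier P" and \<rho>: "\<rho> \<in> carrier P" and eq: "a = b \<otimes>\<^bsub>P\<^esub> h \<oplus>\<^bsub>P\<^esub> \<rho>"
    and z: "\<And>i. k < i \<Longrightarrow> rep \<rho> i = 0" and ld: "\<And>i. i \<le> k \<Longrightarrow> long_division N n r m t f i = rep \<rho> i"
    by (auto simp: k Suc_le_eq less_Suc_eq_le)
  define q where "q = coeff P \<rho> k"
  have q: "q \<in> carrier R" "nat q = rep \<rho> k" using \<rho> by (auto simp: q_def rep_def)
  let ?M = "monom P q (k - n)"
  define \<rho>' where "\<rho>' = \<rho> \<ominus>\<^bsub>P\<^esub> (?M \<otimes>\<^bsub>P\<^esub> b)"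
  have \<rho>': "\<rho>' \<in> carrier P" using \<rho> b q by (simp add: \<rho>'_def)
  have rep': "rep \<rho>' i = diff_mod N (rep \<rho> i) (if k - n \<le> i then rep \<rho> k * rep b (i - (k - n)) mod N else 0)" for i
    unfolding \<rho>'_def using \<rho> b q by (simp add: rep_minus rep_monom_mult)
  have "a = b \<otimes>\<^bsub>P\<^esub> (h \<oplus>\<^bsub>P\<^esub> ?M) \<oplus>\<^bsub>P\<^esub> \<rho>'"
    unfolding \<rho>'_def eq using h \<rho> b(1) monom_closed[OF q(1), of "k - n"]
    by (simp add: P.m_comm P.r_distr a_minus_def P.a_ac P.r_neg2 P.r_neg1 P.r_neg)

  moreover have "rep \<rho>' i = 0" if "k \<le> i" for i
  proof (cases "i = k")
    case True
    then show ?thesis using k b(2) rep_less[OF \<rho>] by (simp add: rep')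
  next
    case False
    then show ?thesis using that k b(3)[of "i - (k - n)"] z[of i] by (simp add: rep')
  qed
  moreover have "long_division N n r m (Suc t) f i = rep \<rho>' i" if "i < k" for i
  proof -
    have "rep b (i - (k - n)) = r (i - (k - n))" if "k - n \<le> i"
      using that \<open>i < k\<close> by (intro r[symmetric]) auto
    then show ?thesis using that ld[of i] ld[of k] by (simp add: rep' cancel_top_def flip: k_def)
  qed
  ultimately show ?case using h \<rho>' monom_closed[OF q(1), of "k - n"] unfolding k(3)
    by (intro bexI[of _ "h \<oplus>\<^bsub>P\<^esub> ?M"] bexI[of _ \<rho>']) auto
qed

text \<open>With zero divisors both sides may vanish, so the statement is about the coefficient at
  the sum of the degrees and not about the degree of the product.\<close>

lemma leading_coeff_mult:
  assumes "f \<in> carrier P" "g \<in> carrier P"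
  shows "coeff P (f \<otimes>\<^bsub>P\<^esub> g) (deg R f + deg R g) = coeff P f (deg R f) \<otimes>\<^bsub>R\<^esub> coeff P g (deg R g)"
proof -
  let ?n = "deg R f + deg R g"
  have "coeff P (f \<otimes>\<^bsub>P\<^esub> g) ?n = (\<Oplus>\<^bsub>R\<^esub> j \<in> {..?n}. coeff P f j \<otimes>\<^bsub>R\<^esub> coeff P g (?n - j))"
    using assms by (simp add: coeff_mult)
  also have "\<dots> = (\<Oplus>\<^bsub>R\<^esub> j \<in> {..?n}. if deg R f = j then coeff P f j \<otimes>\<^bsub>R\<^esub> coeff P g (?n - j) else \<zero>\<^bsub>R\<^esub>)"
  proof (rule R.finsum_cong')
    fix j assume "j \<in> {..?n}"
    show "coeff P f j \<otimes>\<^bsub>R\<^esub> coeff P g (?n - j) =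
        (if deg R f = j then coeff P f j \<otimes>\<^bsub>R\<^esub> coeff P g (?n - j) else \<zero>\<^bsub>R\<^esub>)"
    proof (rule linorder_cases[of "deg R f" j])
      assume "deg R f < j"
      then show ?thesis using assms deg_aboveD[of f j] by simp
    next
      assume "j < deg R f"
      then show ?thesis using assms deg_aboveD[of g "?n - j"] by simp
    qed simp
  qed (use assms in auto)
  also have "\<dots> = coeff P f (deg R f) \<otimes>\<^bsub>R\<^esub> coeff P g (?n - deg R f)"
    by (rule R.finsum_singleton) (use assms in auto)
  finally show ?thesis by simp
qed

text \<open>The product of \<open>b\<close> and \<open>h1 - h2\<close> equals
  \<open>\<rho>2 - \<rho>1\<close>, whose coefficients vanish from the degree of \<open>b\<close>
  on. If \<open>h1 - h2\<close> were nonzero, its leading coefficient times a unit would be such a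
  coefficient.\<close>

lemma remainder_unique:
  assumes b: "b \<in> carrier P" "leading_coeff N b \<in> Units R"
    and h: "h1 \<in> carrier P" "h2 \<in> carrier P" and \<rho>: "\<rho>1 \<in> carrier P" "\<rho>2 \<in> carrier P"
    and eq: "b \<otimes>\<^bsub>P\<^esub> h1 \<oplus>\<^bsub>P\<^esub> \<rho>1 = b \<otimes>\<^bsub>P\<^esub> h2 \<oplus>\<^bsub>P\<^esub> \<rho>2"
    and z: "\<And>i. deg R b \<le> i \<Longrightarrow> coeff P \<rho>1 i = 0" "\<And>i. deg R b \<le> i \<Longrightarrow> coeff P \<rho>2 i = 0"
  shows "\<rho>1 = \<rho>2"
proof -
  define D where "D = h1 \<ominus>\<^bsub>P\<^esub> h2"
  have D: "D \<in> carrier P" using h by (simp add: D_def)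
  have "b \<otimes>\<^bsub>P\<^esub> D = b \<otimes>\<^bsub>P\<^esub> h1 \<oplus>\<^bsub>P\<^esub> \<rho>1 \<ominus>\<^bsub>P\<^esub> \<rho>1 \<ominus>\<^bsub>P\<^esub> b \<otimes>\<^bsub>P\<^esub> h2"
    unfolding D_def using b(1) h \<rho> by (simp add: a_minus_def P.r_distr P.r_minus P.a_assoc P.r_neg)
  also have "\<dots> = \<rho>2 \<ominus>\<^bsub>P\<^esub> \<rho>1"
    unfolding eq using b(1) h \<rho> by (simp add: a_minus_def P.a_ac P.r_neg P.r_neg1 P.r_neg2)
  finally have bD: "b \<otimes>\<^bsub>P\<^esub> D = \<rho>2 \<ominus>\<^bsub>P\<^esub> \<rho>1" .
  have "D = \<zero>\<^bsub>P\<^esub>"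
  proof (rule ccontr)
    assume "D \<noteq> \<zero>\<^bsub>P\<^esub>"
    then have nz: "coeff P D (deg R D) \<noteq> \<zero>\<^bsub>R\<^esub>" by (rule lcoeff_nonzero2[OF D])
    have "\<zero>\<^bsub>R\<^esub> = coeff P (b \<otimes>\<^bsub>P\<^esub> D) (deg R b + deg R D)"
      unfolding bD using \<rho> z N by (simp add: R_minus carrier_R R_ops(1))
    also have "\<dots> = leading_coeff N b \<otimes>\<^bsub>R\<^esub> coeff P D (deg R D)"
      by (simp add: leading_coeff_mult[OF b(1) D] leading_coeff_def)
    finally have "leading_coeff N b \<otimes>\<^bsub>R\<^esub> coeff P D (deg R D) = leading_coeff N b \<otimes>\<^bsub>R\<^esub> \<zero>\<^bsub>R\<^esub>"
      using R.r_null[OF R.Units_closed[OF b(2)]] by metis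
    then show False using R.Units_l_cancel[OF b(2)] nz D by simp
  qed
  then have "\<rho>2 \<ominus>\<^bsub>P\<^esub> \<rho>1 = \<zero>\<^bsub>P\<^esub>" using bD b(1) by simp
  then show ?thesis using \<rho> by (simp add: P.r_right_minus_eq)
qed

lemma Idl_remainder:
  assumes "b \<in> carrier P" "h \<in> carrier P" "\<rho> \<in> carrier P" "a = b \<otimes>\<^bsub>P\<^esub> h \<oplus>\<^bsub>P\<^esub> \<rho>"
  shows "Idl\<^bsub>P\<^esub> {a, b} = Idl\<^bsub>P\<^esub> {b, \<rho>}"
proof (rule equalityI)
  have a: "a \<in> carrier P" using assms by simp
  interpret I1: ideal "Idl\<^bsub>P\<^esub> {b, \<rho>}" P using assms by (intro P.genideal_ideal) auto
  interpret I2: ideal "Idl\<^bsub>P\<^esub> {a, b}" P using assms a by (intro P.genideal_ideal) auto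
  have 1: "b \<in> Idl\<^bsub>P\<^esub> {b, \<rho>}" "\<rho> \<in> Idl\<^bsub>P\<^esub> {b, \<rho>}"
    using P.genideal_self[of "{b, \<rho>}"] assms by auto
  then have "a \<in> Idl\<^bsub>P\<^esub> {b, \<rho>}" using assms by (simp add: I1.I_r_closed)
  with 1 show "Idl\<^bsub>P\<^esub> {a, b} \<subseteq> Idl\<^bsub>P\<^esub> {b, \<rho>}"
    by (intro P.genideal_minimal I1.is_ideal) auto
  have 2: "b \<in> Idl\<^bsub>P\<^esub> {a, b}" "a \<in> Idl\<^bsub>P\<^esub> {a, b}"
    using P.genideal_self[of "{a, b}"] assms a by auto
  have "\<rho> = a \<ominus>\<^bsub>P\<^esub> b \<otimes>\<^bsub>P\<^esub> h"
    unfolding assms(4) using assms(1-3) by (simp add: a_minus_def P.a_ac P.r_neg P.r_neg1 P.r_neg2)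
  moreover have "a \<ominus>\<^bsub>P\<^esub> b \<otimes>\<^bsub>P\<^esub> h \<in> Idl\<^bsub>P\<^esub> {a, b}"
    using 2 assms(2) by (simp add: a_minus_def I2.I_r_closed I2.a_inv_closed)
  ultimately show "Idl\<^bsub>P\<^esub> {b, \<rho>} \<subseteq> Idl\<^bsub>P\<^esub> {a, b}"
    using 2 by (intro P.genideal_minimal I2.is_ideal) auto
qed

text \<open>The array holds the monic \<open>b' = u b\<close>. A division
  \<open>a = b' h + \<rho>'\<close> is also the division \<open>a = b (u h) + \<rho>'\<close>, so
  \<open>\<rho>'\<close> is the remainder by \<open>b\<close>, up to uniqueness.\<close>

lemma scaled_division:
  assumes a: "a \<in> carrier P" and b: "b \<in> carrier P"
    and u: "u < N" "[rep b (deg R b) * u = 1] (mod N)"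
    and f: "\<And>i. i \<le> deg R a \<Longrightarrow> f i = rep a i" and r: "\<And>i. i < deg R b \<Longrightarrow> r i = u * rep b i mod N"
    and le: "deg R b \<le> deg R a"
    and rem: "is_remainder N a b \<rho>" "\<rho> \<in> carrier P" "leading_coeff N b \<in> Units R"
    and i: "i < deg R b"
  shows "long_division N (deg R b) r (deg R a) (Suc (deg R a) - deg R b) f i = rep \<rho> i"
proof -
  let ?m = "deg R a" and ?n = "deg R b"
  let ?U = "monom P (int u) 0"
  have uR: "int u \<in> carrier R" using u by (simp add: carrier_R)
  have U: "?U \<in> carrier P" by (rule monom_closed[OF uR])
  define b' where "b' = ?U \<otimes>\<^bsub>P\<^esub> b"
  have b': "b' \<in> carrier P" using U b by (simp add: b'_def)
  have repb': "rep b' j = u * rep b j mod N" for j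
    using rep_monom_mult[OF b uR, of 0 j] by (simp add: b'_def)
  have "rep b' ?n = 1" using u N by (simp add: repb' cong_def mult.commute)
  moreover have "rep b' j = 0" if "?n < j" for j
  proof -
    have "rep b j = 0" using zero_above_degree[OF b that] by (simp add: rep_def)
    then show ?thesis by (simp add: repb')
  qed
  moreover have "rep a j = 0" if "?m < j" for j
    using zero_above_degree[OF a that] by (simp add: rep_def)
  moreover have "r j = rep b' j" if "j < ?n" for j using r that by (simp add: repb')
  ultimately obtain h \<rho>' where h: "h \<in> carrier P" "\<rho>' \<in> carrier P" "a = b' \<otimes>\<^bsub>P\<^esub> h \<oplus>\<^bsub>P\<^esub> \<rho>'"
    "\<forall>j\<ge>Suc ?m - (Suc ?m - ?n). rep \<rho>' j = 0"
    "\<forall>j<Suc ?m - (Suc ?m - ?n). long_division N ?n r ?m (Suc ?m - ?n) f j = rep \<rho>' j"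
    using long_division_correct[OF a _ b', of ?m ?n f r "Suc ?m - ?n"] f by blast
  have n: "Suc ?m - (Suc ?m - ?n) = ?n" using le by simp
  obtain h' where h': "h' \<in> carrier P" "a = b \<otimes>\<^bsub>P\<^esub> h' \<oplus>\<^bsub>P\<^esub> \<rho>" "deg_less N \<rho> b"
    using rem(1) unfolding is_remainder_def by blast
  have "\<rho>' = \<rho>"
  proof (rule remainder_unique[OF b rem(3), of "?U \<otimes>\<^bsub>P\<^esub> h" h'])
    have "b \<otimes>\<^bsub>P\<^esub> (?U \<otimes>\<^bsub>P\<^esub> h) = b' \<otimes>\<^bsub>P\<^esub> h"
      unfolding b'_def using b U h(1) by (simp add: P.m_ac)
    then show "b \<otimes>\<^bsub>P\<^esub> (?U \<otimes>\<^bsub>P\<^esub> h) \<oplus>\<^bsub>P\<^esub> \<rho>' = b \<otimes>\<^bsub>P\<^esub> h' \<oplus>\<^bsub>P\<^esub> \<rho>"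
      using h(3) h'(2) by simp
    show "coeff P \<rho>' j = 0" if "?n \<le> j" for j
      using h(4) that n int_rep[OF h(2), of j] by simp
    show "coeff P \<rho> j = 0" if "?n \<le> j" for j
      using h'(3) that zero_above_degree[OF rem(2), of j] unfolding deg_less_def by (auto simp: R_ops)
  qed (use U h h' rem in auto)
  then show ?thesis using h(5) i n by simp
qed

end

section \<open>Counting multiplications\<close>

text \<open>The bounds are attained at \<open>\<iota> = 1\<close> and \<open>\<iota> = d\<close>, so
  the differences have the factors \<open>\<iota> - 1\<close> and \<open>d - \<iota>\<close>; the
  cofactors are nonnegative because \<open>\<iota> \<le> d\<close>.\<close>

lemma B_bounds:
  assumes "1 \<le> \<iota>" "\<iota> \<le> d"
  shows "real d * (real e + 1 - real d) \<le> B e d \<iota>" "B e d \<iota> \<le> real d * real e"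
proof -
  define x where "x = real \<iota>"
  define y where "y = real d"
  have x: "1 \<le> x" "x \<le> y" using assms by (auto simp: x_def y_def)
  have B: "B e d \<iota> = y * (real e + x - y * (x + 1) / (2 * x)) - x * (x - 1) / 2"
    by (simp add: B_def x_def y_def)
  have "B e d \<iota> - y * (real e + 1 - y) = (x - 1) * (y - x / 2 + y\<^sup>2 / (2 * x))"
    unfolding B using x by (simp add: field_simps power2_eq_square)
  also have "\<dots> \<ge> 0"
    using x by (intro mult_nonneg_nonneg add_nonneg_nonneg divide_nonneg_nonneg) auto
  finally show "real d * (real e + 1 - real d) \<le> B e d \<iota>" by (simp add: y_def)
  have "y * real e - B e d \<iota> = (y - x) * ((x + 1) * y - x * (x - 1)) / (2 * x)"
    unfolding B using x by (simp add: field_simps power2_eq_square)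
  also have "\<dots> \<ge> 0"
  proof -
    have "x * (x - 1) \<le> (x + 1) * y"
      using x by (subst mult.commute) (intro mult_mono, auto)
    then show ?thesis using x by (intro divide_nonneg_nonneg mult_nonneg_nonneg) auto
  qed
  finally show "B e d \<iota> \<le> real d * real e" by (simp add: y_def)
qed

lemma B_Rats: "B e d \<iota> \<in> \<rat>"
  unfolding B_def by (intro Rats_diff Rats_mult Rats_add Rats_divide Rats_of_nat Rats_number_of Rats_1)

lemma B_add: "B (e + k) d \<iota> = B e d \<iota> + real d * real k"
  by (simp add: B_def algebra_simps)

text \<open>
  With \<open>\<delta> = x k - x (k + 1)\<close> one has \<open>2 \<delta> x (k + 1) = (x k)\<^sup>2 - (x (k + 1))\<^sup>2 - \<delta>\<^sup>2\<close>, and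
  \<open>\<delta>\<^sup>2 \<ge> 2 s \<delta> - s\<^sup>2\<close>; the choice \<open>s = d / \<iota>\<close>, corresponding to equidistant degrees, is optimal.
\<close>

lemma descent_sum:
  fixes x :: "nat \<Rightarrow> real"
  shows "2 * (\<Sum>k<n. (x k - x (Suc k)) * x (Suc k)) \<le> (x 0)\<^sup>2 - (x n)\<^sup>2 - 2 * s * (x 0 - x n) + n * s\<^sup>2"
proof (induction n)
  case (Suc n)
  have "0 \<le> (x n - x (Suc n) - s)\<^sup>2" by simp
  then have "2 * ((x n - x (Suc n)) * x (Suc n)) \<le>
      (x n)\<^sup>2 - (x (Suc n))\<^sup>2 - 2 * s * (x n - x (Suc n)) + s\<^sup>2"
    by (simp add: power2_eq_square algebra_simps)
  with Suc show ?case by (simp add: algebra_simps)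
qed simp

lemma descending_sum_le:
  fixes D :: "nat \<Rightarrow> nat"
  assumes "\<And>k. k < n \<Longrightarrow> D (Suc k) < D k"
  shows "(\<Sum>k<n. real (D (Suc k))) \<le> real n * real (D 0) - real n * (real n + 1) / 2"
proof -
  have le: "D k + k \<le> D 0" if "k \<le> n" for k
    using that
  proof (induction k)
    case (Suc k)
    then show ?case using assms[of k] by simp
  qed simp
  have "(\<Sum>k<n. real (D (Suc k))) \<le> (\<Sum>k<n. real (D 0) - real (Suc k))"
  proof (rule sum_mono)
    fix k assume "k \<in> {..<n}"
    then show "real (D (Suc k)) \<le> real (D 0) - real (Suc k)" using le[of "Suc k"] by simp
  qed
  also have "\<dots> = real n * real (D 0) - real n * (real n + 1) / 2"
    by (induction n) (simp_all add: field_simps)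
  finally show ?thesis .
qed

text \<open>Strict descent is required only from index 1 on, since \<open>c = d\<close> is allowed,
  and only up to index \<open>\<iota>\<close>, since the polynomial after it may be zero.\<close>

locale degree_sequence =
  fixes D :: "nat \<Rightarrow> nat" and c d \<iota> :: nat
  assumes D0: "D 0 = c" and D1: "D 1 = d" and \<iota>: "1 \<le> \<iota>" "\<iota> \<le> d" and c: "d \<le> c"
    and descending: "\<And>k. 1 \<le> k \<Longrightarrow> k < \<iota> \<Longrightarrow> D (Suc k) < D k"
begin

lemma degree_le: "k < \<iota> \<Longrightarrow> D (Suc k) \<le> D k"
  using D0 D1 c descending[of k] by (cases "k = 0") auto

lemma real_quotient_length: "k < \<iota> \<Longrightarrow> real (Suc (D k) - D (Suc k)) = real (D k) + 1 - real (D (Suc k))"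
  using degree_le[of k] by simp

text \<open>This sum occurs twice: as the number of normalizing multiplications, and through the
  \<open>+ 1\<close> in the lengths of the quotients.\<close>

lemma rest_sum: "(\<Sum>k<\<iota> - 1. real (D (Suc (Suc k)))) \<le> (real \<iota> - 1) * real d - real \<iota> * (real \<iota> - 1) / 2"
proof -
  have "(\<Sum>k<\<iota> - 1. real (D (Suc (Suc k)))) \<le> real (\<iota> - 1) * real d - real (\<iota> - 1) * (real (\<iota> - 1) + 1) / 2"
    using descending_sum_le[of "\<iota> - 1" "\<lambda>k. D (Suc k)"] descending D1 by simp
  then show ?thesis using \<iota> by (simp add: of_nat_diff field_simps)
qed

text \<open>The origin of \<open>B\<close>: the first division contributes
  \<open>(c + 1 - d) d\<close>, the degree drops afterwards at most
  \<open>d^2 / 2 - d^2 / (2 \<iota>)\<close> by \<open>descent_sum\<close>, and the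
  \<open>+ 1\<close> in the quotient lengths the bound of \<open>rest_sum\<close>.\<close>

lemma quotient_sum: "real (\<Sum>k<\<iota>. (Suc (D k) - D (Suc k)) * D (Suc k)) \<le> B c d \<iota>"
proof -
  define x where "x k = real (D (Suc k))" for k
  define n where "n = \<iota> - 1"
  define s where "s = real d / real \<iota>"
  have \<iota>n: "\<iota> = Suc n" "real \<iota> = real n + 1" using \<iota> by (auto simp: n_def)
  have s: "s * real \<iota> = real d" using \<iota> by (simp add: s_def)
  have "real (\<Sum>k<\<iota>. (Suc (D k) - D (Suc k)) * D (Suc k)) =
      (\<Sum>k<\<iota>. (real (D k) + 1 - real (D (Suc k))) * real (D (Suc k)))"
    using real_quotient_length by (simp add: of_nat_sum)
  also have "\<dots> = (real c + 1 - real d) * real d + (\<Sum>k<n. (x k + 1 - x (Suc k)) * x (Suc k))"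
    unfolding \<iota>n sum.lessThan_Suc_shift using D0 D1 by (simp add: x_def)
  also have "(\<Sum>k<n. (x k + 1 - x (Suc k)) * x (Suc k)) =
      (\<Sum>k<n. (x k - x (Suc k)) * x (Suc k)) + (\<Sum>k<n. x (Suc k))"
    by (simp add: algebra_simps flip: sum.distrib)
  also have "(\<Sum>k<n. x (Suc k)) \<le> real n * real d - real \<iota> * real n / 2"
    using rest_sum \<iota> by (simp add: x_def n_def of_nat_diff)
  also have "(\<Sum>k<n. (x k - x (Suc k)) * x (Suc k)) \<le> ((real d)\<^sup>2 - 2 * s * real d + real \<iota> * s\<^sup>2) / 2"
  proof -
    \<comment> \<open>The last degree need not be 0. Completing the square removes it and raises
      \<open>n\<close> times the square of \<open>s\<close> to \<open>\<iota>\<close> times that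
      square, as if one more step led down to 0.\<close>
    have "0 \<le> (x n - s)\<^sup>2" by simp
    then have "- (x n)\<^sup>2 + 2 * s * x n \<le> s\<^sup>2" by (simp add: power2_eq_square algebra_simps)
    moreover have "x 0 = real d" using D1 by (simp add: x_def)
    ultimately show ?thesis using descent_sum[of x n s]
      by (simp add: \<iota>n(2) algebra_simps)
  qed
  also have "((real d)\<^sup>2 - 2 * s * real d + real \<iota> * s\<^sup>2) / 2 = (real d)\<^sup>2 / 2 - (real d)\<^sup>2 / (2 * real \<iota>)"
    using \<iota> by (simp add: s_def power2_eq_square field_simps)
  finally have "real (\<Sum>k<\<iota>. (Suc (D k) - D (Suc k)) * D (Suc k)) \<le>
      (real c + 1 - real d) * real d + ((real d)\<^sup>2 / 2 - (real d)\<^sup>2 / (2 * real \<iota>)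
        + (real n * real d - real \<iota> * real n / 2))" by simp
  also have "\<dots> = B c d \<iota>"
  proof -
    have n: "real n = real \<iota> - 1" using \<iota>n by simp
    show ?thesis unfolding n B_def using \<iota> by (simp add: power2_eq_square field_simps)
  qed
  finally show ?thesis .
qed

text \<open>Since \<open>B\<close> grows by \<open>d\<close> when its first argument grows by 1, the
  shift by \<open>\<iota> - 1\<close> together with the subtracted term is exactly the bound of
  \<open>rest_sum\<close> for normalizing.\<close>

lemma multiplication_count:
  "real (\<Sum>k<\<iota>. (Suc (D k) - D (Suc k)) * D (Suc k) + (if Suc k < \<iota> then D (Suc (Suc k)) else 0))
    \<le> B (c + \<iota> - 1) d \<iota> - real \<iota> * (real \<iota> - 1) / 2"
proof -
  obtain n where n: "\<iota> = Suc n" using \<iota> by (cases \<iota>) auto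
  have "(\<Sum>k<\<iota>. if Suc k < \<iota> then D (Suc (Suc k)) else 0) = (\<Sum>k<\<iota> - 1. D (Suc (Suc k)))"
    unfolding n by simp
  then have "real (\<Sum>k<\<iota>. if Suc k < \<iota> then D (Suc (Suc k)) else 0) \<le>
      (real \<iota> - 1) * real d - real \<iota> * (real \<iota> - 1) / 2"
    using rest_sum by (simp add: of_nat_sum)
  moreover have "B (c + \<iota> - 1) d \<iota> = B c d \<iota> + real d * (real \<iota> - 1)"
    using B_add[of c n d \<iota>] n by simp
  ultimately show ?thesis using quotient_sum by (simp add: sum.distrib algebra_simps)
qed

text \<open>From \<open>(d - 1) (c - d) \<ge> 0\<close> one gets
  \<open>c \<le> d (c + 1 - d)\<close>, the lower bound for \<open>B\<close>. Thus the time for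
  reading and writing polynomials is covered by \<open>B\<close>.\<close>

lemma c_le_B: "real c + 1 \<le> 2 * B c d \<iota>"
proof -
  have "0 \<le> (real d - 1) * (real c - real d)" using \<iota> c by (intro mult_nonneg_nonneg) auto
  then have "real c \<le> real d * (real c + 1 - real d)" by (simp add: algebra_simps)
  then have "real c \<le> B c d \<iota>" using B_bounds(1)[OF \<iota>, of c] by simp
  moreover have "1 \<le> real c" using \<iota> c by simp
  ultimately show ?thesis by simp
qed

text \<open>The lengths of the quotients telescope to at most \<open>c + \<iota> \<le> 2 c\<close>,
  which is at most \<open>4 B\<close>; \<open>quotient_sum\<close> contributes the fifth
  \<open>B\<close>.\<close>

lemma overhead_sum: "real (\<Sum>k<\<iota>. (Suc (D k) - D (Suc k)) * Suc (D (Suc k))) \<le> 5 * B c d \<iota>"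
proof -
  have "(\<Sum>k<j. real (D k) + 1 - real (D (Suc k))) = real (D 0) - real (D j) + real j" for j
    by (induction j) auto
  then have "real (\<Sum>k<\<iota>. Suc (D k) - D (Suc k)) = real c - real (D \<iota>) + real \<iota>"
    using real_quotient_length D0 by (simp add: of_nat_sum)
  also have "\<dots> \<le> real c + real c" using \<iota> c by simp
  also have "\<dots> \<le> 4 * B c d \<iota>" using c_le_B by simp
  finally have "real (\<Sum>k<\<iota>. Suc (D k) - D (Suc k)) \<le> 4 * B c d \<iota>" .
  then show ?thesis
    using quotient_sum unfolding mult_Suc_right sum.distrib of_nat_add by linarith
qed

end

section \<open>Remainder sequences: degrees, leading coefficients, ideals\<close>

locale euclid_sequence = residue_poly N for N :: nat +
  fixes c d \<iota> :: nat and g :: "int \<Rightarrow> nat \<Rightarrow> int"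
  assumes rs: "remainder_sequence N c d \<iota> g"
begin

definition f :: "nat \<Rightarrow> nat \<Rightarrow> int" where "f k = g (int k - 1)"

lemma params: "1 \<le> \<iota>" "\<iota> \<le> d" "d \<le> c"
  using rs by (auto simp: remainder_sequence_def)

lemma f_closed: "k \<le> Suc \<iota> \<Longrightarrow> f k \<in> carrier P"
  using rs by (auto simp: remainder_sequence_def f_def)

lemma f_degree: "deg R (f 0) = c" "deg R (f 1) = d"
  using rs by (auto simp: remainder_sequence_def f_def)

lemma f_remainder: "k < \<iota> \<Longrightarrow> is_remainder N (f k) (f (Suc k)) (f (Suc (Suc k)))"
proof -
  assume "k < \<iota>"
  then have "int k + 1 \<in> {1..int \<iota>}" by auto
  then have "is_remainder N (g (int k + 1 - 2)) (g (int k + 1 - 1)) (g (int k + 1))"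
    using rs unfolding remainder_sequence_def by blast
  then show ?thesis by (simp add: f_def add.commute)
qed

lemma f_one: "coeff P (f 1) d = 1"
  using rs by (auto simp: remainder_sequence_def f_def leading_coeff_def R_ops)

lemma f_unit:
  assumes "1 \<le> k" "k \<le> \<iota>"
  shows "leading_coeff N (f k) \<in> Units R"
proof (cases "k = 1")
  case True
  have "leading_coeff N (f 1) = \<one>\<^bsub>R\<^esub>"
    using f_one f_degree by (simp add: leading_coeff_def R_ops)
  then show ?thesis unfolding True by simp
next
  case False
  then have "int k - 1 \<in> {1..int \<iota> - 1}" using assms by auto
  then show ?thesis using rs unfolding remainder_sequence_def f_def by blast
qed

lemma f_last: "f (Suc \<iota>) = \<zero>\<^bsub>P\<^esub> \<or> leading_coeff N (f (Suc \<iota>)) \<notin> Units R"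
  using rs by (auto simp: remainder_sequence_def f_def)

lemma leading_coeff_zero: "leading_coeff N \<zero>\<^bsub>P\<^esub> \<notin> Units R"
  by (simp add: leading_coeff_def Units_R) (simp add: R_ops)

lemma f_nonzero: "1 \<le> k \<Longrightarrow> k \<le> \<iota> \<Longrightarrow> f k \<noteq> \<zero>\<^bsub>P\<^esub>"
  using f_unit[of k] leading_coeff_zero by metis

lemma f_degree_less:
  assumes "k < \<iota>" "f (Suc (Suc k)) \<noteq> \<zero>\<^bsub>P\<^esub>"
  shows "deg R (f (Suc (Suc k))) < deg R (f (Suc k))"
  using f_remainder[OF assms(1)] assms(2) unfolding is_remainder_def deg_less_def by blast

sublocale degree_sequence "\<lambda>k. deg R (f k)" c d \<iota>
proof
  fix k assume "1 \<le> k" "k < \<iota>"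
  then show "deg R (f (Suc k)) < deg R (f k)"
    using f_degree_less[of "k - 1"] f_nonzero[of "Suc k"] by (cases k) auto
qed (use params f_degree in auto)

lemma rep_lead_unit:
  assumes "1 \<le> k" "k \<le> \<iota>"
  shows "coprime (rep (f k) (deg R (f k))) N"
proof -
  have "leading_coeff N (f k) = int (rep (f k) (deg R (f k)))"
    using assms by (simp add: int_rep f_closed leading_coeff_def)
  then show ?thesis using f_unit[OF assms] by (simp add: Units_R)
qed

lemma rep_lead_not_unit:
  assumes "f (Suc \<iota>) \<noteq> \<zero>\<^bsub>P\<^esub>"
  shows "\<not> coprime (rep (f (Suc \<iota>)) (deg R (f (Suc \<iota>)))) N"
    "rep (f (Suc \<iota>)) (deg R (f (Suc \<iota>))) \<noteq> 0"
proof -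
  let ?a = "rep (f (Suc \<iota>)) (deg R (f (Suc \<iota>)))"
  have a: "leading_coeff N (f (Suc \<iota>)) = int ?a"
    by (simp add: int_rep f_closed leading_coeff_def)
  have "leading_coeff N (f (Suc \<iota>)) \<noteq> 0"
    using lcoeff_nonzero2[OF f_closed assms] by (simp add: leading_coeff_def R_ops)
  then show "?a \<noteq> 0" using a by simp
  then show "\<not> coprime ?a N"
    using f_last assms a rep_less[OF f_closed, of "Suc \<iota>"] by (auto simp: Units_R)
qed

lemma Idl_f:
  assumes "k \<le> \<iota>"
  shows "Idl\<^bsub>P\<^esub> {f 0, f 1} = Idl\<^bsub>P\<^esub> {f k, f (Suc k)}"
  using assms
proof (induction k)
  case (Suc k)
  obtain h where "h \<in> carrier P" "f k = f (Suc k) \<otimes>\<^bsub>P\<^esub> h \<oplus>\<^bsub>P\<^esub> f (Suc (Suc k))"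
    using f_remainder[of k] Suc.prems unfolding is_remainder_def by auto
  then have "Idl\<^bsub>P\<^esub> {f k, f (Suc k)} = Idl\<^bsub>P\<^esub> {f (Suc k), f (Suc (Suc k))}"
    using Suc.prems by (intro Idl_remainder) (auto intro: f_closed)
  with Suc show ?case by simp
qed simp

lemma Idl_gcd:
  assumes "f (Suc \<iota>) = \<zero>\<^bsub>P\<^esub>"
  shows "Idl\<^bsub>P\<^esub> {f 0, f 1} = Idl\<^bsub>P\<^esub> {f \<iota>}"
proof -
  interpret ideal "Idl\<^bsub>P\<^esub> {f \<iota>}" P by (intro P.genideal_ideal) (use f_closed in auto)
  have "{f \<iota>, \<zero>\<^bsub>P\<^esub>} \<subseteq> Idl\<^bsub>P\<^esub> {f \<iota>}"
    using P.genideal_self'[OF f_closed[of \<iota>]] by auto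
  then have "Idl\<^bsub>P\<^esub> {f \<iota>, \<zero>\<^bsub>P\<^esub>} \<subseteq> Idl\<^bsub>P\<^esub> {f \<iota>}"
    by (intro P.genideal_minimal is_ideal)
  moreover have "Idl\<^bsub>P\<^esub> {f \<iota>} \<subseteq> Idl\<^bsub>P\<^esub> {f \<iota>, \<zero>\<^bsub>P\<^esub>}"
    by (intro P.subset_Idl_subset P.genideal_self[THEN subset_trans[rotated]]) (use f_closed in auto)
  ultimately show ?thesis using Idl_f[of \<iota>] assms by simp
qed

end

text \<open>Remainders by polynomials with unit leading coefficient are unique, so the two sequences
  agree up to the last member of the shorter one. There one definition demands zero or a nonunit
  leading coefficient and the other a unit.\<close>

lemma remainder_sequence_length_le:
  assumes "remainder_sequence N c d \<iota> g" "remainder_sequence N c d \<iota>' g'"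
    and "g (-1) = g' (-1)" "g 0 = g' 0"
  shows "\<iota>' \<le> \<iota>"
proof (rule ccontr)
  assume "\<not> \<iota>' \<le> \<iota>"
  then have less: "\<iota> < \<iota>'" by simp
  have N: "2 \<le> N" using assms(1) by (simp add: remainder_sequence_def)
  interpret E: euclid_sequence N c d \<iota> g by unfold_locales (use N assms in auto)
  interpret E': euclid_sequence N c d \<iota>' g' by unfold_locales (use N assms in auto)
  have eq: "E.f k = E'.f k \<and> E.f (Suc k) = E'.f (Suc k)" if "k \<le> \<iota>" for k
    using that
  proof (induction k)
    case 0
    then show ?case using assms by (simp add: E.f_def E'.f_def)
  next
    case (Suc k)
    let ?b = "E.f (Suc k)"
    obtain h where h: "h \<in> carrier E.P" "E.f k = ?b \<otimes>\<^bsub>E.P\<^esub> h \<oplus>\<^bsub>E.P\<^esub> E.f (Suc (Suc k))"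
      "deg_less N (E.f (Suc (Suc k))) ?b"
      using E.f_remainder[of k] Suc.prems unfolding is_remainder_def by auto
    obtain h' where h': "h' \<in> carrier E.P" "E'.f k = E'.f (Suc k) \<otimes>\<^bsub>E.P\<^esub> h' \<oplus>\<^bsub>E.P\<^esub> E'.f (Suc (Suc k))"
      "deg_less N (E'.f (Suc (Suc k))) (E'.f (Suc k))"
      using E'.f_remainder[of k] Suc.prems less unfolding is_remainder_def by auto
    have IH: "E.f k = E'.f k" "?b = E'.f (Suc k)" using Suc by auto
    have closed: "?b \<in> carrier E.P" "E.f (Suc (Suc k)) \<in> carrier E.P" "E'.f (Suc (Suc k)) \<in> carrier E.P"
      using Suc.prems less by (auto intro: E.f_closed E'.f_closed)
    have unit: "leading_coeff N ?b \<in> Units E.R" using Suc.prems by (intro E.f_unit) auto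
    have "E.f (Suc (Suc k)) = E'.f (Suc (Suc k))"
    proof (rule E.remainder_unique[of ?b h h'])
      show "coeff E.P (E.f (Suc (Suc k))) i = 0" if "deg E.R ?b \<le> i" for i
        using h(3) that E.zero_above_degree[OF closed(2), of i] unfolding deg_less_def
        by (auto simp: E.R_ops)
      show "coeff E.P (E'.f (Suc (Suc k))) i = 0" if "deg E.R ?b \<le> i" for i
        using h'(3) that E.zero_above_degree[OF closed(3), of i] unfolding deg_less_def IH(2)[symmetric]
        by (auto simp: E.R_ops)
    qed (use closed h h' IH unit in auto)
    then show ?case using IH by simp
  qed
  from eq[of \<iota>] have "E.f (Suc \<iota>) = E'.f (Suc \<iota>)" by simp
  then show False
    using E'.f_unit[of "Suc \<iota>"] E'.f_nonzero[of "Suc \<iota>"] E.f_last less by auto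
qed

section \<open>The Euclidean algorithm\<close>

text \<open>The multiword constant 1 is copied from the leading coefficient of the monic divisor,
  and 0 is obtained as \<open>1 - 1\<close>. The divisor is its own monic associate, so it is also
  copied to area \<open>K + 5\<close>.\<close>

definition initialise :: "nat \<Rightarrow> prog" where
  "initialise K =
     Instr (IndexCopy K 0) ;; Instr (IndexZero (K + 1)) ;; copy_value K 0 (K + 1) K (K + 1) ;;
     copy_rows K 1 (K + 3) 2 ;; copy_rows K 2 (K + 4) 3 ;; copy_rows K 2 (K + 5) 3 ;;
     Instr (IndexCopy (K + 2) 2) ;; Instr (IndexCopy (K + 3) 3) ;; Instr (IndexDec (K + 3)) ;;
     copy_value K 2 (K + 3) (K + 1) (K + 1) ;;
     sub_value K (K + 2) (K + 1) (K + 1) (K + 1) (K + 1) (K + 1) (K + 7) ;;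
     Instr (IndexZero (K + 10))"

definition write_output :: "nat \<Rightarrow> prog" where
  "write_output K =
     Instr (IndexDec (K + 10)) ;;
     If (IndexEq (K + 10) (K + 1))
       (Instr (IndexInc (K + 3)) ;; copy_rows K (K + 4) 0 (K + 3) ;;
        Instr (IndexCopy 1 (K + 3)) ;; Instr (IndexCopy 0 K))
       (copy_value K (K + 8) (K + 1) 0 (K + 1) ;; Instr (IndexZero 1) ;; Instr (IndexInc 1) ;;
        Instr (IndexCopy 0 K))"

definition euclid :: "nat \<Rightarrow> prog \<Rightarrow> prog \<Rightarrow> prog \<Rightarrow> prog" where
  "euclid K pm pg pv =
     initialise K ;; While (IndexEq (K + 10) (K + 1)) (euclid_round K pm pg pv) ;; write_output K"

section \<open>Correctness and cost of the whole algorithm\<close>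

locale euclid_execution = euclid_machine W l N K pm Mm pg pv G + euclid_sequence N c d \<iota> g
  for W :: "'w::len itself" and l N K :: nat and pm :: prog and Mm :: real
    and pg pv :: prog and G :: real and c d \<iota> :: nat and g :: "int \<Rightarrow> nat \<Rightarrow> int"
begin

abbreviation D :: "nat \<Rightarrow> nat" where "D k \<equiv> deg R (f k)"

text \<open>
  After \<open>k\<close> rounds the machine is about to divide \<open>f k\<close> by \<open>f (k + 1)\<close>. It divides by the monic
  associate instead, which has the same remainders but saves the multiplications by the inverse \<open>u\<close>.
\<close>

definition running :: "nat \<Rightarrow> (nat \<Rightarrow> nat) \<Rightarrow> (nat \<Rightarrow> nat \<Rightarrow> nat) \<Rightarrow> bool" where
  "running k I V \<longleftrightarrow> ready I V \<and> I (K + 2) = Suc (D k) \<and> I (K + 3) = D (Suc k) \<and> I (K + 10) = 0 \<and>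
     (\<forall>i\<le>D k. V (K + 3) i = rep (f k) i) \<and> (\<forall>i\<le>D (Suc k). V (K + 4) i = rep (f (Suc k)) i) \<and>
     (\<exists>u<N. [rep (f (Suc k)) (D (Suc k)) * u = 1] (mod N) \<and>
       (\<forall>i<D (Suc k). V (K + 5) i = u * rep (f (Suc k)) i mod N))"

definition halted :: "(nat \<Rightarrow> nat) \<Rightarrow> (nat \<Rightarrow> nat \<Rightarrow> nat) \<Rightarrow> bool" where
  "halted I V \<longleftrightarrow> ready I V \<and>
     (if f (Suc \<iota>) = \<zero>\<^bsub>P\<^esub>
      then I (K + 10) = 1 \<and> I (K + 3) = D \<iota> \<and> (\<forall>i\<le>D \<iota>. V (K + 4) i = rep (f \<iota>) i)
      else I (K + 10) = 2 \<and> V (K + 8) 0 = gcd (rep (f (Suc \<iota>)) (D (Suc \<iota>))) N)"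

definition result :: "nat list" where
  "result = (if f (Suc \<iota>) = \<zero>\<^bsub>P\<^esub> then coeff_vector N (f \<iota>)
     else [gcd (rep (f (Suc \<iota>)) (D (Suc \<iota>))) N])"

lemma coeff_vector_rep: "coeff_vector N h = map (rep h) [0..<Suc (deg R h)]"
  by (simp add: coeff_vector_def rep_def)

lemma coeff_vector_nth [simp]: "i \<le> deg R h \<Longrightarrow> coeff_vector N h ! i = rep h i"
  unfolding coeff_vector_rep by (subst nth_map) (simp_all del: upt_Suc)

lemma length_coeff_vector [simp]: "length (coeff_vector N h) = Suc (deg R h)"
  by (simp add: coeff_vector_rep del: upt_Suc)

lemma run_initialise:
  assumes Q: "\<And>I' V'. running 0 I' V' \<Longrightarrow> Q (T - (24 * real (c + 1) * real l + 40 * real l)) I' V'"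
    and data: "holds_data I V l [[N], coeff_vector N (f 0), coeff_vector N (f 1)]"
  shows "run W l (- {4}) (initialise K) T I V Q"
proof (rule run_conseq[where c = "24 * real (c + 1) * real l + 40 * real l" and R = "running 0"])
  have 0: "I (j + 1) = length ([[N], coeff_vector N (f 0), coeff_vector N (f 1)] ! j) \<and>
      (\<forall>i<length ([[N], coeff_vector N (f 0), coeff_vector N (f 1)] ! j).
        V j i = [[N], coeff_vector N (f 0), coeff_vector N (f 1)] ! j ! i)" if "j < 3" for j
    using data that by (simp add: holds_data_def)
  have I0: "I 0 = l" using data by (simp add: holds_data_def)
  have I1: "I 1 = 1" "I 2 = Suc c" "I 3 = Suc d" and V0: "V 0 0 = N"
    and V1: "\<And>i. i \<le> c \<Longrightarrow> V 1 i = rep (f 0) i" and V2: "\<And>i. i \<le> d \<Longrightarrow> V 2 i = rep (f 1) i"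
    using 0[of 0] 0[of 1] 0[of 2] f_degree
    by (simp_all add: numeral_2_eq_2 numeral_3_eq_3 less_Suc_eq_le)
  have lead: "rep (f 1) d = 1" using f_one by (simp add: rep_def)
  have cost: "1 + 1 + 6 * real l + (real (Suc c) * (8 * real l) + 2) + (real (Suc d) * (8 * real l) + 2) +
      (real (Suc d) * (8 * real l) + 2) + 1 + 1 + 1 + 6 * real l + 14 * real l + 1
      \<le> 24 * real (c + 1) * real l + 40 * real l"
  proof -
    have "real (Suc d) * real l \<le> real (c + 1) * real l" using c by (intro mult_right_mono) auto
    moreover have "real (Suc d) * (8 * real l) = 8 * (real (Suc d) * real l)"
      "real (Suc c) * (8 * real l) = 8 * (real (c + 1) * real l)"
      "24 * real (c + 1) * real l = 24 * (real (c + 1) * real l)" by simp_all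
    ultimately show ?thesis using l_real by linarith
  qed
  show "run W l (- {4}) (initialise K) T I V
      (\<lambda>T' I' V'. T - (24 * real (c + 1) * real l + 40 * real l) \<le> T' \<and> running 0 I' V')"
    unfolding initialise_def
    apply (rule straight)+
    apply (rule run_copy_rows)
    apply (rule run_Seq)
    apply (rule run_copy_rows)
    apply (rule run_Seq)
    apply (rule run_copy_rows)
    apply (rule straight)+
    subgoal
      using cost I0 I1 V0 V1 V2 lead K N f_degree
      apply (simp add: running_def ready_def)
      \<comment> \<open>The witness for \<open>u\<close> is 1 because the first divisor is
        monic.\<close>
      apply (intro conjI exI[of _ 1])
        apply (auto simp: rep_less f_closed cong_def)
      done
    using I0 I1 V0 K l by simp_all
qed (use Q in blast)

lemma run_write_output:
  assumes Q: "\<And>I' V'. holds_data I' V' l [result] \<Longrightarrow>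
      Q (T - (8 * real (c + 1) * real l + 10 * real l)) I' V'"
    and halted: "halted I V"
  shows "run W l (- {4}) (write_output K) T I V Q"
proof (rule run_conseq[where c = "8 * real (c + 1) * real l + 10 * real l"
      and R = "\<lambda>I' V'. holds_data I' V' l [result]"])
  have D\<iota>: "D \<iota> \<le> c"
  proof -
    have "D (Suc k) \<le> c" if "k < \<iota>" for k
      using that
    proof (induction k)
      case 0
      then show ?case using D1 c by simp
    next
      case (Suc k)
      then show ?case using degree_le[of "Suc k"] by simp
    qed
    from this[of "\<iota> - 1"] show ?thesis using \<iota> by simp
  qed
  have cost: "real (Suc (D \<iota>)) * (8 * real l) + 7 \<le> 8 * real (c + 1) * real l + 10 * real l"
  proof -
    have "real (Suc (D \<iota>)) * real l \<le> real (c + 1) * real l" using D\<iota> by (intro mult_right_mono) auto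
    moreover have "real (Suc (D \<iota>)) * (8 * real l) = 8 * (real (Suc (D \<iota>)) * real l)"
      "8 * real (c + 1) * real l = 8 * (real (c + 1) * real l)" by (rule mult.left_commute mult.assoc)+
    ultimately show ?thesis using l_real by linarith
  qed
  have cost': "6 * real l + 5 \<le> 8 * real (c + 1) * real l + 10 * real l"
  proof -
    have "1 * real l \<le> 8 * real (c + 1) * real l" by (intro mult_right_mono) auto
    then show ?thesis using l_real by linarith
  qed
  show "run W l (- {4}) (write_output K) T I V (\<lambda>T' I' V'.
      T - (8 * real (c + 1) * real l + 10 * real l) \<le> T' \<and> holds_data I' V' l [result])"
  proof (cases "f (Suc \<iota>) = \<zero>\<^bsub>P\<^esub>")
    case True
    show ?thesis
      unfolding write_output_def
      apply (rule straight)+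
       apply (rule run_If)
      subgoal using K by simp
        apply (rule straight)+
         apply (rule run_copy_rows)
               apply (rule straight)+
      subgoal using halted True cost K
        by (simp add: halted_def ready_def holds_data_def result_def)
      using halted True K l by (simp_all add: halted_def ready_def)
  next
    case False
    show ?thesis
      unfolding write_output_def
      apply (rule straight)+
       apply (rule run_If)
      subgoal using K by simp
      subgoal using halted False by (simp add: halted_def ready_def)
        apply (rule straight)+
      subgoal using halted False cost' K
        by (simp add: halted_def ready_def holds_data_def result_def)
      using halted False K l by (simp_all add: halted_def ready_def)
  qed
qed (use Q in blast)

text \<open>The last round normalizes nothing and inverts nothing; it computes a gcd only if the
  remainder is nonzero. Summing the coefficients of \<open>G\<close> gives
  \<open>2 (\<iota> - 1)\<close> or \<open>2 \<iota> - 1\<close>.\<close>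

definition round_cost :: "nat \<Rightarrow> real" where
  "round_cost k =
     real ((Suc (D k) - D (Suc k)) * D (Suc k) + (if Suc k < \<iota> then D (Suc (Suc k)) else 0)) * Mm
     + 205 * real ((Suc (D k) - D (Suc k)) * Suc (D (Suc k))) * real l
     + (if Suc k < \<iota> then 2 else if f (Suc \<iota>) = \<zero>\<^bsub>P\<^esub> then 0 else 1) * G"

lemma run_round:
  assumes k: "k < \<iota>" and I: "running k I V"
  shows "run W l {K..} (euclid_round K pm pg pv) T I V (\<lambda>T' I' V'. T - round_cost k \<le> T' \<and>
    (if Suc k < \<iota> then running (Suc k) I' V' else halted I' V'))"
proof -
  let ?m = "D k" and ?n = "D (Suc k)"
  define r where "r = long_division N ?n (V (K + 5)) ?m (Suc ?m - ?n) (V (K + 3))"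
  have ready: "ready I V" and deg: "I (K + 2) = Suc ?m" "I (K + 3) = ?n" and I10: "I (K + 10) = 0"
    and VP: "\<And>i. i \<le> ?m \<Longrightarrow> V (K + 3) i = rep (f k) i"
    and VQ: "\<And>i. i \<le> ?n \<Longrightarrow> V (K + 4) i = rep (f (Suc k)) i"
    using I by (auto simp: running_def)
  obtain u where u: "u < N" "[rep (f (Suc k)) ?n * u = 1] (mod N)"
    and VR: "\<And>i. i < ?n \<Longrightarrow> V (K + 5) i = u * rep (f (Suc k)) i mod N"
    using I unfolding running_def by blast
  have le: "?n \<le> ?m" using degree_le[OF k] .
  have closed: "f k \<in> carrier P" "f (Suc k) \<in> carrier P" "f (Suc (Suc k)) \<in> carrier P"
    using k by (auto intro: f_closed)
  have less: "\<And>i. i \<le> ?m \<Longrightarrow> V (K + 3) i < N" "\<And>i. i < ?n \<Longrightarrow> V (K + 5) i < N"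
    using VP VR N rep_less[OF closed(1)] by auto
  have r: "r i = rep (f (Suc (Suc k))) i" if "i < ?n" for i
    unfolding r_def using f_unit[of "Suc k"] k
    by (intro scaled_division[OF closed(1,2) u VP VR le f_remainder[OF k] closed(3) _ that]) auto
  show ?thesis
  proof (cases "Suc k < \<iota>")
    case True
    let ?k = "D (Suc (Suc k))"
    have lt: "?k < ?n" using descending[of "Suc k"] True by simp
    have top: "r i = 0" if "?k < i" "i < ?n" for i
      using r[OF that(2)] zero_above_degree[OF closed(3) that(1)] by (simp add: rep_def)
    have co: "coprime (r ?k) N"
      using rep_lead_unit[of "Suc (Suc k)"] True r[OF lt] by simp
    have "run W l {K..} (euclid_round K pm pg pv) T I V (\<lambda>T' I' V'.
      T - (real ((Suc ?m - ?n) * ?n + ?k) * Mm + 205 * real ((Suc ?m - ?n) * Suc ?n) * real l + 2 * G) \<le> T' \<and>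
      ready I' V' \<and> I' (K + 2) = Suc ?n \<and> I' (K + 3) = ?k \<and> I' (K + 10) = I (K + 10) \<and>
      (\<forall>i\<le>?n. V' (K + 3) i = V (K + 4) i) \<and> (\<forall>i\<le>?k. V' (K + 4) i = r i) \<and>
      (\<exists>u<N. [r ?k * u = 1] (mod N) \<and> (\<forall>i<?k. V' (K + 5) i = u * r i mod N)))"
      unfolding r_def by (rule run_round_step) (use ready deg le less lt top co in \<open>simp_all flip: r_def\<close>)
    then show ?thesis
    proof (rule run_mono, elim conjE)
      fix T' I' V'
      assume *: "T - (real ((Suc ?m - ?n) * ?n + ?k) * Mm + 205 * real ((Suc ?m - ?n) * Suc ?n) * real l + 2 * G) \<le> T'"
        "ready I' V'" "I' (K + 2) = Suc ?n" "I' (K + 3) = ?k" "I' (K + 10) = I (K + 10)"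
        "\<forall>i\<le>?n. V' (K + 3) i = V (K + 4) i" "\<forall>i\<le>?k. V' (K + 4) i = r i"
        "\<exists>u<N. [r ?k * u = 1] (mod N) \<and> (\<forall>i<?k. V' (K + 5) i = u * r i mod N)"
      have "running (Suc k) I' V'"
        using * I10 VQ r lt by (auto simp: running_def)
      then show "T - round_cost k \<le> T' \<and> (if Suc k < \<iota> then running (Suc k) I' V' else halted I' V')"
        using *(1) True by (simp add: round_cost_def)
    qed
  next
    case False
    then have k\<iota>: "\<iota> = Suc k" using k by simp
    show ?thesis
    proof (cases "f (Suc \<iota>) = \<zero>\<^bsub>P\<^esub>")
      case True
      have zero: "r i = 0" if "i < ?n" for i
        using r[OF that] True by (simp add: rep_def R_ops k\<iota>)
      have "run W l {K..} (euclid_round K pm pg pv) T I V (\<lambda>T' I' V'.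
        T - (real ((Suc ?m - ?n) * ?n) * Mm + 205 * real ((Suc ?m - ?n) * Suc ?n) * real l) \<le> T' \<and>
        ready I' V' \<and> I' (K + 3) = ?n \<and> I' (K + 10) = Suc (I (K + 10)) \<and> V' (K + 4) = V (K + 4))"
        by (rule run_round_zero) (use ready deg le less zero in \<open>simp_all flip: r_def\<close>)
      then show ?thesis
      proof (rule run_mono, elim conjE)
        fix T' I' V'
        assume *: "T - (real ((Suc ?m - ?n) * ?n) * Mm + 205 * real ((Suc ?m - ?n) * Suc ?n) * real l) \<le> T'"
          "ready I' V'" "I' (K + 3) = ?n" "I' (K + 10) = Suc (I (K + 10))" "V' (K + 4) = V (K + 4)"
        have "halted I' V'" using * True I10 VQ by (simp add: halted_def flip: k\<iota>)
        then show "T - round_cost k \<le> T' \<and> (if Suc k < \<iota> then running (Suc k) I' V' else halted I' V')"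
          using *(1) True False by (simp add: round_cost_def)
      qed
    next
      case nz: False
      let ?k = "D (Suc (Suc k))"
      have lt: "?k < ?n" using f_degree_less[OF k] nz by (simp add: k\<iota>)
      have top: "r i = 0" if "?k < i" "i < ?n" for i
        using r[OF that(2)] zero_above_degree[OF closed(3) that(1)] by (simp add: rep_def)
      have lead: "r ?k \<noteq> 0" "\<not> coprime (r ?k) N"
        using rep_lead_not_unit[OF nz] r[OF lt] by (simp_all add: k\<iota>)
      have "run W l {K..} (euclid_round K pm pg pv) T I V (\<lambda>T' I' V'.
        T - (real ((Suc ?m - ?n) * ?n) * Mm + 205 * real ((Suc ?m - ?n) * Suc ?n) * real l + G) \<le> T' \<and>
        ready I' V' \<and> I' (K + 10) = Suc (Suc (I (K + 10))) \<and> V' (K + 8) 0 = gcd (r ?k) N)"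
        unfolding r_def by (rule run_round_gcd) (use ready deg le less lt top lead in \<open>simp_all flip: r_def\<close>)
      then show ?thesis
      proof (rule run_mono, elim conjE)
        fix T' I' V'
        assume *: "T - (real ((Suc ?m - ?n) * ?n) * Mm + 205 * real ((Suc ?m - ?n) * Suc ?n) * real l + G) \<le> T'"
          "ready I' V'" "I' (K + 10) = Suc (Suc (I (K + 10)))" "V' (K + 8) 0 = gcd (r ?k) N"
        have "halted I' V'" using * nz I10 r[OF lt] by (simp add: halted_def flip: k\<iota>)
        then show "T - round_cost k \<le> T' \<and> (if Suc k < \<iota> then running (Suc k) I' V' else halted I' V')"
          using *(1) nz False by (simp add: round_cost_def)
      qed
    qed
  qed
qed

text \<open>The rounds contribute \<open>205 * 5 = 1025\<close> to the coefficient of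
  \<open>B c d \<iota> * l\<close>, by \<open>overhead_sum\<close>; initialization, loop tests and
  output add 116, by \<open>c_le_B\<close>. The constant 1200 is rounded up.\<close>

definition total_cost :: real where
  "total_cost = (B (c + \<iota> - 1) d \<iota> - real \<iota> * (real \<iota> - 1) / 2) * Mm + 1200 * B c d \<iota> * real l
     + (2 * (real \<iota> - 1) + (if f (Suc \<iota>) = \<zero>\<^bsub>P\<^esub> then 0 else 1)) * G"

lemma total_cost:
  assumes "0 \<le> Mm"
  shows "(24 * real (c + 1) * real l + 40 * real l) + ((\<Sum>k<\<iota>. round_cost k + 1) + 1) +
      (8 * real (c + 1) * real l + 10 * real l) \<le> total_cost"
proof -
  obtain n where n: "\<iota> = Suc n" using \<iota> by (cases \<iota>) auto
  have "(\<Sum>k<\<iota>. (if Suc k < \<iota> then 2 else if f (Suc \<iota>) = \<zero>\<^bsub>P\<^esub> then 0 else 1) * G) =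
      (2 * (real \<iota> - 1) + (if f (Suc \<iota>) = \<zero>\<^bsub>P\<^esub> then 0 else 1)) * G"
    unfolding n by (simp add: algebra_simps)
  moreover have "(\<Sum>k<\<iota>. real (x k) * Mm + 205 * real (y k) * real l + z k) =
      real (\<Sum>k<\<iota>. x k) * Mm + 205 * real (\<Sum>k<\<iota>. y k) * real l + (\<Sum>k<\<iota>. z k)"
    for x y :: "nat \<Rightarrow> nat" and z
    by (simp add: sum.distrib sum_distrib_right sum_distrib_left)
  ultimately have sum: "(\<Sum>k<\<iota>. round_cost k) =
      real (\<Sum>k<\<iota>. (Suc (D k) - D (Suc k)) * D (Suc k) + (if Suc k < \<iota> then D (Suc (Suc k)) else 0)) * Mm
      + 205 * real (\<Sum>k<\<iota>. (Suc (D k) - D (Suc k)) * Suc (D (Suc k))) * real l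
      + (2 * (real \<iota> - 1) + (if f (Suc \<iota>) = \<zero>\<^bsub>P\<^esub> then 0 else 1)) * G"
    unfolding round_cost_def by (simp only:)
  have 1: "real (\<Sum>k<\<iota>. (Suc (D k) - D (Suc k)) * D (Suc k) + (if Suc k < \<iota> then D (Suc (Suc k)) else 0)) * Mm
      \<le> (B (c + \<iota> - 1) d \<iota> - real \<iota> * (real \<iota> - 1) / 2) * Mm"
    by (rule mult_right_mono[OF multiplication_count assms])
  have 2: "real (\<Sum>k<\<iota>. (Suc (D k) - D (Suc k)) * Suc (D (Suc k))) * real l \<le> 5 * B c d \<iota> * real l"
    by (rule mult_right_mono[OF overhead_sum]) simp
  have 3: "real (c + 1) * real l \<le> 2 * B c d \<iota> * real l"
    using c_le_B by (intro mult_right_mono) auto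
  have B1: "1 \<le> B c d \<iota>" using c_le_B \<iota> c by simp
  have 4: "1 * real l \<le> B c d \<iota> * real l" using B1 by (intro mult_right_mono) auto
  have "real \<iota> + 1 \<le> 2 * B c d \<iota>" using c_le_B \<iota> c by simp
  also have "\<dots> \<le> 2 * B c d \<iota> * real l" using l_real B1 by simp
  finally have 5: "real \<iota> + 1 \<le> 2 * B c d \<iota> * real l" .
  have "(\<Sum>k<\<iota>. round_cost k + 1) = (\<Sum>k<\<iota>. round_cost k) + real \<iota>" by (simp add: sum.distrib)
  with 1 2 3 4 5 show ?thesis unfolding sum total_cost_def by (simp only: mult.assoc mult_1)
qed

lemma run_euclid:
  assumes "0 \<le> Mm" and data: "holds_data I V l [[N], coeff_vector N (f 0), coeff_vector N (f 1)]"
  shows "run W l (- {4}) (euclid K pm pg pv) total_cost I V (\<lambda>T' I' V'. 0 \<le> T' \<and> holds_data I' V' l [result])"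
  unfolding euclid_def
  apply (rule run_Seq)
  apply (rule run_initialise)
  subgoal premises init for I1 V1
    apply (rule run_Seq)
    \<comment> \<open>Input and output lie below \<open>K\<close> and need the large view, whereas
      the loop is verified in \<open>{K..}\<close>. Only \<open>halted\<close>, which concerns
      numbers from \<open>K\<close> on, is carried out of the loop.\<close>
    apply (rule run_extend[where X = "{K..}" and Q' = "\<lambda>T' I' V'. T' = total_cost -
          (24 * real (c + 1) * real l + 40 * real l) - ((\<Sum>k<\<iota>. round_cost k + 1) + 1) \<and> halted I' V'"])
    subgoal using K by auto
    subgoal
      apply (rule run_while[where n = \<iota> and c = round_cost and
            Inv = "\<lambda>k I V. if k < \<iota> then running k I V else halted I V"])
      subgoal for k T I V
        using run_round[of k I V T] by (auto simp: running_def ready_def)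
      subgoal by (auto simp: halted_def ready_def split: if_splits)
      subgoal by simp
      subgoal using init \<iota> by simp
      subgoal by simp
      done
    subgoal premises h for T' I' V' I'' V''
      apply (rule run_write_output)
      subgoal using h(1) total_cost[OF assms(1)] by auto
      subgoal using h unfolding halted_def ready_def by (simp split: if_splits)
      done
    done
  subgoal using data .
  done

lemma solves_euclid:
  assumes "0 \<le> Mm"
  shows "solves_within W (euclid K pm pg pv) l [[N], coeff_vector N (g (-1)), coeff_vector N (g 0)] l
    {[result]} total_cost"
proof (rule solves_within_runI)
  fix I V assume "holds_data I V l [[N], coeff_vector N (g (- 1)), coeff_vector N (g 0)]"
  then have "run W l (- {4}) (euclid K pm pg pv) total_cost I V (\<lambda>T' I' V'. 0 \<le> T' \<and> holds_data I' V' l [result])"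
    by (intro run_euclid assms) (simp add: f_def)
  then show "run W l UNIV (euclid K pm pg pv) total_cost I V
      (\<lambda>T' I' V'. 0 \<le> T' \<and> (\<exists>out\<in>{[result]}. holds_data I' V' l out))"
    by (rule run_extend[rotated]) (auto simp: holds_data_def)
qed

end

section \<open>Number of words per residue\<close>

lemma bit_length_bounds:
  assumes "2 \<le> N"
  shows "1 \<le> bit_length N" "real (bit_length N) \<le> 2 * log 2 (real N)"
proof -
  have "log 2 2 \<le> log 2 (real N)" using assms by (subst log_le_cancel_iff) auto
  then have "1 \<le> log 2 (real N)" by simp
  moreover from this have "real (nat \<lfloor>log 2 (real N)\<rfloor>) \<le> log 2 (real N)" by linarith
  ultimately show "real (bit_length N) \<le> 2 * log 2 (real N)" unfolding bit_length_def by linarith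
qed (simp add: bit_length_def)

lemma words_for_bounds:
  fixes W :: "'w::len itself"
  assumes "1 \<le> n"
  shows "1 \<le> words_for W n" "words_for W n \<le> n"
proof -
  have L: "1 \<le> real LENGTH('w)" by (simp add: Suc_leI)
  have "0 < real n / real LENGTH('w)" using assms L by simp
  then show "1 \<le> words_for W n" unfolding words_for_def by linarith
  have "real n / real LENGTH('w) \<le> real n" using L by (simp add: divide_le_eq mult_le_cancel_left1)
  then have "\<lceil>real n / real LENGTH('w)\<rceil> \<le> int n" by (simp add: ceiling_le_iff)
  then show "words_for W n \<le> n" unfolding words_for_def by linarith
qed

lemma residue_words_bounds:
  assumes "2 \<le> N"
  shows "1 \<le> residue_words W N" "real (residue_words W N) \<le> 2 * log 2 (real N)"
  using words_for_bounds[OF bit_length_bounds(1)[OF assms], of W] bit_length_bounds(2)[OF assms] by auto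

lemma solves_within_mono:
  "solves_within W p l inp l' Out T \<Longrightarrow> Out \<subseteq> Out' \<Longrightarrow> T \<le> T' \<Longrightarrow> solves_within W p l inp l' Out' T'"
  unfolding solves_within_def by (meson order_trans subsetD)

theorem proposition6p2:
  fixes M Mmod :: "nat \<Rightarrow> real" and W :: "'w::len itself"
  assumes M: "multiplication_time W M"
    and Mmod: "modular_multiplication_time W Mmod"
    and Mmod_M: "Mmod \<in> O(\<lambda>N. M (bit_length N))"
    and gcd_cost: "gcd_cost_bigo W (\<lambda>N. M (bit_length N) * ln (real N))"
    and inverse_cost: "inverse_cost_bigo W (\<lambda>N. M (bit_length N) * ln (real N))"
  shows
    "(\<forall>N c d \<iota> g \<iota>' g'. remainder_sequence N c d \<iota> g \<and> remainder_sequence N c d \<iota>' g' \<and>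
        g (-1) = g' (-1) \<and> g 0 = g' 0 \<longrightarrow> \<iota> = \<iota>') \<and>
     (\<forall>N c d \<iota> g e. remainder_sequence N c d \<iota> g \<and> e \<ge> d \<longrightarrow>
        B e d \<iota> \<in> {real d * (real e + 1 - real d)..real d * real e} \<inter> \<rat>) \<and>
     (\<forall>N c d \<iota> g. remainder_sequence N c d \<iota> g \<and> g (int \<iota>) = \<zero>\<^bsub>Zmod_poly N\<^esub> \<longrightarrow>
        Idl\<^bsub>Zmod_poly N\<^esub> {g (-1), g 0} = Idl\<^bsub>Zmod_poly N\<^esub> {g (int \<iota> - 1)}) \<and>
     (\<exists>p C1 C2. \<forall>N c d \<iota> g.
        remainder_sequence N c d \<iota> g \<and> g (int \<iota>) = \<zero>\<^bsub>Zmod_poly N\<^esub> \<longrightarrow>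
        solves_within W p
          (residue_words W N) [[N], coeff_vector N (g (-1)), coeff_vector N (g 0)]
          (residue_words W N) {[coeff_vector N (g (int \<iota> - 1))]}
          ((B (c + \<iota> - 1) d \<iota> - real \<iota> * (real \<iota> - 1) / 2) * Mmod N
            + B c d \<iota> * (C1 * log 2 (real N))
            + C2 * (2 * (real \<iota> - 1) * M (bit_length N) * ln (real N)))) \<and>
     (\<exists>p C1 C2. \<forall>N c d \<iota> g.
        remainder_sequence N c d \<iota> g \<and> g (int \<iota>) \<noteq> \<zero>\<^bsub>Zmod_poly N\<^esub> \<longrightarrow>
        solves_within W p
          (residue_words W N) [[N], coeff_vector N (g (-1)), coeff_vector N (g 0)]
          (residue_words W N) {[[m]] | m. proper_divisor m N}
          ((B (c + \<iota> - 1) d \<iota> - real \<iota> * (real \<iota> - 1) / 2) * Mmod N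
            + B c d \<iota> * (C1 * log 2 (real N))
            + C2 * ((2 * real \<iota> - 1) * M (bit_length N) * ln (real N))))"
proof -
  obtain pm where pm: "\<And>N a b. 1 \<le> N \<Longrightarrow> a < N \<Longrightarrow> b < N \<Longrightarrow>
      solves_within W pm (residue_words W N) [[N], [a], [b]] (residue_words W N) {[[a * b mod N]]} (Mmod N)"
    and Mmod_pos: "\<And>N. 1 \<le> N \<Longrightarrow> 0 < Mmod N"
    using Mmod unfolding modular_multiplication_time_def by blast
  obtain pg Cg where pg: "\<And>N b. b \<in> {2..<N} \<Longrightarrow>
      solves_within W pg (residue_words W N) [[N], [b]] (residue_words W N) {[[gcd b N]]}
        (Cg * (M (bit_length N) * ln (real N)))"
    using gcd_cost unfolding gcd_cost_bigo_def by blast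
  obtain pv Cv where pv: "\<And>N b. b \<in> {2..<N} \<Longrightarrow> coprime b N \<Longrightarrow>
      solves_within W pv (residue_words W N) [[N], [b]] (residue_words W N)
        {[[y]] | y. y < N \<and> [b * y = 1] (mod N)} (Cv * (M (bit_length N) * ln (real N)))"
    using inverse_cost unfolding inverse_cost_bigo_def by blast
  \<comment> \<open>The number \<open>K\<close> has to be chosen here, before any instance is fixed,
    because the text of \<open>euclid\<close> depends on it.\<close>
  obtain K0 where K0: "\<forall>x \<in> prog_writes pm \<union> prog_writes pg \<union> prog_writes pv. x < K0"
    using finite_nat_bounded[of "prog_writes pm \<union> prog_writes pg \<union> prog_writes pv"]
    by (auto simp: finite_prog_writes)
  define K where "K = max 10 K0"
  have K: "10 \<le> K" "prog_writes pm \<subseteq> {..<K}" "prog_writes pg \<subseteq> {..<K}" "prog_writes pv \<subseteq> {..<K}"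
    using K0 by (auto simp: K_def less_max_iff_disj)
  \<comment> \<open>One constant covers gcd and inversion; the maximum with 0 makes \<open>G\<close>
    nonnegative.\<close>
  define C2 where "C2 = max 0 (max Cg Cv)"
  define G where "G N = C2 * (M (bit_length N) * ln (real N))" for N
  have execution: "euclid_execution W (residue_words W N) N K pm (Mmod N) pg pv (G N) c d \<iota> g"
    if rs: "remainder_sequence N c d \<iota> g" for N c d \<iota> g
  proof -
    have N: "2 \<le> N" using rs by (simp add: remainder_sequence_def)
    have "0 < M (bit_length N)"
      using M bit_length_bounds(1)[OF N] unfolding multiplication_time_def by blast
    then have pos: "0 \<le> M (bit_length N) * ln (real N)" using N by simp
    then have "Cg * (M (bit_length N) * ln (real N)) \<le> G N"
      "Cv * (M (bit_length N) * ln (real N)) \<le> G N" "0 \<le> G N"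
      unfolding G_def C2_def by (auto intro: mult_right_mono)
    then show ?thesis
      using N rs residue_words_bounds(1)[OF N, of W] K pm[of N]
        solves_within_mono[OF pg[of _ N] order_refl] solves_within_mono[OF pv[of _ N] order_refl]
      by unfold_locales auto
  qed
  \<comment> \<open>The constant 2400 is \<open>2 * 1200\<close>, as a residue has at most
    \<open>2 * log 2 N\<close> words.\<close>
  have cost: "euclid_execution.total_cost (residue_words W N) N (Mmod N) (G N) c d \<iota> g \<le>
      (B (c + \<iota> - 1) d \<iota> - real \<iota> * (real \<iota> - 1) / 2) * Mmod N + B c d \<iota> * (2400 * log 2 (real N))
      + C2 * ((2 * (real \<iota> - 1) + (if g (int \<iota>) = \<zero>\<^bsub>Zmod_poly N\<^esub> then 0 else 1)) * M (bit_length N) * ln (real N))"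
    if rs: "remainder_sequence N c d \<iota> g" for N c d \<iota> g
  proof -
    interpret euclid_execution W "residue_words W N" N K pm "Mmod N" pg pv "G N" c d \<iota> g
      by (rule execution[OF rs])
    have "B c d \<iota> * real (residue_words W N) \<le> B c d \<iota> * (2 * log 2 (real N))"
      using residue_words_bounds(2)[OF N, of W] c_le_B by (intro mult_left_mono) auto
    then show ?thesis unfolding total_cost_def unfolding G_def by (simp add: f_def algebra_simps)
  qed
  have solves: "solves_within W (euclid K pm pg pv) (residue_words W N)
      [[N], coeff_vector N (g (-1)), coeff_vector N (g 0)] (residue_words W N)
      {[euclid_execution.result N \<iota> g]}
      (euclid_execution.total_cost (residue_words W N) N (Mmod N) (G N) c d \<iota> g)"
    if rs: "remainder_sequence N c d \<iota> g" for N c d \<iota> g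
  proof -
    interpret euclid_execution W "residue_words W N" N K pm "Mmod N" pg pv "G N" c d \<iota> g
      by (rule execution[OF rs])
    show ?thesis using solves_euclid Mmod_pos[of N] N by simp
  qed
  \<comment> \<open>Both existential claims are met by the same program and the same
    constants.\<close>
  have witness: "\<exists>p C1 C2. Q p C1 C2" if "Q (euclid K pm pg pv) 2400 C2"
    for Q :: "prog \<Rightarrow> real \<Rightarrow> real \<Rightarrow> bool"
    using that by blast
  show ?thesis
  proof (intro conjI allI impI witness; elim conjE)
    fix N c d \<iota> g \<iota>' g'
    assume "remainder_sequence N c d \<iota> g" "remainder_sequence N c d \<iota>' g'" "g (-1) = g' (-1)" "g 0 = g' 0"
    then show "\<iota> = \<iota>'"
      using remainder_sequence_length_le[of N c d \<iota> g \<iota>' g'] remainder_sequence_length_le[of N c d \<iota>' g' \<iota> g]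
      by simp
  next
    fix N c d \<iota> g and e :: nat
    assume "remainder_sequence N c d \<iota> g"
    then have "1 \<le> \<iota>" "\<iota> \<le> d" by (auto simp: remainder_sequence_def)
    then show "B e d \<iota> \<in> {real d * (real e + 1 - real d)..real d * real e} \<inter> \<rat>"
      using B_bounds B_Rats by auto
  next
    fix N c d \<iota> g
    assume rs: "remainder_sequence N c d \<iota> g" and zero: "g (int \<iota>) = \<zero>\<^bsub>Zmod_poly N\<^esub>"
    interpret euclid_execution W "residue_words W N" N K pm "Mmod N" pg pv "G N" c d \<iota> g
      by (rule execution[OF rs])
    show "Idl\<^bsub>Zmod_poly N\<^esub> {g (-1), g 0} = Idl\<^bsub>Zmod_poly N\<^esub> {g (int \<iota> - 1)}"
      using Idl_gcd zero by (simp add: f_def)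
    have "result = coeff_vector N (g (int \<iota> - 1))"
      using zero by (simp add: result_def f_def)
    then show "solves_within W (euclid K pm pg pv) (residue_words W N)
      [[N], coeff_vector N (g (-1)), coeff_vector N (g 0)] (residue_words W N) {[coeff_vector N (g (int \<iota> - 1))]}
      ((B (c + \<iota> - 1) d \<iota> - real \<iota> * (real \<iota> - 1) / 2) * Mmod N + B c d \<iota> * (2400 * log 2 (real N))
        + C2 * (2 * (real \<iota> - 1) * M (bit_length N) * ln (real N)))"
      using solves_within_mono[OF solves[OF rs] _ cost[OF rs]] zero by simp
  next
    fix N c d \<iota> g
    assume rs: "remainder_sequence N c d \<iota> g" and nz: "g (int \<iota>) \<noteq> \<zero>\<^bsub>Zmod_poly N\<^esub>"
    interpret euclid_execution W "residue_words W N" N K pm "Mmod N" pg pv "G N" c d \<iota> g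
      by (rule execution[OF rs])
    let ?a = "rep (f (Suc \<iota>)) (deg R (f (Suc \<iota>)))"
    have nz': "f (Suc \<iota>) \<noteq> \<zero>\<^bsub>P\<^esub>" using nz by (simp add: f_def)
    \<comment> \<open>Since the leading coefficient is nonzero and less than \<open>N\<close>, the
      gcd cannot be \<open>N\<close>; it is not 1 because the coefficient is not a unit.\<close>
    have "gcd ?a N \<le> ?a" using rep_lead_not_unit(2)[OF nz'] by (intro dvd_imp_le) auto
    then have "proper_divisor (gcd ?a N) N"
      using rep_lead_not_unit(1)[OF nz'] rep_less[OF f_closed, of "Suc \<iota>" "deg R (f (Suc \<iota>))"]
      by (auto simp: proper_divisor_def coprime_iff_gcd_eq_1)
    then have "{[result]} \<subseteq> {[[m]] | m. proper_divisor m N}"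
      using nz' by (simp add: result_def)
    moreover have "2 * (real \<iota> - 1) + 1 = 2 * real \<iota> - 1" by simp
    ultimately show "solves_within W (euclid K pm pg pv) (residue_words W N)
      [[N], coeff_vector N (g (-1)), coeff_vector N (g 0)] (residue_words W N) {[[m]] | m. proper_divisor m N}
      ((B (c + \<iota> - 1) d \<iota> - real \<iota> * (real \<iota> - 1) / 2) * Mmod N + B c d \<iota> * (2400 * log 2 (real N))
        + C2 * ((2 * real \<iota> - 1) * M (bit_length N) * ln (real N)))"
      using solves_within_mono[OF solves[OF rs] _ cost[OF rs]] nz by simp
  qed
qed

end
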